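(* Let $\mathbf X=\rho(t,x)\partial_t+\phi^0(t,x)\partial_x$ be a $\lambda$-symmetry of $x_2=F(t,x,x_1)$ for some $\lambda=\lambda(t,x,x_1)$, and let $\psi=\psi(t,x,x_1)$ be a particular solution of the linear PDE $$\psi_t+\psi_xx_1+\psi_{x_1}F+\psi\lambda=D_t(\rho)\lambda+\rho\lambda^2+\mathbf X^{[\lambda,(1)]}(\lambda).$$ Then: (a) the vector field $\mathbf v=e^w\big(\rho(t,x)\partial_t+\phi^0(t,x)\partial_x+\psi(t,x,x_1)\partial_w\big)$ is a (generalized) symmetry of the system $x_2=F(t,x,x_1)$, $w_1=\lambda(t,x,x_1)$, and it is a nonlocal symmetry of $x_2=F$ associated to this system; (b) if $z=z(t,x)$ and $\zeta=\zeta(t,x,x_1)$ are functionally independent invariants of $\mathbf X^{[\lambda,(1)]}$ with $\zeta_{x_1}\neq0$, then $\mathbf v(z)=0$, $\mathbf v^{(1)}(\zeta)|_\Delta=0$, and $x_2=F$ can be written in terms of $\{z,\zeta,\zeta_z\}$ as a first-order ODE.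
   Context: For smooth $H=H(t,x,x_1)$, $(S_H)$ denotes the system $x_2=F(t,x,x_1)$, $w_1=H(t,x,x_1)$ in dependent variables $x,w$, and $\Delta$ the submanifold it defines. $\widetilde D_t=\partial_t+x_1\partial_x+x_2\partial_{x_1}+w_1\partial_w+\cdots$, $D_t=\partial_t+x_1\partial_x+x_2\partial_{x_1}+\cdots$, $\zeta_z=D_t\zeta/D_tz$. For $\mathbf v=\xi\partial_t+\eta^0\partial_x+\psi^0\partial_w$ with coefficients depending on $(t,x,x_1,w)$, $\mathbf v^{(k)}$ adds $\sum_{i=1}^k(\eta^i\partial_{x_i}+\psi^i\partial_{w_i})$, $\eta^i=\widetilde D_t(\eta^{i-1})-\widetilde D_t(\xi)x_i$, $\psi^i=\widetilde D_t(\psi^{i-1})-\widetilde D_t(\xi)w_i$; $\mathbf v$ is a (generalized) symmetry of $(S_H)$ if $\mathbf v^{(2)}(x_2-F)$, $\mathbf v^{(2)}(w_1-H)$ vanish on $\Delta$. A nonlocal symmetry of $x_2=F$ associated to $(S_H)$ is such a symmetry with $(\xi_w)^2+(\eta^0_w)^2\ne0$ for which there exist functionally independent $z=z(t,x)$, $\zeta=\zeta(t,x,x_1)$ (with $\zeta_{x_1}\ne0$) such that $\mathbf v(z)=0$, $\mathbf v^{(1)}(\zeta)|_\Delta=0$, and $x_2=F$ can be written in terms of $\{z,\zeta,\zeta_z\}$ as a first-order ODE. For $\lambda=\lambda(t,x,x_1)$ and $\mathbf X=\rho(t,x)\partial_t+\phi^0(t,x)\partial_x$, $\mathbf{X}^{[\lambda,(k)]}=\rho\partial_t+\phi^0\partial_x+\sum_{i=1}^k\phi^{[\lambda,(i)]}\partial_{x_i}$,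 $\phi^{[\lambda,(0)]}=\phi^0$, $\phi^{[\lambda,(i)]}=D_t(\phi^{[\lambda,(i-1)]})-D_t(\rho)x_i+\lambda(\phi^{[\lambda,(i-1)]}-\rho x_i)$; $(\mathbf X,\lambda)$ defines a $\lambda$-symmetry of $x_2=F$ if $\mathbf X^{[\lambda,(2)]}$ is tangent to $\{x_2=F\}$.
   Formalization: X is assumed not identically zero (else (a) fails). Nonlocal symmetry asks for z, ζ only on some nonempty open set. In (b) the first-order form is claimed locally, near points where D_t z≠0 and X^{[λ,(1)]}≠0 (else ζ_z is undefined or it can fail); its regularity is not stated. *)

theory Defs
  imports "HOL-Analysis.Analysis"
begin

datatype coord = CT | CX | CX1

definition pd3 :: "coord \<Rightarrow> (real \<Rightarrow> real \<Rightarrow> real \<Rightarrow> real) \<Rightarrow> (real \<Rightarrow> real \<Rightarrow> real \<Rightarrow> real)" where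
  "pd3 c f = (case c of
      CT \<Rightarrow> (\<lambda>t x y. deriv (\<lambda>s. f s x y) t)
    | CX \<Rightarrow> (\<lambda>t x y. deriv (\<lambda>s. f t s y) x)
    | CX1 \<Rightarrow> (\<lambda>t x y. deriv (\<lambda>s. f t x s) y))"

fun ipd :: "coord list \<Rightarrow> (real \<Rightarrow> real \<Rightarrow> real \<Rightarrow> real) \<Rightarrow> (real \<Rightarrow> real \<Rightarrow> real \<Rightarrow> real)" where
  "ipd [] f = f"
| "ipd (c # cs) f = pd3 c (ipd cs f)"

definition smooth3 :: "(real \<times> real \<times> real) set \<Rightarrow> (real \<Rightarrow> real \<Rightarrow> real \<Rightarrow> real) \<Rightarrow> bool" where
  "smooth3 U f \<longleftrightarrow>
     (\<forall>cs. continuous_on U (\<lambda>(t, x, y). ipd cs f t x y) \<and>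
        (\<forall>(t, x, y) \<in> U.
            (\<lambda>s. ipd cs f s x y) differentiable (at t) \<and>
            (\<lambda>s. ipd cs f t s y) differentiable (at x) \<and>
            (\<lambda>s. ipd cs f t x s) differentiable (at y)))"

text \<open>Functional independence of f, g on U: their gradients are linearly independent
  at every point (the 2x3 Jacobian has rank 2, i.e. some 2x2 minor is nonzero).\<close>
definition func_indep :: "(real \<times> real \<times> real) set \<Rightarrow> (real \<Rightarrow> real \<Rightarrow> real \<Rightarrow> real)
     \<Rightarrow> (real \<Rightarrow> real \<Rightarrow> real \<Rightarrow> real) \<Rightarrow> bool" where
  "func_indep U f g \<longleftrightarrow> (\<forall>(t, x, y) \<in> U.
      pd3 CT f t x y * pd3 CX g t x y - pd3 CX f t x y * pd3 CT g t x y \<noteq> 0 \<or>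
      pd3 CT f t x y * pd3 CX1 g t x y - pd3 CX1 f t x y * pd3 CT g t x y \<noteq> 0 \<or>
      pd3 CX f t x y * pd3 CX1 g t x y - pd3 CX1 f t x y * pd3 CX g t x y \<noteq> 0)"

text \<open>A jet point (t, (x_i)_i, (w_i)_i): x_0 = x, x_1, x_2, ... and w_0 = w, w_1, ...\<close>
type_synonym jet = "real \<times> (nat \<Rightarrow> real) \<times> (nat \<Rightarrow> real)"

definition jt :: "jet \<Rightarrow> real" where "jt p = fst p"
definition jx :: "jet \<Rightarrow> nat \<Rightarrow> real" where "jx p = fst (snd p)"
definition jw :: "jet \<Rightarrow> nat \<Rightarrow> real" where "jw p = snd (snd p)"

definition base :: "jet \<Rightarrow> real \<times> real \<times> real" where
  "base p = (jt p, jx p 0, jx p 1)"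

definition lift :: "(real \<Rightarrow> real \<Rightarrow> real \<Rightarrow> real) \<Rightarrow> jet \<Rightarrow> real" where
  "lift f p = f (jt p) (jx p 0) (jx p 1)"

text \<open>a jet point over (t,x,x1) (higher coordinates set to 0; used only for quantities
  depending on (t,x,x1) alone)\<close>
definition jet_at :: "real \<times> real \<times> real \<Rightarrow> jet" where
  "jet_at q = (fst q, (\<lambda>i. if i = 0 then fst (snd q) else if i = 1 then snd (snd q) else 0), (\<lambda>_. 0))"

definition pdt :: "(jet \<Rightarrow> real) \<Rightarrow> jet \<Rightarrow> real" where
  "pdt f p = deriv (\<lambda>s. f (s, jx p, jw p)) (jt p)"
definition pdx :: "nat \<Rightarrow> (jet \<Rightarrow> real) \<Rightarrow> jet \<Rightarrow> real" where
  "pdx i f p = deriv (\<lambda>s. f (jt p, (jx p)(i := s), jw p)) (jx p i)"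
definition pdw :: "nat \<Rightarrow> (jet \<Rightarrow> real) \<Rightarrow> jet \<Rightarrow> real" where
  "pdw i f p = deriv (\<lambda>s. f (jt p, jx p, (jw p)(i := s))) (jw p i)"

definition TDt :: "(jet \<Rightarrow> real) \<Rightarrow> jet \<Rightarrow> real" where
  "TDt f p = pdt f p + (\<Sum>i. jx p (Suc i) * pdx i f p + jw p (Suc i) * pdw i f p)"

text \<open>Total derivative D_t = d_t + x_1 d_x + x_2 d_{x_1} + ... (functions not involving w)\<close>
definition Dt :: "(jet \<Rightarrow> real) \<Rightarrow> jet \<Rightarrow> real" where
  "Dt f p = pdt f p + (\<Sum>i. jx p (Suc i) * pdx i f p)"

fun eta :: "(jet \<Rightarrow> real) \<Rightarrow> (jet \<Rightarrow> real) \<Rightarrow> nat \<Rightarrow> jet \<Rightarrow> real" where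
  "eta xi eta0 0 = eta0"
| "eta xi eta0 (Suc i) = (\<lambda>p. TDt (eta xi eta0 i) p - TDt xi p * jx p (Suc i))"

fun psiP :: "(jet \<Rightarrow> real) \<Rightarrow> (jet \<Rightarrow> real) \<Rightarrow> nat \<Rightarrow> jet \<Rightarrow> real" where
  "psiP xi psi0 0 = psi0"
| "psiP xi psi0 (Suc i) = (\<lambda>p. TDt (psiP xi psi0 i) p - TDt xi p * jw p (Suc i))"

definition prol :: "nat \<Rightarrow> (jet \<Rightarrow> real) \<Rightarrow> (jet \<Rightarrow> real) \<Rightarrow> (jet \<Rightarrow> real)
     \<Rightarrow> (jet \<Rightarrow> real) \<Rightarrow> jet \<Rightarrow> real" where
  "prol k xi eta0 psi0 G p = xi p * pdt G p +
     (\<Sum>i\<le>k. eta xi eta0 i p * pdx i G p + psiP xi psi0 i p * pdw i G p)"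

text \<open>The submanifold Delta of (S_H): x_2 = F, w_1 = H, together with the differential
  consequence w_2 = D_t H needed to evaluate the second prolongation.\<close>
definition inDelta :: "(real \<Rightarrow> real \<Rightarrow> real \<Rightarrow> real) \<Rightarrow> (real \<Rightarrow> real \<Rightarrow> real \<Rightarrow> real) \<Rightarrow> jet \<Rightarrow> bool" where
  "inDelta F H p \<longleftrightarrow> jx p 2 = lift F p \<and> jw p 1 = lift H p \<and> jw p 2 = Dt (lift H) p"

definition gen_symmetry :: "(real \<times> real \<times> real) set \<Rightarrow> (real \<Rightarrow> real \<Rightarrow> real \<Rightarrow> real)
     \<Rightarrow> (real \<Rightarrow> real \<Rightarrow> real \<Rightarrow> real) \<Rightarrow> (jet \<Rightarrow> real) \<Rightarrow> (jet \<Rightarrow> real) \<Rightarrow> (jet \<Rightarrow> real) \<Rightarrow> bool" where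
  "gen_symmetry \<Omega> F H xi eta0 psi0 \<longleftrightarrow>
     (\<forall>p. base p \<in> \<Omega> \<and> inDelta F H p \<longrightarrow>
        prol 2 xi eta0 psi0 (\<lambda>q. jx q 2 - lift F q) p = 0 \<and>
        prol 2 xi eta0 psi0 (\<lambda>q. jw q 1 - lift H q) p = 0)"

text \<open>x_2 = F can be written, on V, as a first-order ODE in terms of z, zeta, zeta_z
  (zeta_z = D_t zeta / D_t z, with D_t z nonvanishing on V).\<close>
definition ode_form :: "(real \<times> real \<times> real) set \<Rightarrow> (real \<Rightarrow> real \<Rightarrow> real \<Rightarrow> real)
     \<Rightarrow> (jet \<Rightarrow> real) \<Rightarrow> (jet \<Rightarrow> real) \<Rightarrow> bool" where
  "ode_form V F Z Zeta \<longleftrightarrow>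
     (\<forall>p. base p \<in> V \<longrightarrow> Dt Z p \<noteq> 0) \<and>
     (\<exists>\<Phi> :: real \<Rightarrow> real \<Rightarrow> real \<Rightarrow> real. \<forall>p. base p \<in> V \<longrightarrow>
        (jx p 2 = lift F p \<longleftrightarrow> \<Phi> (Z p) (Zeta p) (Dt Zeta p / Dt Z p) = 0))"

definition nonlocal_symmetry :: "(real \<times> real \<times> real) set \<Rightarrow> (real \<Rightarrow> real \<Rightarrow> real \<Rightarrow> real)
     \<Rightarrow> (real \<Rightarrow> real \<Rightarrow> real \<Rightarrow> real) \<Rightarrow> (jet \<Rightarrow> real) \<Rightarrow> (jet \<Rightarrow> real) \<Rightarrow> (jet \<Rightarrow> real) \<Rightarrow> bool" where
  "nonlocal_symmetry \<Omega> F H xi eta0 psi0 \<longleftrightarrow>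
     gen_symmetry \<Omega> F H xi eta0 psi0 \<and>
     (\<exists>p. base p \<in> \<Omega> \<and> (pdw 0 xi p)\<^sup>2 + (pdw 0 eta0 p)\<^sup>2 \<noteq> 0) \<and>
     (\<exists>V (z :: real \<Rightarrow> real \<Rightarrow> real) (\<zeta> :: real \<Rightarrow> real \<Rightarrow> real \<Rightarrow> real).
        open V \<and> V \<noteq> {} \<and> V \<subseteq> \<Omega> \<and>
        smooth3 V (\<lambda>t x y. z t x) \<and> smooth3 V \<zeta> \<and>
        func_indep V (\<lambda>t x y. z t x) \<zeta> \<and>
        (\<forall>(t, x, y) \<in> V. pd3 CX1 \<zeta> t x y \<noteq> 0) \<and>
        (\<forall>p. base p \<in> V \<longrightarrow> prol 0 xi eta0 psi0 (lift (\<lambda>t x y. z t x)) p = 0) \<and>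
        (\<forall>p. base p \<in> V \<and> inDelta F H p \<longrightarrow> prol 1 xi eta0 psi0 (lift \<zeta>) p = 0) \<and>
        ode_form V F (lift (\<lambda>t x y. z t x)) (lift \<zeta>))"

fun phiL :: "(real \<Rightarrow> real \<Rightarrow> real \<Rightarrow> real) \<Rightarrow> (real \<Rightarrow> real \<Rightarrow> real) \<Rightarrow> (real \<Rightarrow> real \<Rightarrow> real)
     \<Rightarrow> nat \<Rightarrow> jet \<Rightarrow> real" where
  "phiL lam rho phi0 0 = lift (\<lambda>t x y. phi0 t x)"
| "phiL lam rho phi0 (Suc i) = (\<lambda>p. Dt (phiL lam rho phi0 i) p
      - Dt (lift (\<lambda>t x y. rho t x)) p * jx p (Suc i)
      + lift lam p * (phiL lam rho phi0 i p - lift (\<lambda>t x y. rho t x) p * jx p (Suc i)))"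

definition XL :: "nat \<Rightarrow> (real \<Rightarrow> real \<Rightarrow> real \<Rightarrow> real) \<Rightarrow> (real \<Rightarrow> real \<Rightarrow> real) \<Rightarrow> (real \<Rightarrow> real \<Rightarrow> real)
     \<Rightarrow> (jet \<Rightarrow> real) \<Rightarrow> jet \<Rightarrow> real" where
  "XL k lam rho phi0 G p = rho (jt p) (jx p 0) * pdt G p +
     (\<Sum>i\<le>k. phiL lam rho phi0 i p * pdx i G p)"

definition lambda_symmetry :: "(real \<times> real \<times> real) set \<Rightarrow> (real \<Rightarrow> real \<Rightarrow> real \<Rightarrow> real)
     \<Rightarrow> (real \<Rightarrow> real \<Rightarrow> real \<Rightarrow> real) \<Rightarrow> (real \<Rightarrow> real \<Rightarrow> real) \<Rightarrow> (real \<Rightarrow> real \<Rightarrow> real) \<Rightarrow> bool" where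
  "lambda_symmetry \<Omega> F lam rho phi0 \<longleftrightarrow>
     (\<forall>p. base p \<in> \<Omega> \<and> jx p 2 = lift F p \<longrightarrow>
        XL 2 lam rho phi0 (\<lambda>q. jx q 2 - lift F q) p = 0)"

end

theory Submission
  imports Defs
begin

text \<open>
  On the submanifold \<open>\<Delta>\<close> one has \<open>w\<^sub>1 = \<lambda>\<close> and \<open>w\<^sub>2 = D\<^sub>t \<lambda>\<close>, which turns the prolongation coefficients of
  \<open>e\<^sup>w (\<rho> \<partial>\<^sub>t + \<phi>\<^sub>0 \<partial>\<^sub>x)\<close> into \<open>e\<^sup>w\<close> times those of the \<open>\<lambda>\<close>-prolongation, so \<open>x\<^sub>2 = F\<close> is preserved because \<open>X\<close> is
  a \<open>\<lambda>\<close>-symmetry; the PDE for \<open>\<psi>\<close> says exactly that \<open>w\<^sub>1 = \<lambda>\<close> is preserved as well.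

  Let \<open>X\<close> be the first \<open>\<lambda>\<close>-prolongation and \<open>A = \<partial>\<^sub>t + x\<^sub>1 \<partial>\<^sub>x + F \<partial>\<^bsub>x\<^sub>1\<^esub>\<close>. The \<open>\<lambda>\<close>-symmetry condition amounts to
  \<open>[X, A] = \<lambda> X + \<mu> A\<close>, so for invariants \<open>z, \<zeta>\<close> of \<open>X\<close> the quotient \<open>A \<zeta> / A z\<close> is again invariant, hence locally a
  function of \<open>(z, \<zeta>)\<close>; since \<open>\<zeta>\<^bsub>x\<^sub>1\<^esub> \<noteq> 0\<close>, the equation \<open>x\<^sub>2 = F\<close> is equivalent to \<open>\<zeta>\<^sub>z\<close> being equal to that function.

  Invariants exist near a point where \<open>(\<rho>, \<phi>\<^sub>0) \<noteq> 0\<close>: \<open>z\<close> is a first integral of a scalar ODE, and in coordinates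
  containing \<open>z\<close> the function \<open>\<zeta>\<close> is a first integral of a scalar ODE with parameter \<open>z\<close>. For scalar equations the
  parameter derivatives of the solution are given by explicit integrals in the solution itself, so a continuous solution
  (obtained from Banach's fixed point theorem, jointly in time and parameter) is automatically smooth.
\<close>

section \<open>Functions of class Ck\<close>

text \<open>Smoothness in the statement means iterated partial derivatives, a notion that is clumsy
  under composition and inversion. The analysis therefore uses \<open>Ck\<close>, where a Frechet
  derivative is tested in each fixed direction: the derivatives have the same type as the function,
  so inductions on the order never leave that type.

  Two obstacles shrink the final neighbourhood. The quotient \<zeta>_z needs D_t z to be nonzero; as
  z depends on t and x only, D_t z = z_t + x_1 z_x is affine in x_1, and a small change of x_1 makes
  it nonzero. Moreover, invariance makes A \<zeta> / A z constant only along orbits of X, while a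
  level set of (z, \<zeta>) may have several pieces; hence the passage to a box in which each level
  set lies on a single orbit segment. The function of (z, \<zeta>) then comes from choosing
  representatives, since the reduced equation is not asked to be regular.

  Nonlocality comes from the point where the field is nonzero: the w-derivatives of the first two
  coefficients of v are e^w \<rho> and e^w \<phi>_0.\<close>

fun Ck :: "nat \<Rightarrow> 'a::real_normed_vector set \<Rightarrow> ('a \<Rightarrow> 'b::real_normed_vector) \<Rightarrow> bool" where
  "Ck 0 U f \<longleftrightarrow> continuous_on U f"
| "Ck (Suc n) U f \<longleftrightarrow>
     (\<exists>D. (\<forall>x\<in>U. (f has_derivative D x) (at x)) \<and> (\<forall>v. Ck n U (\<lambda>x. D x v)))"

declare Ck.simps(2) [simp del]

lemma Ck_SucI:
  assumes "\<And>x. x \<in> U \<Longrightarrow> (f has_derivative D x) (at x)" "\<And>v. Ck n U (\<lambda>x. D x v)"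
  shows "Ck (Suc n) U f"
  using assms by (auto simp: Ck.simps(2))

lemma Ck_SucE:
  assumes "Ck (Suc n) U f"
  obtains D where "\<And>x. x \<in> U \<Longrightarrow> (f has_derivative D x) (at x)" "\<And>v. Ck n U (\<lambda>x. D x v)"
  using assms by (auto simp: Ck.simps(2))

lemma Ck_Suc_imp: "Ck (Suc n) U f \<Longrightarrow> Ck n U f"
proof (induction n arbitrary: f)
  case 0
  then show ?case
    by (auto elim!: Ck_SucE intro!: continuous_at_imp_continuous_on dest!: has_derivative_continuous)
next
  case (Suc n)
  then show ?case by (metis Ck.simps(2))
qed

lemma Ck_continuous_on: "Ck n U f \<Longrightarrow> continuous_on U f"
  by (induction n) (auto dest: Ck_Suc_imp)

lemma Ck_subset: "Ck n U f \<Longrightarrow> V \<subseteq> U \<Longrightarrow> Ck n V f"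
proof (induction n arbitrary: f)
  case 0 then show ?case by (auto intro: continuous_on_subset)
next
  case (Suc n)
  then obtain D where "\<And>x. x \<in> U \<Longrightarrow> (f has_derivative D x) (at x)" "\<And>v. Ck n U (\<lambda>x. D x v)"
    using Ck_SucE by blast
  with Suc show ?case by (intro Ck_SucI[of V f D]) auto
qed

lemma Ck_cong:
  assumes "open U" "\<And>x. x \<in> U \<Longrightarrow> f x = g x" "Ck n U f"
  shows "Ck n U g"
  using assms
proof (cases n)
  case 0 then show ?thesis using assms by (auto cong: continuous_on_cong)
next
  case (Suc m)
  then obtain D where D: "\<And>x. x \<in> U \<Longrightarrow> (f has_derivative D x) (at x)" "\<And>v. Ck m U (\<lambda>x. D x v)"
    using Ck_SucE assms(3) by blast
  have "(g has_derivative D x) (at x)" if "x \<in> U" for x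
    by (rule has_derivative_transform_within_open[OF D(1)[OF that] assms(1) that assms(2)])
  with D(2) show ?thesis unfolding Suc by (intro Ck_SucI) auto
qed

lemma Ck_const [simp, intro]: "Ck n U (\<lambda>x. c)"
proof (induction n arbitrary: c)
  case (Suc n)
  show ?case by (rule Ck_SucI[where D="\<lambda>x v. 0"]) (auto simp: Suc)
qed auto

lemma Ck_bounded_linear: "bounded_linear f \<Longrightarrow> Ck n U f"
proof (cases n)
  case (Suc m)
  assume "bounded_linear f"
  then show ?thesis unfolding Suc
    by (intro Ck_SucI[where D="\<lambda>x. f"]) (auto simp: bounded_linear_imp_has_derivative)
qed (auto simp: linear_continuous_on)

lemma Ck_ident [simp, intro]: "Ck n U (\<lambda>x. x)"
  by (rule Ck_bounded_linear) (rule bounded_linear_ident)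

lemma Ck_linear_comp: "bounded_linear L \<Longrightarrow> Ck n U f \<Longrightarrow> Ck n U (\<lambda>x. L (f x))"
proof (induction n arbitrary: f)
  case 0 then show ?case
    by (auto intro: bounded_linear.continuous_on)
next
  case (Suc n)
  from Suc.prems obtain D where D: "\<And>x. x \<in> U \<Longrightarrow> (f has_derivative D x) (at x)" "\<And>v. Ck n U (\<lambda>x. D x v)"
    using Ck_SucE by blast
  show ?case
    by (rule Ck_SucI[where D="\<lambda>x v. L (D x v)"])
       (auto intro: Suc D bounded_linear.has_derivative)
qed

lemma Ck_fst: "Ck n U f \<Longrightarrow> Ck n U (\<lambda>x. fst (f x))"
  and Ck_snd: "Ck n U f \<Longrightarrow> Ck n U (\<lambda>x. snd (f x))"
  by (rule Ck_linear_comp; simp add: bounded_linear_fst bounded_linear_snd)+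

lemma Ck_add:
  "Ck n U f \<Longrightarrow> Ck n U g \<Longrightarrow> Ck n U (\<lambda>x. f x + g x)"
proof (induction n arbitrary: f g)
  case 0 then show ?case by (auto intro: continuous_intros)
next
  case (Suc n)
  obtain D where D: "\<And>x. x \<in> U \<Longrightarrow> (f has_derivative D x) (at x)" "\<And>v. Ck n U (\<lambda>x. D x v)"
    using Ck_SucE Suc.prems(1) by blast
  obtain E where E: "\<And>x. x \<in> U \<Longrightarrow> (g has_derivative E x) (at x)" "\<And>v. Ck n U (\<lambda>x. E x v)"
    using Ck_SucE Suc.prems(2) by blast
  show ?case
    by (rule Ck_SucI[where D="\<lambda>x v. D x v + E x v"]) (auto intro: Suc D E has_derivative_add)
qed

lemma Ck_Pair:
  "Ck n U f \<Longrightarrow> Ck n U g \<Longrightarrow> Ck n U (\<lambda>x. (f x, g x))"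
proof (induction n arbitrary: f g)
  case 0 then show ?case by (auto intro: continuous_intros)
next
  case (Suc n)
  obtain D where D: "\<And>x. x \<in> U \<Longrightarrow> (f has_derivative D x) (at x)" "\<And>v. Ck n U (\<lambda>x. D x v)"
    using Ck_SucE Suc.prems(1) by blast
  obtain E where E: "\<And>x. x \<in> U \<Longrightarrow> (g has_derivative E x) (at x)" "\<And>v. Ck n U (\<lambda>x. E x v)"
    using Ck_SucE Suc.prems(2) by blast
  show ?case
    by (rule Ck_SucI[where D="\<lambda>x v. (D x v, E x v)"]) (auto intro: Suc D E has_derivative_Pair)
qed

lemma Ck_scaleR:
  fixes f :: "'a::real_normed_vector \<Rightarrow> real"
  shows "Ck n U f \<Longrightarrow> Ck n U g \<Longrightarrow> Ck n U (\<lambda>x. f x *\<^sub>R g x)"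
proof (induction n arbitrary: f g)
  case 0 then show ?case by (auto intro: continuous_intros)
next
  case (Suc n)
  obtain D where D: "\<And>x. x \<in> U \<Longrightarrow> (f has_derivative D x) (at x)" "\<And>v. Ck n U (\<lambda>x. D x v)"
    using Ck_SucE Suc.prems(1) by blast
  obtain E where E: "\<And>x. x \<in> U \<Longrightarrow> (g has_derivative E x) (at x)" "\<And>v. Ck n U (\<lambda>x. E x v)"
    using Ck_SucE Suc.prems(2) by blast
  show ?case
    by (rule Ck_SucI[where D="\<lambda>x v. f x *\<^sub>R E x v + D x v *\<^sub>R g x"])
       (auto intro!: Ck_add Suc.IH D E has_derivative_scaleR Ck_Suc_imp[OF Suc.prems(1)] Ck_Suc_imp[OF Suc.prems(2)])
qed

lemma Ck_mult:
  fixes f g :: "'a::real_normed_vector \<Rightarrow> real"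
  shows "Ck n U f \<Longrightarrow> Ck n U g \<Longrightarrow> Ck n U (\<lambda>x. f x * g x)"
  using Ck_scaleR[of n U f g] by simp

lemma Ck_minus: "Ck n U f \<Longrightarrow> Ck n U (\<lambda>x. - f x)"
  by (rule Ck_linear_comp[where L=uminus]) (simp add: bounded_linear_minus)

lemma Ck_diff: "Ck n U f \<Longrightarrow> Ck n U g \<Longrightarrow> Ck n U (\<lambda>x. f x - g x)"
  using Ck_add[OF _ Ck_minus, of n U f g] by simp

lemma Ck_sum: "(\<And>i. i \<in> I \<Longrightarrow> Ck n U (f i)) \<Longrightarrow> Ck n U (\<lambda>x. \<Sum>i\<in>I. f i x)"
  by (induction I rule: infinite_finite_induct) (auto intro: Ck_add)

lemma Ck_inverse:
  fixes f :: "'a::real_normed_vector \<Rightarrow> real"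
  shows "Ck n U f \<Longrightarrow> (\<And>x. x \<in> U \<Longrightarrow> f x \<noteq> 0) \<Longrightarrow> Ck n U (\<lambda>x. inverse (f x))"
proof (induction n)
  case 0 then show ?case by (auto intro!: continuous_intros)
next
  case (Suc n)
  obtain D where D: "\<And>x. x \<in> U \<Longrightarrow> (f has_derivative D x) (at x)" "\<And>v. Ck n U (\<lambda>x. D x v)"
    using Ck_SucE Suc.prems(1) by blast
  have I: "Ck n U (\<lambda>x. inverse (f x))"
    using Suc.IH Suc.prems Ck_Suc_imp by blast
  show ?case
    by (rule Ck_SucI[where D="\<lambda>x v. - (inverse (f x) * D x v * inverse (f x))"])
       (use Suc.prems(2) in \<open>auto intro!: Ck_minus Ck_mult I D(2) Deriv.has_derivative_inverse[OF _ D(1)]\<close>)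
qed

lemma Ck_divide:
  fixes f :: "'a::real_normed_vector \<Rightarrow> real"
  shows "Ck n U f \<Longrightarrow> Ck n U g \<Longrightarrow> (\<And>x. x \<in> U \<Longrightarrow> g x \<noteq> 0) \<Longrightarrow> Ck n U (\<lambda>x. f x / g x)"
  unfolding divide_inverse by (intro Ck_mult Ck_inverse)

lemma Ck_exp:
  fixes f :: "'a::real_normed_vector \<Rightarrow> real"
  shows "Ck n U f \<Longrightarrow> Ck n U (\<lambda>x. exp (f x))"
proof (induction n)
  case 0 then show ?case by (auto intro!: continuous_intros)
next
  case (Suc n)
  obtain D where D: "\<And>x. x \<in> U \<Longrightarrow> (f has_derivative D x) (at x)" "\<And>v. Ck n U (\<lambda>x. D x v)"
    using Ck_SucE Suc.prems(1) by blast
  have I: "Ck n U (\<lambda>x. exp (f x))"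
    using Suc.IH Suc.prems Ck_Suc_imp by blast
  show ?case
    by (rule Ck_SucI[where D="\<lambda>x v. exp (f x) * D x v"])
       (auto intro!: Ck_mult I D(2) derivative_eq_intros D(1))
qed

text \<open>The chain rule yields \<open>D (h x) (E x v)\<close>, whose direction moves with
  \<open>x\<close>, whereas \<open>Ck\<close> speaks of fixed directions. Expanding
  \<open>E x v\<close> in a basis repairs this, which is why the codomain of \<open>h\<close> is
  Euclidean.\<close>

lemma Ck_compose:
  fixes h :: "'a::real_normed_vector \<Rightarrow> 'b::euclidean_space"
  shows "Ck n U f \<Longrightarrow> Ck n V h \<Longrightarrow> h ` V \<subseteq> U \<Longrightarrow> Ck n V (\<lambda>x. f (h x))"
proof (induction n arbitrary: f)
  case 0 then show ?case by (auto intro: continuous_on_compose2)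
next
  case (Suc n)
  obtain D where D: "\<And>x. x \<in> U \<Longrightarrow> (f has_derivative D x) (at x)" "\<And>v. Ck n U (\<lambda>x. D x v)"
    using Ck_SucE Suc.prems(1) by blast
  obtain E where E: "\<And>x. x \<in> V \<Longrightarrow> (h has_derivative E x) (at x)" "\<And>v. Ck n V (\<lambda>x. E x v)"
    using Ck_SucE Suc.prems(2) by blast
  have h: "Ck n V h" using Suc.prems(2) Ck_Suc_imp by blast
  show ?case
  proof (rule Ck_SucI[where D="\<lambda>x v. \<Sum>b\<in>Basis. (E x v \<bullet> b) *\<^sub>R D (h x) b"])
    fix x assume x: "x \<in> V"
    then have hx: "h x \<in> U" using Suc.prems by auto
    have "((\<lambda>x. f (h x)) has_derivative (\<lambda>v. D (h x) (E x v))) (at x)"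
      by (rule has_derivative_compose[OF E(1)[OF x] D(1)[OF hx]])
    moreover have "D (h x) (E x v) = (\<Sum>b\<in>Basis. (E x v \<bullet> b) *\<^sub>R D (h x) b)" for v
    proof -
      have lin: "linear (D (h x))" using D(1)[OF hx] has_derivative_linear by blast
      have "D (h x) (E x v) = D (h x) (\<Sum>b\<in>Basis. (E x v \<bullet> b) *\<^sub>R b)"
        by (simp add: euclidean_representation)
      also have "\<dots> = (\<Sum>b\<in>Basis. (E x v \<bullet> b) *\<^sub>R D (h x) b)"
        by (simp add: linear_sum[OF lin] linear_cmul[OF lin])
      finally show ?thesis .
    qed
    ultimately show "((\<lambda>x. f (h x)) has_derivative (\<lambda>v. \<Sum>b\<in>Basis. (E x v \<bullet> b) *\<^sub>R D (h x) b)) (at x)"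
      by simp
  next
    fix v
    show "Ck n V (\<lambda>x. \<Sum>b\<in>Basis. (E x v \<bullet> b) *\<^sub>R D (h x) b)"
      by (intro Ck_sum Ck_scaleR Suc.IH D h Suc.prems Ck_linear_comp[OF _ E(2)] bounded_linear_inner_left)
  qed
qed

text \<open>Differentiation under the integral sign in direction \<open>v\<close> leads to the
  integral of \<open>D (x, \<theta>) (v, 0)\<close>, again a parameter integral but of one order
  less, so the induction closes.\<close>

lemma Ck_integral_param:
  fixes h :: "'a::euclidean_space \<times> real \<Rightarrow> real"
  assumes "open U" "U \<times> {0..1} \<subseteq> T" "Ck n T h"
  shows "Ck n U (\<lambda>x. integral {0..1} (\<lambda>\<theta>. h (x, \<theta>)))"
  using assms(3)
proof (induction n arbitrary: h)
  case 0
  then have "continuous_on (U \<times> cbox 0 1) (\<lambda>(x, t). h (x, t))"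
    using assms(2) by (auto intro: continuous_on_subset)
  from integral_continuous_on_param[OF this] show ?case by simp
next
  case (Suc n)
  obtain D where D: "\<And>x. x \<in> T \<Longrightarrow> (h has_derivative D x) (at x)" "\<And>v. Ck n T (\<lambda>x. D x v)"
    using Ck_SucE Suc.prems by blast
  show ?case
  proof (rule Ck_SucI)
    fix v
    show "Ck n U (\<lambda>x. integral {0..1} (\<lambda>\<theta>. D (x, \<theta>) (v, 0)))"
      by (rule Suc.IH) (rule D)
  next
    fix x assume x: "x \<in> U"
    then obtain e where e: "e > 0" "ball x e \<subseteq> U"
      using assms(1) openE by blast
    \<comment> \<open>The Leibniz rule wants the derivative as a continuous map into the bounded
      linear operators; in finite dimension its continuity can be checked on basis vectors.\<close>
    define fx where "fx x \<theta> = Blinfun (\<lambda>v. D (x, \<theta>) (v, 0))" for x \<theta>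
    have fx: "blinfun_apply (fx y \<theta>) v = D (y, \<theta>) (v, 0)" if "y \<in> U" "\<theta> \<in> {0..1}" for y \<theta> v
    proof -
      have "bounded_linear (D (y, \<theta>))"
        using D(1) assms(2) that has_derivative_bounded_linear by blast
      then have "bounded_linear (\<lambda>v. D (y, \<theta>) (v, 0))"
        using bounded_linear_compose[of "D (y,\<theta>)" "\<lambda>v. (v, 0)"]
        by (simp add: bounded_linear_Pair bounded_linear_ident bounded_linear_zero)
      then show ?thesis by (simp add: fx_def bounded_linear_Blinfun_apply)
    qed
    have cont: "continuous_on (U \<times> {0..1}) h"
      using Ck_continuous_on[OF Suc.prems] assms(2) continuous_on_subset by blast
    have cfx: "continuous_on (ball x e \<times> cbox 0 1) (\<lambda>(x, t). fx x t)"
    proof (rule continuous_on_blinfun_componentwise)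
      fix i :: 'a
      have "continuous_on (U \<times> {0..1}) (\<lambda>x. D x (i, 0))"
        using Ck_continuous_on[OF D(2)] assms(2) continuous_on_subset by blast
      then have "continuous_on (ball x e \<times> {0..1}) (\<lambda>x. D x (i, 0))"
        by (rule continuous_on_subset) (use e in auto)
      then show "continuous_on (ball x e \<times> cbox 0 1) (\<lambda>z. blinfun_apply (case z of (x, t) \<Rightarrow> fx x t) i)"
        using e by (auto simp: fx split: prod.splits intro!: continuous_on_eq[of _ "\<lambda>x. D x (i, 0)"])
    qed
    have "((\<lambda>x. integral (cbox 0 1) (\<lambda>\<theta>. h (x, \<theta>))) has_derivative integral (cbox 0 1) (fx x)) (at x within ball x e)"
    proof (rule leibniz_rule[OF _ _ cfx])
      fix y t assume y: "y \<in> ball x e" and t: "t \<in> cbox 0 (1::real)"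
      then have yt: "y \<in> U" "(y, t) \<in> T" using e assms(2) by (auto simp: subset_iff)
      have "((\<lambda>x. h (x, t)) has_derivative (\<lambda>v. D (y, t) (v, 0))) (at y)"
        by (rule has_derivative_compose[where f="\<lambda>x. (x,t)", OF _ D(1)[OF yt(2)]])
           (auto intro!: derivative_eq_intros)
      moreover have "(\<lambda>v. D (y, t) (v, 0)) = blinfun_apply (fx y t)"
        using fx yt t by auto
      ultimately show "((\<lambda>x. h (x, t)) has_derivative blinfun_apply (fx y t)) (at y within ball x e)"
        by (simp add: has_derivative_at_withinI)
    next
      fix y assume "y \<in> ball x e"
      then have "y \<in> U" using e by auto
      then show "(\<lambda>\<theta>. h (y, \<theta>)) integrable_on cbox 0 1"
        by (intro integrable_continuous continuous_on_compose2[OF cont]) (auto intro!: continuous_intros)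
    qed (use e in auto)
    moreover have "blinfun_apply (integral (cbox 0 1) (fx x)) = (\<lambda>v. integral {0..1} (\<lambda>\<theta>. D (x, \<theta>) (v, 0)))"
    proof
      fix v
      have "continuous_on (cbox 0 1) (fx x)"
        using continuous_on_compose2[OF cfx, of "cbox 0 1" "\<lambda>t. (x,t)"] e
          continuous_on_Pair[OF continuous_on_const continuous_on_id, of "cbox 0 (1::real)" x]
        by (auto simp: image_subset_iff)
      then have "fx x integrable_on cbox 0 1" by (rule integrable_continuous)
      then have "blinfun_apply (integral (cbox 0 1) (fx x)) v = integral (cbox 0 1) (\<lambda>t. blinfun_apply (fx x t) v)"
        by (rule blinfun_apply_integral)
      also have "\<dots> = integral {0..1} (\<lambda>\<theta>. D (x, \<theta>) (v, 0))"
        using fx[OF x] by (auto intro!: integral_cong)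
      finally show "blinfun_apply (integral (cbox 0 1) (fx x)) v = integral {0..1} (\<lambda>\<theta>. D (x, \<theta>) (v, 0))" .
    qed
    ultimately show "((\<lambda>x. integral {0..1} (\<lambda>\<theta>. h (x, \<theta>))) has_derivative (\<lambda>v. integral {0..1} (\<lambda>\<theta>. D (x, \<theta>) (v, 0)))) (at x)"
      using e by (simp add: at_within_open[of x "ball x e"])
  qed
qed

definition smooth_on :: "'a::real_normed_vector set \<Rightarrow> ('a \<Rightarrow> 'b::real_normed_vector) \<Rightarrow> bool" where
  "smooth_on U f \<longleftrightarrow> (\<forall>n. Ck n U f)"

lemma smooth_onI: "(\<And>n. Ck n U f) \<Longrightarrow> smooth_on U f"
  by (simp add: smooth_on_def)

lemma smooth_onD: "smooth_on U f \<Longrightarrow> Ck n U f"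
  by (simp add: smooth_on_def)

text \<open>Each order provides its own derivative function; uniqueness of the Frechet derivative
  identifies them, so one \<open>D\<close> serves all orders at once.\<close>

lemma smooth_on_obtain_derivative:
  assumes "smooth_on U f" "open U"
  obtains D where "\<And>x. x \<in> U \<Longrightarrow> (f has_derivative D x) (at x)" "\<And>v. smooth_on U (\<lambda>x. D x v)"
proof -
  obtain D where D: "\<And>x. x \<in> U \<Longrightarrow> (f has_derivative D x) (at x)"
    using assms(1) Ck_SucE smooth_on_def by metis
  have "Ck n U (\<lambda>x. D x v)" for v n
  proof -
    obtain E where E: "\<And>x. x \<in> U \<Longrightarrow> (f has_derivative E x) (at x)" "\<And>v. Ck n U (\<lambda>x. E x v)"
      using assms(1) Ck_SucE smooth_on_def by metis
    then have "E x = D x" if "x \<in> U" for x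
      using D that has_derivative_unique by blast
    then show ?thesis using Ck_cong[OF assms(2) _ E(2)] by metis
  qed
  then show ?thesis using D that unfolding smooth_on_def by blast
qed


section \<open>Smooth dependence of scalar ODEs on parameters\<close>

text \<open>The integral of \<open>\<phi> (\<cdot>, p)\<close> from \<open>t0\<close> to \<open>t\<close>, rescaled to the unit interval: this makes sense on both sides of \<open>t0\<close>
  and turns the moving upper limit into a parameter.\<close>

definition pint :: "real \<Rightarrow> (real \<times> 'a \<Rightarrow> real) \<Rightarrow> real \<times> 'a \<Rightarrow> real" where
  "pint t0 \<phi> x = (fst x - t0) * integral {0..1} (\<lambda>\<theta>. \<phi> (t0 + \<theta> * (fst x - t0), snd x))"

lemma pint_init [simp]: "pint t0 \<phi> (t0, p) = 0"
  by (simp add: pint_def)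

lemma convex_segment_mem:
  fixes A :: "real set"
  assumes "convex A" "t0 \<in> A" "t \<in> A" "0 \<le> \<theta>" "\<theta> \<le> 1"
  shows "t0 + \<theta> * (t - t0) \<in> A"
proof -
  have "(1 - \<theta>) *\<^sub>R t0 + \<theta> *\<^sub>R t \<in> A"
    using assms by (intro convexD) auto
  then show ?thesis by (simp add: algebra_simps)
qed

lemma pint_integrand_continuous:
  fixes \<phi> :: "real \<times> 'a::topological_space \<Rightarrow> real"
  assumes "continuous_on (A \<times> B) \<phi>" "convex A" "t0 \<in> A" "t \<in> A" "p \<in> B"
  shows "continuous_on {0..1} (\<lambda>\<theta>. \<phi> (t0 + \<theta> * (t - t0), p))"
  by (rule continuous_on_compose2[OF assms(1)], intro continuous_intros)
     (use assms in \<open>auto intro!: convex_segment_mem\<close>)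

lemma pint_continuous_on:
  fixes \<phi> :: "real \<times> 'a::topological_space \<Rightarrow> real"
  assumes "continuous_on (A \<times> B) \<phi>" "convex A" "t0 \<in> A"
  shows "continuous_on (A \<times> B) (pint t0 \<phi>)"
proof -
  have "continuous_on ((A \<times> B) \<times> cbox 0 1) (\<lambda>(x, \<theta>). \<phi> (t0 + \<theta> * (fst x - t0), snd x))"
    unfolding split_beta
    by (rule continuous_on_compose2[OF assms(1)])
       (auto intro!: continuous_intros convex_segment_mem assms)
  from integral_continuous_on_param[OF this]
  have "continuous_on (A \<times> B) (\<lambda>x. integral {0..1} (\<lambda>\<theta>. \<phi> (t0 + \<theta> * (fst x - t0), snd x)))"
    by simp
  then show ?thesis
    unfolding pint_def by (intro continuous_intros)
qed

lemma pint_bound: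
  assumes "continuous_on (A \<times> B) \<phi>" "convex A" "t0 \<in> A" "t \<in> A" "p \<in> B"
    and "\<And>x. x \<in> A \<times> B \<Longrightarrow> \<bar>\<phi> x\<bar> \<le> M"
  shows "\<bar>pint t0 \<phi> (t, p)\<bar> \<le> \<bar>t - t0\<bar> * M"
proof -
  have "norm (integral {0..1} (\<lambda>\<theta>. \<phi> (t0 + \<theta> * (t - t0), p))) \<le> M * (1 - 0)"
    by (rule integral_bound)
       (use assms in \<open>auto intro!: pint_integrand_continuous[OF assms(1)] convex_segment_mem\<close>)
  then show ?thesis
    by (simp add: pint_def abs_mult mult_left_mono)
qed

lemma pint_diff:
  assumes "continuous_on (A \<times> B) \<phi>" "continuous_on (A \<times> B) \<psi>" "convex A" "t0 \<in> A" "t \<in> A" "p \<in> B"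
  shows "pint t0 (\<lambda>x. \<phi> x - \<psi> x) (t, p) = pint t0 \<phi> (t, p) - pint t0 \<psi> (t, p)"
proof -
  have "integral {0..1} (\<lambda>\<theta>. \<phi> (t0 + \<theta> * (t - t0), p) - \<psi> (t0 + \<theta> * (t - t0), p))
     = integral {0..1} (\<lambda>\<theta>. \<phi> (t0 + \<theta> * (t - t0), p)) - integral {0..1} (\<lambda>\<theta>. \<psi> (t0 + \<theta> * (t - t0), p))"
    by (rule integral_diff; rule integrable_continuous_real;
        rule pint_integrand_continuous[OF _ assms(3-6)]; rule assms)
  then show ?thesis by (simp add: pint_def right_diff_distrib)
qed

lemma pint_sum:
  assumes "\<And>i. i \<in> I \<Longrightarrow> continuous_on (A \<times> B) (\<phi> i)" "finite I" "convex A" "t0 \<in> A" "t \<in> A" "p \<in> B"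
  shows "pint t0 (\<lambda>x. \<Sum>i\<in>I. c i * \<phi> i x) (t, p) = (\<Sum>i\<in>I. c i * pint t0 (\<phi> i) (t, p))"
proof -
  have "integral {0..1} (\<lambda>\<theta>. \<Sum>i\<in>I. c i * \<phi> i (t0 + \<theta> * (t - t0), p))
     = (\<Sum>i\<in>I. integral {0..1} (\<lambda>\<theta>. c i * \<phi> i (t0 + \<theta> * (t - t0), p)))"
    by (rule integral_sum)
       (use assms in \<open>auto intro!: integrable_continuous_real continuous_intros
          pint_integrand_continuous[of A B]\<close>)
  then show ?thesis by (simp add: pint_def sum_distrib_left mult_ac)
qed

lemma pint_deriv:
  assumes cont: "continuous_on ({a<..<b} \<times> B) \<phi>" and t0: "t0 \<in> {a<..<b}" and t: "t \<in> {a<..<b}" and p: "p \<in> B"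
  shows "((\<lambda>t. pint t0 \<phi> (t, p)) has_real_derivative \<phi> (t, p)) (at t)"
proof -
  \<comment> \<open>Midpoints towards \<open>a\<close> and \<open>b\<close>: the compact interval
    from \<open>c\<close> to \<open>d\<close> contains \<open>t0\<close> and \<open>t\<close> in its
    interior, so an antiderivative exists on it and is differentiable at both points.\<close>
  define c d where "c = (a + min t0 t) / 2" and "d = (b + max t0 t) / 2"
  have cd: "a < c" "d < b" "c < t0" "c < t" "t0 < d" "t < d"
    using t0 t by (auto simp: c_def d_def min_def max_def)
  have cont1: "continuous_on {c..d} (\<lambda>s. \<phi> (s, p))"
    by (rule continuous_on_compose2[OF cont]) (use cd p in \<open>auto intro!: continuous_intros\<close>)
  obtain A where A: "\<And>x. x \<in> {c..d} \<Longrightarrow> (A has_vector_derivative \<phi> (x, p)) (at x within {c..d})"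
    using antiderivative_continuous[OF cont1] by metis
  have A': "(A has_real_derivative \<phi> (x, p)) (at x)" if "x \<in> {c<..<d}" for x
  proof -
    have "(A has_vector_derivative \<phi> (x, p)) (at x within {c<..<d})"
      by (rule has_vector_derivative_within_subset[OF A]) (use that in auto)
    then show ?thesis
      using that by (simp add: at_within_open[of x "{c<..<d}"] has_real_derivative_iff_has_vector_derivative)
  qed
  have eq: "A s - A t0 = pint t0 \<phi> (s, p)" if s: "s \<in> {c<..<d}" for s
  proof -
    have "((\<lambda>\<theta>. \<phi> (t0 + \<theta> * (s - t0), p) * (s - t0)) has_integral (A (t0 + 1 * (s - t0)) - A (t0 + 0 * (s - t0)))) {0..1}"
    proof (rule fundamental_theorem_of_calculus)
      fix \<theta> :: real assume th: "\<theta> \<in> {0..1}"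
      have "t0 + \<theta> * (s - t0) \<in> {c<..<d}"
        by (rule convex_segment_mem) (use s cd th in auto)
      from A'[OF this]
      have "((\<lambda>\<theta>. A (t0 + \<theta> * (s - t0))) has_real_derivative \<phi> (t0 + \<theta> * (s - t0), p) * (s - t0)) (at \<theta>)"
        by (rule DERIV_chain2) (auto intro!: derivative_eq_intros)
      then show "((\<lambda>\<theta>. A (t0 + \<theta> * (s - t0))) has_vector_derivative \<phi> (t0 + \<theta> * (s - t0), p) * (s - t0)) (at \<theta> within {0..1})"
        by (simp add: has_field_derivative_at_within flip: has_real_derivative_iff_has_vector_derivative)
    qed simp
    then have "integral {0..1} (\<lambda>\<theta>. \<phi> (t0 + \<theta> * (s - t0), p) * (s - t0)) = A s - A t0"
      by (auto dest: integral_unique)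
    then show ?thesis by (simp add: pint_def mult_ac)
  qed
  have "((\<lambda>s. A s - A t0) has_real_derivative \<phi> (t, p)) (at t)"
    using A'[of t] cd by (auto intro!: derivative_eq_intros)
  then show ?thesis
    by (rule has_field_derivative_transform_within_open[where S="{c<..<d}"]) (use cd eq in auto)
qed

lemma Ck_pint:
  fixes \<phi> :: "real \<times> 'a::euclidean_space \<Rightarrow> real"
  assumes "Ck n (A \<times> B) \<phi>" "convex A" "t0 \<in> A" "open A" "open B"
  shows "Ck n (A \<times> B) (pint t0 \<phi>)"
proof -
  have "Ck n (A \<times> B) (\<lambda>x. integral {0..1} (\<lambda>\<theta>. (\<lambda>y. \<phi> (t0 + snd y * (fst (fst y) - t0), snd (fst y))) (x, \<theta>)))"
  proof (rule Ck_integral_param)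
    show "Ck n ((A \<times> B) \<times> {0..1}) (\<lambda>y. \<phi> (t0 + snd y * (fst (fst y) - t0), snd (fst y)))"
      by (rule Ck_compose[OF assms(1)])
         (auto intro!: Ck_Pair Ck_add Ck_mult Ck_diff Ck_fst Ck_snd convex_segment_mem assms)
  qed (use assms in \<open>auto simp: open_Times\<close>)
  then show ?thesis
    unfolding pint_def by (auto intro!: Ck_mult Ck_diff Ck_fst)
qed

text \<open>Variation of constants: \<open>D\<close> divided by the integrating factor, minus the
  integral on the right, has derivative zero on the interval and vanishes at
  \<open>t0\<close>.\<close>

lemma linear_ode_solution:
  fixes M R :: "real \<times> 'a::topological_space \<Rightarrow> real"
  assumes M: "continuous_on ({a<..<b} \<times> B) M" and R: "continuous_on ({a<..<b} \<times> B) R"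
    and D: "\<And>t. t \<in> {a<..<b} \<Longrightarrow> (D has_real_derivative M (t, p) * D t + R (t, p)) (at t)"
    and D0: "D t0 = 0" and t0: "t0 \<in> {a<..<b}" and t: "t \<in> {a<..<b}" and p: "p \<in> B"
  shows "D t = exp (pint t0 M (t, p)) * pint t0 (\<lambda>x. R x / exp (pint t0 M x)) (t, p)"
proof -
  let ?E = "\<lambda>x. exp (pint t0 M x)"
  let ?h = "\<lambda>t. D t / ?E (t, p) - pint t0 (\<lambda>x. R x / ?E x) (t, p)"
  have cE: "continuous_on ({a<..<b} \<times> B) (\<lambda>x. R x / ?E x)"
    by (intro continuous_intros R pint_continuous_on M) (use t0 in auto)
  have "(?h has_real_derivative 0) (at s within {a<..<b})" if s: "s \<in> {a<..<b}" for s
  proof -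
    have "(?h has_real_derivative 0) (at s)"
      by (rule DERIV_cong[OF DERIV_diff[OF DERIV_divide[OF D[OF s] DERIV_exp[THEN DERIV_chain2, OF pint_deriv[OF M t0 s p]]]
            pint_deriv[OF cE t0 s p]]])
         (auto simp: field_simps)
    then show ?thesis by (rule has_field_derivative_at_within)
  qed
  then obtain c where c: "\<And>s. s \<in> {a<..<b} \<Longrightarrow> ?h s = c"
    using has_field_derivative_zero_constant[of "{a<..<b}" ?h] by auto
  from c[OF t0] D0 have "c = 0" by simp
  with c[OF t] show ?thesis by (simp add: field_simps)
qed

text \<open>The factor \<open>l (y - x)\<close> already vanishes to first order at \<open>x\<close>,
  so continuity of the other factor suffices. It serves to differentiate an increment known only as
  a sum of coordinates times continuous coefficients.\<close>

lemma has_derivative_linear_mult_isCont: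
  fixes \<kappa> l :: "'a::real_normed_vector \<Rightarrow> real"
  assumes l: "bounded_linear l" and \<kappa>: "isCont \<kappa> x"
  shows "((\<lambda>y. l (y - x) * \<kappa> y) has_derivative (\<lambda>h. l h * \<kappa> x)) (at x)"
proof -
  interpret l: bounded_linear l by fact
  obtain K where K: "\<And>v. norm (l v) \<le> norm v * K" using l.bounded by blast
  show ?thesis
  proof (rule has_derivativeI_sandwich[where e=1 and H="\<lambda>y. K * \<bar>\<kappa> y - \<kappa> x\<bar>"])
    show "bounded_linear (\<lambda>h. l h * \<kappa> x)"
      by (rule bounded_linear_mult_const[OF l])
    fix y assume "y \<noteq> x"
    have "norm (l (y - x) * \<kappa> y - l (x - x) * \<kappa> x - l (y - x) * \<kappa> x) = \<bar>l (y - x)\<bar> * \<bar>\<kappa> y - \<kappa> x\<bar>"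
      by (simp add: l.zero flip: right_diff_distrib abs_mult)
    also have "\<dots> \<le> (norm (y - x) * K) * \<bar>\<kappa> y - \<kappa> x\<bar>"
      using K[of "y - x"] by (intro mult_right_mono) auto
    finally show "norm (l (y - x) * \<kappa> y - l (x - x) * \<kappa> x - l (y - x) * \<kappa> x) / norm (y - x) \<le> K * \<bar>\<kappa> y - \<kappa> x\<bar>"
      using \<open>y \<noteq> x\<close> by (simp add: field_simps)
  next
    have "((\<lambda>y. K * \<bar>\<kappa> y - \<kappa> x\<bar>) \<longlongrightarrow> K * \<bar>\<kappa> x - \<kappa> x\<bar>) (at x)"
      by (intro tendsto_intros) (use \<kappa> in \<open>simp add: isCont_def\<close>)
    then show "((\<lambda>y. K * \<bar>\<kappa> y - \<kappa> x\<bar>) \<longlongrightarrow> 0) (at x within UNIV)" by simp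
  qed auto
qed


section \<open>Local existence by contraction\<close>

text \<open>The initial value is 0 for every parameter, so the box for the values is centred at 0;
  other initial values are reduced to this case by moving them into the parameter.\<close>

lemma ode_local_solution:
  fixes G :: "real \<times> 'p::euclidean_space \<times> real \<Rightarrow> real"
  assumes U: "open U" "(t0, p0, 0) \<in> U" and G: "Ck 1 U G"
  obtains h r e u where "h > 0" "r > 0" "e > 0" "{t0-h..t0+h} \<times> cball p0 r \<times> {-e..e} \<subseteq> U"
    "continuous_on ({t0-h..t0+h} \<times> cball p0 r) u"
    "\<And>x. x \<in> {t0-h..t0+h} \<times> cball p0 r \<Longrightarrow> u x \<in> {-e..e}"
    "\<And>x. x \<in> {t0-h..t0+h} \<times> cball p0 r \<Longrightarrow> u x = pint t0 (\<lambda>y. G (fst y, snd y, u y)) x"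
proof -
  obtain A B where AB: "open A" "open B" "t0 \<in> A" "(p0, 0) \<in> B" "A \<times> B \<subseteq> U"
    using open_prod_elim[OF U] by (metis mem_Sigma_iff)
  obtain P E where PE: "open P" "open E" "p0 \<in> P" "0 \<in> E" "P \<times> E \<subseteq> B"
    using open_prod_elim[OF AB(2,4)] by (metis mem_Sigma_iff)
  obtain h1 where h1: "h1 > 0" "cball t0 h1 \<subseteq> A" using AB open_contains_cball by blast
  obtain r where r: "r > 0" "cball p0 r \<subseteq> P" using PE open_contains_cball by blast
  obtain e where e: "e > 0" "cball 0 e \<subseteq> E" using PE open_contains_cball by blast
  define K where "K = cball t0 h1 \<times> cball p0 r \<times> cball (0::real) e"
  have KU: "K \<subseteq> U" using AB PE h1 r e unfolding K_def by blast
  have "compact K" by (auto simp: K_def intro!: compact_Times)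
  obtain D where D: "\<And>x. x \<in> U \<Longrightarrow> (G has_derivative D x) (at x)" "\<And>v. Ck 0 U (\<lambda>x. D x v)"
    using Ck_SucE[of 0 U G] G by auto
  have cG: "continuous_on U G" using G Ck_continuous_on by blast
  have "bounded (G ` K)"
    using \<open>compact K\<close> cG KU by (intro compact_imp_bounded compact_continuous_image) (auto intro: continuous_on_subset)
  then obtain M where M: "M > 0" "\<And>x. x \<in> K \<Longrightarrow> \<bar>G x\<bar> \<le> M"
    unfolding bounded_pos by auto
  have "bounded ((\<lambda>x. D x (0,0,1)) ` K)"
    using \<open>compact K\<close> D(2) KU by (intro compact_imp_bounded compact_continuous_image) (auto intro: continuous_on_subset)
  then obtain L where L: "L > 0" "\<And>x. x \<in> K \<Longrightarrow> \<bar>D x (0,0,1)\<bar> \<le> L"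
    unfolding bounded_pos by auto
  have lip: "\<bar>G (t, p, a) - G (t, p, b)\<bar> \<le> L * \<bar>a - b\<bar>"
    if tp: "t \<in> cball t0 h1" "p \<in> cball p0 r" and ab: "a \<in> cball 0 e" "b \<in> cball 0 e" for t p a b
  proof -
    have "norm (G (t, p, a) - G (t, p, b)) \<le> L * norm (a - b)"
    proof (rule field_differentiable_bound[where S="cball 0 e"])
      fix z :: real assume z: "z \<in> cball 0 e"
      have in_K: "(t, p, z) \<in> K" using tp z by (auto simp: K_def)
      have "((\<lambda>z. G (t, p, z)) has_derivative (\<lambda>v. D (t, p, z) (0, 0, v))) (at z)"
        by (rule has_derivative_compose[where f="\<lambda>z. (t,p,z)", OF _ D(1)])
           (use in_K KU in \<open>auto intro!: derivative_eq_intros\<close>)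
      moreover have "(\<lambda>v. D (t, p, z) (0, 0, v)) = (*) (D (t, p, z) (0, 0, 1))"
      proof
        fix v
        have "linear (D (t, p, z))" using D(1) in_K KU has_derivative_linear by blast
        from linear_cmul[OF this, of v "(0,0,1)"] show "D (t, p, z) (0, 0, v) = D (t, p, z) (0, 0, 1) * v" by simp
      qed
      ultimately have "((\<lambda>z. G (t, p, z)) has_field_derivative D (t, p, z) (0, 0, 1)) (at z)"
        by (simp only: has_field_derivative_def)
      then show "((\<lambda>z. G (t, p, z)) has_field_derivative D (t, p, z) (0, 0, 1)) (at z within cball 0 e)"
        by (rule has_field_derivative_at_within)
      show "norm (D (t, p, z) (0, 0, 1)) \<le> L" using L in_K by auto
    qed (use ab in auto)
    then show ?thesis by simp
  qed
  \<comment> \<open>\<open>h * M \<le> e\<close> keeps the values of the Picard operator within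
    distance \<open>e\<close> of 0, and \<open>h * L \<le> 1/2\<close> makes it a contraction with
    factor 1/2.\<close>
  define h where "h = min h1 (min (e / M) (1 / (2 * L)))"
  have "h \<le> e / M" "h \<le> 1 / (2 * L)" by (simp_all add: h_def)
  then have h: "h > 0" "h \<le> h1" "h * M \<le> e" "h * L \<le> 1/2"
    using h1(1) e(1) M(1) L(1) by (simp_all add: h_def field_simps)
  define I where "I = {t0-h..t0+h}"
  define C where "C = I \<times> cball p0 r"
  have I: "convex I" "t0 \<in> I" "I \<subseteq> cball t0 h1" using h by (auto simp: I_def dist_real_def)
  have "convex C" "closed C" "C \<noteq> {}"
    using h r by (auto simp: C_def I_def intro!: convex_Times closed_Times)
  note C = this
  \<comment> \<open>Bounded continuous functions live on the whole space here. Precomposition with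
    the nearest-point projection onto the closed convex set \<open>C\<close> extends the integral
    from \<open>C\<close> without enlarging its bound.\<close>
  define c where "c = closest_point C"
  have c: "continuous_on UNIV c" "\<And>x. c x \<in> C" "\<And>x. x \<in> C \<Longrightarrow> c x = x"
    unfolding c_def using C by (auto intro: continuous_on_closest_point closest_point_in_set closest_point_self)
  define S where "S = PiC (UNIV :: (real \<times> 'p) set) (\<lambda>_. cball (0::real) e)"
  have S: "w \<in> S \<longleftrightarrow> (\<forall>x. \<bar>apply_bcontfun w x\<bar> \<le> e)" for w
    by (auto simp: S_def mem_PiC_iff Pi_iff)
  define \<phi> where "\<phi> w y = G (fst y, snd y, apply_bcontfun w y)" for w :: "(real \<times> 'p) \<Rightarrow>\<^sub>C real" and y
  have in_K: "(fst y, snd y, apply_bcontfun w y) \<in> K" if "w \<in> S" "y \<in> C" for w y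
    using that I S by (auto simp: K_def C_def)
  have c\<phi>: "continuous_on C (\<phi> w)" if "w \<in> S" for w
    unfolding \<phi>_def
    by (rule continuous_on_compose2[OF cG]) (use in_K[OF that] KU in \<open>auto intro!: continuous_intros\<close>)
  have bound: "\<bar>pint t0 (\<phi> w) x\<bar> \<le> e" if w: "w \<in> S" and x: "x \<in> C" for w x
  proof -
    obtain t p where tp: "x = (t, p)" by fastforce
    then have "t \<in> I" "p \<in> cball p0 r" using x by (auto simp: C_def)
    then have "\<bar>pint t0 (\<phi> w) (t, p)\<bar> \<le> \<bar>t - t0\<bar> * M"
      using c\<phi>[OF w] I M(2)[OF in_K[OF w]]
      by (intro pint_bound[of I "cball p0 r"]) (auto simp: C_def \<phi>_def)
    also have "\<dots> \<le> h * M" using M \<open>t \<in> I\<close> by (intro mult_right_mono) (auto simp: I_def)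
    finally show ?thesis using h tp by simp
  qed
  define T where "T w = Bcontfun (\<lambda>x. pint t0 (\<phi> w) (c x))" for w
  have T: "apply_bcontfun (T w) x = pint t0 (\<phi> w) (c x)" if w: "w \<in> S" for w x
  proof -
    have "continuous_on C (pint t0 (\<phi> w))"
      unfolding C_def by (rule pint_continuous_on) (use c\<phi>[OF w] I in \<open>auto simp: C_def\<close>)
    then have "continuous_on UNIV (\<lambda>x. pint t0 (\<phi> w) (c x))"
      by (rule continuous_on_compose2[OF _ c(1)]) (use c in auto)
    moreover have "bounded (range (\<lambda>x. pint t0 (\<phi> w) (c x)))"
      using bound[OF w c(2)] by (auto simp: bounded_iff)
    ultimately show ?thesis
      unfolding T_def by (subst Bcontfun_inverse) (auto simp: bcontfun_def)
  qed
  have "\<exists>!w\<in>S. T w = w"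
  proof (rule Banach_fix[where c="1/2"])
    have "closed S" unfolding S_def by (rule closed_PiC) auto
    then show "complete S" by (simp add: complete_eq_closed)
    have "const_bcontfun 0 \<in> S" using e by (simp add: S const_bcontfun.rep_eq)
    then show "S \<noteq> {}" by auto
    show "T ` S \<subseteq> S"
    proof (rule image_subsetI)
      fix w assume w: "w \<in> S"
      have "\<bar>apply_bcontfun (T w) x\<bar> \<le> e" for x
        unfolding T[OF w] by (rule bound[OF w c(2)])
      then show "T w \<in> S" using S by blast
    qed
    fix v w assume vw: "v \<in> S" "w \<in> S"
    show "dist (T v) (T w) \<le> 1/2 * dist v w"
    proof (rule dist_bound)
      fix x
      obtain t p where tp: "c x = (t, p)" by fastforce
      then have tp': "t \<in> I" "p \<in> cball p0 r" using c(2)[of x] by (auto simp: C_def)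
      have le: "\<bar>\<phi> v y - \<phi> w y\<bar> \<le> L * dist v w" if "y \<in> C" for y
      proof -
        have "\<bar>\<phi> v y - \<phi> w y\<bar> \<le> L * \<bar>apply_bcontfun v y - apply_bcontfun w y\<bar>"
          unfolding \<phi>_def using in_K[OF vw(1) that] in_K[OF vw(2) that]
          by (intro lip) (auto simp: K_def)
        also have "\<dots> \<le> L * dist v w"
          using L dist_bounded[of v y w] by (intro mult_left_mono) (auto simp: dist_real_def)
        finally show ?thesis .
      qed
      have "dist (apply_bcontfun (T v) x) (apply_bcontfun (T w) x) = \<bar>pint t0 (\<lambda>y. \<phi> v y - \<phi> w y) (t, p)\<bar>"
        using c\<phi> vw I tp' by (subst pint_diff[of I "cball p0 r"]) (auto simp: C_def T tp dist_real_def)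
      also have "\<dots> \<le> \<bar>t - t0\<bar> * (L * dist v w)"
        using c\<phi> vw I tp' le by (intro pint_bound[of I "cball p0 r"] continuous_on_diff) (auto simp: C_def)
      also have "\<dots> \<le> h * (L * dist v w)"
        using L tp' by (intro mult_right_mono) (auto simp: I_def)
      also have "\<dots> \<le> 1/2 * dist v w"
        using h mult_right_mono[OF h(4), of "dist v w"] by (simp add: mult_ac)
      finally show "dist (apply_bcontfun (T v) x) (apply_bcontfun (T w) x) \<le> 1/2 * dist v w" .
    qed
  qed auto
  then obtain w where w: "w \<in> S" "T w = w" by blast
  show ?thesis
  proof (rule that[of h r e "apply_bcontfun w"])
    show "{t0-h..t0+h} \<times> cball p0 r \<times> {-e..e} \<subseteq> U"
      using KU I by (auto simp: K_def I_def subset_iff abs_le_iff)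
    fix x assume x: "x \<in> {t0-h..t0+h} \<times> cball p0 r"
    then have "x \<in> C" by (auto simp: C_def I_def)
    show "apply_bcontfun w x \<in> {-e..e}" using S[of w] w(1) by (simp only: atLeastAtMost_iff abs_le_iff) (metis minus_le_iff)
    show "apply_bcontfun w x = pint t0 (\<lambda>y. G (fst y, snd y, apply_bcontfun w y)) x"
      using T[OF w(1), of x] w(2) c(3)[OF \<open>x \<in> C\<close>] by (simp add: \<phi>_def[abs_def])
  qed (use h r e in auto)
qed


section \<open>Regularity of the solution in time and parameter\<close>

text \<open>\<open>E\<close> is the integrating factor of the equation linearised along the
  solution, and the coefficient of each basis direction \<open>b\<close> is the
  variation-of-constants solution whose forcing term is the partial derivative of \<open>G\<close>
  in direction \<open>b\<close>.\<close>

lemma ode_solution_has_derivative: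
  fixes G :: "real \<times> 'p::euclidean_space \<times> real \<Rightarrow> real"
  assumes sub: "{t0-h<..<t0+h} \<times> ball p0 r \<times> {-e..e} \<subseteq> U"
    and D: "\<And>x. x \<in> U \<Longrightarrow> (G has_derivative D x) (at x)" "\<And>v. continuous_on U (\<lambda>x. D x v)"
    and cu: "continuous_on ({t0-h<..<t0+h} \<times> ball p0 r) u"
    and ue: "\<And>x. x \<in> {t0-h<..<t0+h} \<times> ball p0 r \<Longrightarrow> u x \<in> {-e..e}"
    and ut: "\<And>t p. t \<in> {t0-h<..<t0+h} \<Longrightarrow> p \<in> ball p0 r \<Longrightarrow>
          ((\<lambda>t. u (t, p)) has_real_derivative G (t, p, u (t, p))) (at t)"
    and u0: "\<And>p. p \<in> ball p0 r \<Longrightarrow> u (t0, p) = 0"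
    and h: "h > 0" and x: "x \<in> {t0-h<..<t0+h} \<times> ball p0 r"
  defines "E \<equiv> \<lambda>y. exp (pint t0 (\<lambda>y. D (fst y, snd y, u y) (0, 0, 1)) y)"
  shows "(u has_derivative (\<lambda>v. fst v * G (fst x, snd x, u x) +
      (\<Sum>b\<in>Basis. (snd v \<bullet> b) * (E x * pint t0 (\<lambda>y. D (fst y, snd y, u y) (0, b, 0) / E y) x)))) (at x)"
proof -
  define J where "J = {t0-h<..<t0+h}"
  define B where "B = ball p0 r"
  have J: "convex J" "t0 \<in> J" "open J" and B: "convex B" "open B"
    using h by (auto simp: J_def B_def)
  note sub = sub[folded J_def B_def] and cu = cu[folded J_def B_def] and ue = ue[folded J_def B_def]
    and ut = ut[folded J_def B_def] and u0 = u0[folded B_def]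
  obtain t p where tp: "x = (t, p)" "t \<in> J" "p \<in> B" using x by (auto simp: J_def B_def)
  \<comment> \<open>Hadamard's lemma: the increment \<open>u (\<cdot>, p') - u (\<cdot>, p)\<close> solves a linear ODE whose coefficients are averages
    of the partial derivatives of \<open>G\<close> along \<open>\<gamma>\<close>, hence it is linear in \<open>p' - p\<close> with continuous coefficients \<open>\<kappa>\<close>.\<close>
  define \<gamma> where "\<gamma> y \<theta> = (fst y, p + \<theta> *\<^sub>R (snd y - p), u (fst y, p) + \<theta> * (u y - u (fst y, p)))"
    for y :: "real \<times> 'p" and \<theta> :: real
  have \<gamma>U: "\<gamma> y \<theta> \<in> U" if y: "y \<in> J \<times> B" and \<theta>: "0 \<le> \<theta>" "\<theta> \<le> 1" for y \<theta>
  proof -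
    have 1: "fst y \<in> J" "(fst y, p) \<in> J \<times> B" using y tp by auto
    have "(1 - \<theta>) *\<^sub>R p + \<theta> *\<^sub>R snd y \<in> B"
      using y \<theta> tp by (intro convexD[OF B(1)]) auto
    then have "p + \<theta> *\<^sub>R (snd y - p) \<in> B" by (simp add: algebra_simps)
    moreover have "u (fst y, p) + \<theta> * (u y - u (fst y, p)) \<in> {-e..e}"
      by (rule convex_segment_mem[OF _ ue[OF 1(2)] ue[OF y] \<theta>]) simp
    ultimately have "\<gamma> y \<theta> \<in> J \<times> B \<times> {-e..e}" unfolding \<gamma>_def using 1(1) by blast
    then show ?thesis by (rule subsetD[OF sub])
  qed
  have cup: "continuous_on (J \<times> B) (\<lambda>y. u (fst y, p))"
    by (rule continuous_on_compose2[OF cu]) (use tp in \<open>auto intro!: continuous_intros\<close>)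
  define m where "m v y = integral {0..1} (\<lambda>\<theta>. D (\<gamma> y \<theta>) v)" for v y
  have c\<gamma>: "continuous_on ((J \<times> B) \<times> {0..1}) (\<lambda>z. D (\<gamma> (fst z) (snd z)) v)" for v
  proof (rule continuous_on_compose2[OF D(2)])
    show "continuous_on ((J \<times> B) \<times> {0..1}) (\<lambda>z. \<gamma> (fst z) (snd z))"
      unfolding \<gamma>_def
      by (intro continuous_intros continuous_on_compose2[OF cup] continuous_on_compose2[OF cu]) auto
  qed (use \<gamma>U in auto)
  have cm: "continuous_on (J \<times> B) (m v)" for v
    using integral_continuous_on_param[where f="\<lambda>y \<theta>. D (\<gamma> y \<theta>) v" and U="J \<times> B" and a=0 and b="1::real"]
      c\<gamma>[of v] by (simp add: m_def[abs_def] split_beta)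
  have mp: "m v (s, p) = D (s, p, u (s, p)) v" for v s
    by (simp add: m_def \<gamma>_def)
  have lin: "D z (0, \<pi>, \<delta>) = \<delta> * D z (0, 0, 1) + (\<Sum>b\<in>Basis. (\<pi> \<bullet> b) * D z (0, b, 0))"
    if "z \<in> U" for z \<pi> \<delta>
  proof -
    have l: "linear (D z)" using D(1)[OF that] has_derivative_linear by blast
    have eq: "(0, \<pi>, \<delta>) = \<delta> *\<^sub>R (0, 0, 1) + (\<Sum>b\<in>Basis. (\<pi> \<bullet> b) *\<^sub>R (0::real, b, 0::real))"
    proof -
      have "(\<Sum>b\<in>Basis. (\<pi> \<bullet> b) *\<^sub>R (0::real, b, 0::real)) = (0, \<Sum>b\<in>Basis. (\<pi> \<bullet> b) *\<^sub>R b, 0)"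
        by (simp add: prod_eq_iff fst_sum snd_sum)
      then show ?thesis by (simp add: euclidean_representation)
    qed
    show ?thesis
      unfolding eq using l by (simp only: linear_add linear_sum linear_cmul real_scaleR_def)
  qed
  have key: "G (s, p', u (s, p')) - G (s, p, u (s, p)) =
      m (0, 0, 1) (s, p') * (u (s, p') - u (s, p)) + (\<Sum>b\<in>Basis. ((p' - p) \<bullet> b) * m (0, b, 0) (s, p'))"
    if s: "s \<in> J" and p': "p' \<in> B" for s p'
  proof -
    have y: "(s, p') \<in> J \<times> B" using s p' by auto
    let ?g = "\<gamma> (s, p')" and ?d = "u (s, p') - u (s, p)"
    have "((\<lambda>\<theta>. D (?g \<theta>) (0, p' - p, ?d)) has_integral (G (?g 1) - G (?g 0))) {0..1}"
    proof (rule fundamental_theorem_of_calculus)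
      fix \<theta> :: real assume \<theta>: "\<theta> \<in> {0..1}"
      have 1: "(?g has_derivative (\<lambda>h. (0, h *\<^sub>R (p' - p), h * ?d))) (at \<theta>)"
        unfolding \<gamma>_def by (auto intro!: derivative_eq_intros)
      have 2: "(G has_derivative D (?g \<theta>)) (at (?g \<theta>))" using D(1) \<gamma>U[OF y] \<theta> by auto
      have l: "linear (D (?g \<theta>))" using 2 has_derivative_linear by blast
      have "((\<lambda>\<theta>. G (?g \<theta>)) has_derivative (\<lambda>h. D (?g \<theta>) (0, h *\<^sub>R (p' - p), h * ?d))) (at \<theta>)"
        by (rule has_derivative_compose[OF 1 2])
      moreover have "D (?g \<theta>) (0, h *\<^sub>R (p' - p), h * ?d) = h *\<^sub>R D (?g \<theta>) (0, p' - p, ?d)" for h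
        using linear_cmul[OF l, of h "(0, p' - p, ?d)"] by simp
      ultimately have "((\<lambda>\<theta>. G (?g \<theta>)) has_vector_derivative D (?g \<theta>) (0, p' - p, ?d)) (at \<theta>)"
        by (simp only: has_vector_derivative_def)
      then show "((\<lambda>\<theta>. G (?g \<theta>)) has_vector_derivative D (?g \<theta>) (0, p' - p, ?d)) (at \<theta> within {0..1})"
        by (rule has_vector_derivative_at_within)
    qed simp
    then have "G (s, p', u (s, p')) - G (s, p, u (s, p)) = integral {0..1} (\<lambda>\<theta>. D (?g \<theta>) (0, p' - p, ?d))"
      by (simp add: \<gamma>_def integral_unique)
    also have "\<dots> = integral {0..1} (\<lambda>\<theta>. ?d * D (?g \<theta>) (0, 0, 1) + (\<Sum>b\<in>Basis. ((p' - p) \<bullet> b) * D (?g \<theta>) (0, b, 0)))"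
      by (rule integral_cong, rule lin, rule \<gamma>U[OF y]) auto
    also have "\<dots> = ?d * m (0, 0, 1) (s, p') + (\<Sum>b\<in>Basis. ((p' - p) \<bullet> b) * m (0, b, 0) (s, p'))"
    proof -
      have i: "(\<lambda>\<theta>. D (?g \<theta>) v) integrable_on {0..1}" for v
        by (rule integrable_continuous_real, rule continuous_on_compose2[OF c\<gamma>[of v], where f="\<lambda>\<theta>. ((s,p'),\<theta>)", simplified])
           (use y in \<open>auto intro!: continuous_intros\<close>)
      have "integral {0..1} (\<lambda>\<theta>. \<Sum>b\<in>Basis. ((p' - p) \<bullet> b) * D (?g \<theta>) (0, b, 0)) =
          (\<Sum>b\<in>Basis. integral {0..1} (\<lambda>\<theta>. ((p' - p) \<bullet> b) * D (?g \<theta>) (0, b, 0)))"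
        by (rule integral_sum) (auto intro!: i integrable_on_mult_right)
      then show ?thesis
        unfolding m_def
        by (subst integral_add)
           (auto intro!: i integrable_on_mult_right integrable_sum)
    qed
    finally show ?thesis by (simp add: mult_ac)
  qed
  define \<epsilon> where "\<epsilon> y = exp (pint t0 (m (0, 0, 1)) y)" for y
  define \<kappa> where "\<kappa> b y = \<epsilon> y * pint t0 (\<lambda>y. m (0, b, 0) y / \<epsilon> y) y" for b y
  have c\<epsilon>: "continuous_on (J \<times> B) \<epsilon>"
    unfolding \<epsilon>_def by (intro continuous_intros pint_continuous_on cm J)
  have cq: "continuous_on (J \<times> B) (\<lambda>y. m (0, b, 0) y / \<epsilon> y)" for b
    by (intro continuous_intros cm c\<epsilon>) (auto simp: \<epsilon>_def)
  have c\<kappa>: "continuous_on (J \<times> B) (\<kappa> b)" for b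
    unfolding \<kappa>_def by (intro continuous_intros c\<epsilon> pint_continuous_on cq J)
  have incr: "u (s, p') - u (s, p) = (\<Sum>b\<in>Basis. ((p' - p) \<bullet> b) * \<kappa> b (s, p'))" if s: "s \<in> J" and p': "p' \<in> B" for s p'
  proof -
    let ?R = "\<lambda>y. \<Sum>b\<in>Basis. ((p' - p) \<bullet> b) * m (0, b, 0) y"
    have "u (s, p') - u (s, p) = exp (pint t0 (m (0, 0, 1)) (s, p')) *
       pint t0 (\<lambda>y. ?R y / exp (pint t0 (m (0, 0, 1)) y)) (s, p')"
    proof (rule linear_ode_solution[where B=B and a="t0 - h" and b="t0 + h" and D="\<lambda>s. u (s, p') - u (s, p)"])
      fix s assume "s \<in> {t0 - h<..<t0 + h}"
      then have s: "s \<in> J" by (simp add: J_def)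
      show "((\<lambda>s. u (s, p') - u (s, p)) has_real_derivative
         m (0, 0, 1) (s, p') * (u (s, p') - u (s, p)) + ?R (s, p')) (at s)"
        using DERIV_diff[OF ut[OF s p'] ut[OF s tp(3)]] key[OF s p'] by simp
    qed (use cm s p' tp u0 J in \<open>auto simp flip: J_def intro!: continuous_intros\<close>)
    also have "\<dots> = \<epsilon> (s, p') * pint t0 (\<lambda>y. \<Sum>b\<in>Basis. ((p' - p) \<bullet> b) * (m (0, b, 0) y / \<epsilon> y)) (s, p')"
      by (simp add: \<epsilon>_def sum_divide_distrib)
    also have "\<dots> = \<epsilon> (s, p') * (\<Sum>b\<in>Basis. ((p' - p) \<bullet> b) * pint t0 (\<lambda>y. m (0, b, 0) y / \<epsilon> y) (s, p'))"
      by (subst pint_sum[of _ J B]) (use cq J s p' in auto)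
    finally show ?thesis by (simp add: \<kappa>_def sum_distrib_left mult_ac)
  qed
  have x': "x \<in> J \<times> B" using tp by auto
  have \<kappa>c: "isCont (\<kappa> b) x" for b
    using c\<kappa>[of b] x' open_Times[OF J(3) B(2)] continuous_on_eq_continuous_at by blast
  have du: "((\<lambda>y. u (fst y, p) + (\<Sum>b\<in>Basis. (snd (y - x) \<bullet> b) * \<kappa> b y)) has_derivative
      (\<lambda>v. fst v * G (t, p, u x) + (\<Sum>b\<in>Basis. (snd v \<bullet> b) * \<kappa> b x))) (at x)"
  proof (intro has_derivative_add has_derivative_sum)
    have "((\<lambda>t. u (t, p)) has_derivative (\<lambda>v. v * G (t, p, u (t, p)))) (at (fst x))"
      using ut[OF tp(2,3)] tp by (simp add: has_field_derivative_def mult_commute_abs)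
    from has_derivative_compose[OF bounded_linear_imp_has_derivative[OF bounded_linear_fst] this]
    show "((\<lambda>y. u (fst y, p)) has_derivative (\<lambda>v. fst v * G (t, p, u x))) (at x)" by (simp add: tp)
  next
    fix b :: 'p
    have "bounded_linear (\<lambda>v::real \<times> 'p. snd v \<bullet> b)"
      by (intro bounded_linear_inner_left_comp bounded_linear_snd)
    from has_derivative_linear_mult_isCont[OF this \<kappa>c]
    show "((\<lambda>y. snd (y - x) \<bullet> b * \<kappa> b y) has_derivative (\<lambda>v. snd v \<bullet> b * \<kappa> b x)) (at x)" .
  qed
  have eq: "u (fst y, p) + (\<Sum>b\<in>Basis. (snd (y - x) \<bullet> b) * \<kappa> b y) = u y" if "y \<in> J \<times> B" for y
    using incr[of "fst y" "snd y"] that tp by auto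
  have "(u has_derivative (\<lambda>v. fst v * G (t, p, u x) + (\<Sum>b\<in>Basis. (snd v \<bullet> b) * \<kappa> b x))) (at x)"
    by (rule has_derivative_transform_within_open[OF du open_Times[OF J(3) B(2)] x' eq])
  \<comment> \<open>The integrals defining \<open>\<kappa>\<close> at \<open>x\<close> run along
    points with parameter \<open>p\<close>, where the averages have been identified.\<close>
  moreover have "\<kappa> b x = E x * pint t0 (\<lambda>y. D (fst y, snd y, u y) (0, b, 0) / E y) x" for b
    by (simp add: \<kappa>_def \<epsilon>_def E_def pint_def tp mp)
  ultimately show ?thesis by (simp add: tp)
qed

theorem ode_smooth_solution:
  fixes G :: "real \<times> 'p::euclidean_space \<times> real \<Rightarrow> real"
  assumes U: "open U" "(t0, p0, 0) \<in> U" and G: "smooth_on U G"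
  obtains h r u where "h > 0" "r > 0" "smooth_on ({t0-h<..<t0+h} \<times> ball p0 r) u"
    "\<And>t p. t \<in> {t0-h<..<t0+h} \<Longrightarrow> p \<in> ball p0 r \<Longrightarrow> (t, p, u (t, p)) \<in> U"
    "\<And>p. u (t0, p) = 0"
    "\<And>t p. t \<in> {t0-h<..<t0+h} \<Longrightarrow> p \<in> ball p0 r \<Longrightarrow>
          ((\<lambda>t. u (t, p)) has_real_derivative G (t, p, u (t, p))) (at t)"
proof -
  obtain h r e w where *: "h > 0" "r > 0" "e > 0" "{t0-h..t0+h} \<times> cball p0 r \<times> {-e..e} \<subseteq> U"
    "continuous_on ({t0-h..t0+h} \<times> cball p0 r) w"
    "\<And>x. x \<in> {t0-h..t0+h} \<times> cball p0 r \<Longrightarrow> w x \<in> {-e..e}"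
    "\<And>x. x \<in> {t0-h..t0+h} \<times> cball p0 r \<Longrightarrow> w x = pint t0 (\<lambda>y. G (fst y, snd y, w y)) x"
    using ode_local_solution[OF U smooth_onD[OF G]] by blast
  define J where "J = {t0-h<..<t0+h}"
  define B where "B = ball p0 r"
  have J: "convex J" "t0 \<in> J" "open J" and B: "convex B" "open B"
    using * by (auto simp: J_def B_def)
  have incl: "J \<times> B \<subseteq> {t0-h..t0+h} \<times> cball p0 r" by (auto simp: J_def B_def)
  \<comment> \<open>Replacing the fixed point by its own integral makes it vanish at
    \<open>t0\<close> for every \<open>p\<close>, also outside the ball, where nothing is known
    about \<open>w\<close>.\<close>
  define u where "u = pint t0 (\<lambda>y. G (fst y, snd y, w y))"
  have uw: "u x = w x" if "x \<in> J \<times> B" for x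
    using *(7) incl that by (auto simp: u_def)
  have sub: "J \<times> B \<times> {-e..e} \<subseteq> U"
    using *(4) by (auto simp: J_def B_def subset_iff)
  have cu: "continuous_on (J \<times> B) u"
    using continuous_on_subset[OF *(5) incl] uw by (auto cong: continuous_on_cong)
  have ue: "u x \<in> {-e..e}" if "x \<in> J \<times> B" for x
    using uw[OF that] *(6)[of x] incl that by auto
  have inU: "(fst y, snd y, u y) \<in> U" if "y \<in> J \<times> B" for y
    using ue[OF that] that sub by (auto simp: subset_iff)
  have ut: "((\<lambda>t. u (t, p)) has_real_derivative G (t, p, u (t, p))) (at t)" if "t \<in> J" "p \<in> B" for t p
  proof -
    have "((\<lambda>t. pint t0 (\<lambda>y. G (fst y, snd y, w y)) (t, p)) has_real_derivative
       (\<lambda>y. G (fst y, snd y, w y)) (t, p)) (at t)"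
    proof (rule pint_deriv)
      have "continuous_on (J \<times> B) (\<lambda>y. G (fst y, snd y, u y))"
        by (rule continuous_on_compose2[OF Ck_continuous_on[OF smooth_onD[OF G]]])
           (use cu inU in \<open>auto intro!: continuous_intros\<close>)
      then show "continuous_on ({t0-h<..<t0+h} \<times> B) (\<lambda>y. G (fst y, snd y, w y))"
        using uw by (simp add: J_def cong: continuous_on_cong)
    qed (use that J in \<open>auto simp: J_def\<close>)
    then show ?thesis using uw[of "(t,p)"] that by (simp add: u_def)
  qed
  have u0: "u (t0, p) = 0" for p by (simp add: u_def)
  obtain D where D: "\<And>x. x \<in> U \<Longrightarrow> (G has_derivative D x) (at x)" "\<And>v. smooth_on U (\<lambda>x. D x v)"
    using smooth_on_obtain_derivative[OF G U(1)] by blast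
  \<comment> \<open>If \<open>u\<close> has order \<open>n\<close>, every ingredient of its
    derivative is a smooth function composed with \<open>u\<close>, or an integral or quotient built
    from such functions, hence of order \<open>n\<close>; this raises the order of \<open>u\<close>
    by one.\<close>
  have "Ck n (J \<times> B) u" for n
  proof (induction n)
    case 0 then show ?case using cu by simp
  next
    case (Suc n)
    have cmp: "Ck n (J \<times> B) (\<lambda>y. f (fst y, snd y, u y))" if "smooth_on U f" for f :: "real \<times> 'p \<times> real \<Rightarrow> real"
      by (rule Ck_compose[OF smooth_onD[OF that]]) (use inU Suc in \<open>auto intro!: Ck_Pair Ck_fst Ck_snd\<close>)
    show ?case
    proof (rule Ck_SucI)
      fix x assume x: "x \<in> J \<times> B"
      show "(u has_derivative (\<lambda>v. fst v * G (fst x, snd x, u x) +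
        (\<Sum>b\<in>Basis. (snd v \<bullet> b) * (exp (pint t0 (\<lambda>y. D (fst y, snd y, u y) (0, 0, 1)) x) *
           pint t0 (\<lambda>y. D (fst y, snd y, u y) (0, b, 0) / exp (pint t0 (\<lambda>y. D (fst y, snd y, u y) (0, 0, 1)) y)) x)))) (at x)"
        by (rule ode_solution_has_derivative[where U=U and e=e and h=h and ?p0.0=p0 and r=r])
           (use sub D(1) smooth_onD[OF D(2)] cu ue ut u0 * x in \<open>auto simp: J_def B_def intro: Ck_continuous_on\<close>)
    next
      fix v :: "real \<times> 'p"
      show "Ck n (J \<times> B) (\<lambda>x. fst v * G (fst x, snd x, u x) +
        (\<Sum>b\<in>Basis. (snd v \<bullet> b) * (exp (pint t0 (\<lambda>y. D (fst y, snd y, u y) (0, 0, 1)) x) *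
           pint t0 (\<lambda>y. D (fst y, snd y, u y) (0, b, 0) / exp (pint t0 (\<lambda>y. D (fst y, snd y, u y) (0, 0, 1)) y)) x)))"
        by (intro Ck_add Ck_mult Ck_const Ck_sum cmp[OF G] Ck_exp Ck_pint Ck_divide cmp[OF D(2)] J B) auto
    qed
  qed
  then have "smooth_on (J \<times> B) u" by (rule smooth_onI)
  then show ?thesis
    using that[of h r u] * ut u0 inU by (force simp: J_def B_def)
qed


section \<open>Straightening a scalar ODE\<close>

text \<open>An injective linear endomorphism of a finite-dimensional space is invertible, so
  injectivity at \<open>x0\<close> feeds the inverse function theorem. The derivative of the inverse
  is described by the linear system it solves, the form needed for implicit differentiation.\<close>

lemma local_inverse:
  fixes f :: "'a::euclidean_space \<Rightarrow> 'a"
  assumes U: "open U" "x0 \<in> U"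
    and D: "\<And>x. x \<in> U \<Longrightarrow> (f has_derivative D x) (at x)" "\<And>v. continuous_on U (\<lambda>x. D x v)"
    and inj: "\<And>v. D x0 v = 0 \<Longrightarrow> v = 0"
  obtains W V g g' where "open W" "W \<subseteq> U" "x0 \<in> W" "open V" "homeomorphism W V f g"
    "\<And>y. y \<in> V \<Longrightarrow> (g has_derivative g' y) (at y)"
    "\<And>y v. y \<in> V \<Longrightarrow> D (g y) (g' y v) = v"
proof -
  have bl: "bounded_linear (D x)" if "x \<in> U" for x
    using D(1)[OF that] has_derivative_bounded_linear by blast
  define F where "F x = Blinfun (D x)" for x
  have F: "blinfun_apply (F x) = D x" if "x \<in> U" for x
    using bl[OF that] by (simp add: F_def bounded_linear_Blinfun_apply)
  have cF: "continuous_on U F"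
    by (rule continuous_on_blinfun_componentwise) (use D(2) F in \<open>simp cong: continuous_on_cong\<close>)
  have lin: "linear (D x0)" using bl[OF U(2)] by (simp add: bounded_linear.linear)
  then have "inj (D x0)" using inj by (simp add: linear_injective_0)
  then obtain k where k: "linear k" "k \<circ> D x0 = id"
    using linear_injective_left_inverse[OF lin] by blast
  have "Blinfun k o\<^sub>L F x0 = id_blinfun"
  proof (rule blinfun_eqI)
    fix v
    show "blinfun_apply (Blinfun k o\<^sub>L F x0) v = blinfun_apply id_blinfun v"
      using k F[OF U(2)] by (simp add: bounded_linear_Blinfun_apply linear_conv_bounded_linear fun_eq_iff)
  qed
  then obtain W V g g' where *: "open W" "W \<subseteq> U" "x0 \<in> W" "open V" "f x0 \<in> V" "homeomorphism W V f g"
    "\<And>y. y \<in> V \<Longrightarrow> (g has_derivative (g' y)) (at y)"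
    "\<And>y. y \<in> V \<Longrightarrow> g' y = inv (blinfun_apply (F (g y)))"
    "\<And>y. y \<in> V \<Longrightarrow> bij (blinfun_apply (F (g y)))"
    using inverse_function_theorem[of U f F x0 "Blinfun k"] U D(1) F cF by (metis (no_types, lifting))
  have "D (g y) (g' y v) = v" if y: "y \<in> V" for y v
  proof -
    have "g y \<in> U" using *(2,6) y by (auto simp: homeomorphism_def)
    then show ?thesis
      using *(8,9)[OF y] F by (metis bij_inv_eq_iff)
  qed
  then show ?thesis using that * by blast
qed

lemma smooth_on_continuous: "smooth_on U f \<Longrightarrow> continuous_on U f"
  by (meson Ck_continuous_on smooth_onD)

lemma smooth_on_subset: "smooth_on U f \<Longrightarrow> V \<subseteq> U \<Longrightarrow> smooth_on V f"
  by (meson Ck_subset smooth_on_def)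

text \<open>\<open>\<eta> (t, p, c)\<close> is the value at time \<open>t\<close> of the solution
  that starts from \<open>c\<close> at time \<open>t0\<close>, and \<open>\<zeta> (t, p, y)\<close>
  recovers that initial value from the value \<open>y\<close> at time \<open>t\<close>. Initial
  values are constant along solutions, so \<open>\<zeta>\<close> is a first integral of the field
  \<open>(1, 0, g)\<close>.\<close>

lemma flow_box:
  fixes g :: "real \<times> 'p::euclidean_space \<times> real \<Rightarrow> real"
  assumes U: "open U" "(t0, p0, y0) \<in> U" and g: "smooth_on U g"
  obtains N V \<eta> \<zeta> Z where "open N" "(t0, p0, y0) \<in> N" "smooth_on N \<zeta>" "\<zeta> (t0, p0, y0) = y0"
    "open V" "smooth_on V \<eta>"
    "\<And>t p y. (t, p, y) \<in> N \<Longrightarrow> (t, p, \<zeta> (t, p, y)) \<in> V \<and> \<eta> (t, p, \<zeta> (t, p, y)) = y"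
    "\<And>x. x \<in> N \<Longrightarrow> (\<zeta> has_derivative Z x) (at x)"
    "\<And>x. x \<in> N \<Longrightarrow> Z x (1, 0, g x) = 0"
    "\<And>x. x \<in> N \<Longrightarrow> Z x (0, 0, 1) \<noteq> 0"
proof -
  \<comment> \<open>The available solution starts from 0, so the initial value becomes part of the
    parameter: with parameter \<open>(p, c)\<close> the unknown is the displacement from
    \<open>c\<close>.\<close>
  let ?m = "\<lambda>z :: real \<times> ('p \<times> real) \<times> real. (fst z, fst (fst (snd z)), snd (fst (snd z)) + snd (snd z))"
  have m: "continuous_on UNIV ?m" by (intro continuous_intros)
  have "open (?m -` U)" by (rule open_vimage[OF U(1) m])
  moreover have "(t0, (p0, y0), 0) \<in> ?m -` U" using U by simp
  moreover have "smooth_on (?m -` U) (\<lambda>z. g (?m z))"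
    by (intro smooth_onI Ck_compose[OF smooth_onD[OF g]] Ck_Pair Ck_fst Ck_snd Ck_add Ck_ident) auto
  ultimately obtain h r u where u: "h > 0" "r > 0" "smooth_on ({t0-h<..<t0+h} \<times> ball (p0, y0) r) u"
    "\<And>t p. t \<in> {t0-h<..<t0+h} \<Longrightarrow> p \<in> ball (p0, y0) r \<Longrightarrow> (t, p, u (t, p)) \<in> ?m -` U"
    "\<And>p. u (t0, p) = 0"
    "\<And>t p. t \<in> {t0-h<..<t0+h} \<Longrightarrow> p \<in> ball (p0, y0) r \<Longrightarrow>
          ((\<lambda>t. u (t, p)) has_real_derivative g (?m (t, p, u (t, p)))) (at t)"
    using ode_smooth_solution by blast
  define V0 where "V0 = {t0-h<..<t0+h} \<times> ball (p0, y0) r"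
  have V0: "open V0" "(t0, p0, y0) \<in> V0" using u by (auto simp: V0_def intro: open_Times)
  define \<eta> where "\<eta> x = snd (snd x) + u x" for x
  have s\<eta>: "smooth_on V0 \<eta>"
    unfolding \<eta>_def V0_def by (intro smooth_onI Ck_add Ck_snd Ck_ident smooth_onD[OF u(3)])
  obtain H where H: "\<And>x. x \<in> V0 \<Longrightarrow> (\<eta> has_derivative H x) (at x)" "\<And>v. smooth_on V0 (\<lambda>x. H x v)"
    using smooth_on_obtain_derivative[OF s\<eta> V0(1)] by blast
  have \<eta>t: "H x (1, 0, 0) = g (fst x, fst (snd x), \<eta> x)" if x: "x \<in> V0" for x
  proof -
    obtain t p c where tp: "x = (t, p, c)" by (metis prod.exhaust)
    have d: "((\<lambda>t. \<eta> (t, p, c)) has_derivative (\<lambda>v. H x (v, 0, 0))) (at t)"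
      by (rule has_derivative_compose[where f="\<lambda>t. (t, p, c)" and g=\<eta>])
         (use H(1)[OF x] tp in \<open>auto simp: zero_prod_def intro!: derivative_eq_intros\<close>)
    have "((\<lambda>t. \<eta> (t, p, c)) has_real_derivative 0 + g (t, p, c + u (t, p, c))) (at t)"
      unfolding \<eta>_def snd_conv
      by (intro DERIV_add DERIV_const) (use u(6)[of t "(p, c)"] x tp in \<open>auto simp: V0_def\<close>)
    then have "((\<lambda>t. \<eta> (t, p, c)) has_derivative (*) (g (t, p, c + u (t, p, c)))) (at t)"
      by (simp add: has_field_derivative_def)
    from has_derivative_unique[OF d this] show ?thesis
      by (metis \<eta>_def fst_conv mult.right_neutral snd_conv tp)
  qed
  \<comment> \<open>At \<open>t0\<close> the displacement is 0, so \<open>\<eta>\<close> is the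
    identity in its last argument.\<close>
  have \<eta>c: "H (t0, p0, y0) (0, 0, 1) = 1"
  proof -
    have d: "((\<lambda>c. \<eta> (t0, p0, c)) has_derivative (\<lambda>v. H (t0, p0, y0) (0, 0, v))) (at y0)"
      by (rule has_derivative_compose[where f="\<lambda>c. (t0, p0, c)" and g=\<eta>])
         (use H(1)[OF V0(2)] in \<open>auto intro!: derivative_eq_intros\<close>)
    have "(\<lambda>c. \<eta> (t0, p0, c)) = (\<lambda>c. c)" using u(5) by (auto simp: \<eta>_def)
    then show ?thesis
      using has_derivative_unique[OF d] by (metis has_derivative_ident)
  qed
  define V where "V = {x \<in> V0. H x (0, 0, 1) \<noteq> 0}"
  have "open ((\<lambda>x. H x (0, 0, 1)) -` (- {0}) \<inter> V0)"
    using V0(1) smooth_on_continuous[OF H(2)] by (intro continuous_on_open_vimage[THEN iffD1, rule_format]) auto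
  then have V: "open V" "(t0, p0, y0) \<in> V" "V \<subseteq> V0"
    using V0 \<eta>c by (auto simp: V_def Int_def vimage_def conj_commute)
  define \<Psi> where "\<Psi> x = (fst x, fst (snd x), \<eta> x)" for x
  have d\<Psi>: "(\<Psi> has_derivative (\<lambda>v. (fst v, fst (snd v), H x v))) (at x)" if "x \<in> V" for x
    unfolding \<Psi>_def using H(1)[of x] that V
    by (auto intro!: has_derivative_Pair derivative_eq_intros)
  have Hlin: "H x (a, b, c) = H x (a, b, 0) + c * H x (0, 0, 1)" if "x \<in> V" for x a b c
  proof -
    have l: "linear (H x)" using H(1) that V(3) has_derivative_linear by blast
    have "H x (a, b, c) = H x ((a, b, 0) + c *\<^sub>R (0, 0, 1))" by simp
    also have "\<dots> = H x (a, b, 0) + c * H x (0, 0, 1)" using l by (simp only: linear_add linear_cmul real_scaleR_def)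
    finally show ?thesis .
  qed
  obtain W N k k' where *: "open W" "W \<subseteq> V" "(t0, p0, y0) \<in> W" "open N" "homeomorphism W N \<Psi> k"
    "\<And>y. y \<in> N \<Longrightarrow> (k has_derivative k' y) (at y)"
    "\<And>y v. y \<in> N \<Longrightarrow> (\<lambda>v. (fst v, fst (snd v), H (k y) v)) (k' y v) = v"
  proof (rule local_inverse[OF V(1,2) d\<Psi>])
    fix v :: "real \<times> 'p \<times> real"
    have "continuous_on V (\<lambda>x. H x v)"
      by (rule continuous_on_subset[OF smooth_on_continuous[OF H(2)] V(3)])
    then show "continuous_on V (\<lambda>x. (fst v, fst (snd v), H x v))"
      by (intro continuous_intros)
    obtain a b c where abc: "v = (a, b, c)" by (metis prod.exhaust)
    assume "(fst v, fst (snd v), H (t0, p0, y0) v) = 0"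
    moreover have "H (t0, p0, y0) (0, 0, 0) = 0"
      using linear_0[OF has_derivative_linear[OF H(1)[OF V0(2)]]] by (simp add: zero_prod_def)
    ultimately show "v = 0"
      using Hlin[OF V(2), of a b c] \<eta>c by (auto simp: abc zero_prod_def)
  qed (assumption, rule that)
  define \<zeta> where "\<zeta> y = snd (snd (k y))" for y
  have k: "k y = (fst y, fst (snd y), \<zeta> y)" "\<eta> (k y) = snd (snd y)" "k y \<in> V" if "y \<in> N" for y
  proof -
    have "\<Psi> (k y) = y" "k y \<in> W" using *(5) that by (auto simp: homeomorphism_def)
    then show "k y = (fst y, fst (snd y), \<zeta> y)" "\<eta> (k y) = snd (snd y)" "k y \<in> V"
      using *(2) by (auto simp: \<Psi>_def \<zeta>_def prod_eq_iff)
  qed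
  \<comment> \<open>Implicit differentiation of
    \<open>\<eta> (t, p, \<zeta> (t, p, y)) = y\<close>.\<close>
  define Z where "Z y w = (snd (snd w) - H (k y) (fst w, fst (snd w), 0)) / H (k y) (0, 0, 1)" for y w
  have Hk: "H (k y) (0, 0, 1) \<noteq> 0" if "y \<in> N" for y using k(3)[OF that] by (simp add: V_def)
  have dZ: "(\<zeta> has_derivative Z y) (at y)" if y: "y \<in> N" for y
  proof -
    have "(\<zeta> has_derivative (\<lambda>w. snd (snd (k' y w)))) (at y)"
      unfolding \<zeta>_def by (intro has_derivative_snd *(6) y)
    moreover have "snd (snd (k' y w)) = Z y w" for w
    proof -
      obtain a b c where abc: "k' y w = (a, b, c)" by (metis prod.exhaust)
      have "fst w = a" "fst (snd w) = b" "snd (snd w) = H (k y) (a, b, c)"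
        using *(7)[OF y, of w] abc by (auto simp: prod_eq_iff)
      then show ?thesis
        using Hlin[OF k(3)[OF y], of a b c] Hk[OF y] by (simp add: Z_def abc)
    qed
    ultimately show ?thesis by simp
  qed
  \<comment> \<open>The inverse function theorem provides one derivative only. Since
    \<open>Z\<close> is a quotient of smooth functions evaluated at \<open>(t, p, \<zeta>)\<close>,
    any order of \<open>\<zeta>\<close> passes to \<open>Z\<close>, and the order of
    \<open>\<zeta>\<close> rises by one.\<close>
  have "Ck n N \<zeta>" for n
  proof (induction n)
    case 0
    show ?case using dZ by (auto intro!: continuous_at_imp_continuous_on has_derivative_continuous)
  next
    case (Suc n)
    have ck: "Ck n N (\<lambda>y. H (k y) v)" for v
    proof (rule Ck_compose[OF smooth_onD[OF H(2)]])
      show "Ck n N k"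
        by (rule Ck_cong[OF *(4), of "\<lambda>y. (fst y, fst (snd y), \<zeta> y)"])
           (use k Suc in \<open>auto intro!: Ck_Pair Ck_fst Ck_snd\<close>)
    qed (use k V in auto)
    show ?case
    proof (rule Ck_SucI[OF dZ])
      show "Ck n N (\<lambda>y. Z y v)" for v
        unfolding Z_def using Hk by (intro Ck_divide Ck_diff ck Ck_const)
    qed
  qed
  then have s\<zeta>: "smooth_on N \<zeta>" by (rule smooth_onI)
  have \<Psi>0: "\<Psi> (t0, p0, y0) = (t0, p0, y0)" by (simp add: \<Psi>_def \<eta>_def u)
  show ?thesis
  proof (rule that[OF *(4) _ s\<zeta> _ V0(1) s\<eta> _ dZ])
    show N0: "(t0, p0, y0) \<in> N" using *(3,5) \<Psi>0 by (metis homeomorphism_def imageI)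
    have "k (t0, p0, y0) = (t0, p0, y0)" using *(3,5) \<Psi>0 by (metis homeomorphism_def)
    then show "\<zeta> (t0, p0, y0) = y0" by (simp add: \<zeta>_def)
    show "(t, p, \<zeta> (t, p, y)) \<in> V0 \<and> \<eta> (t, p, \<zeta> (t, p, y)) = y" if "(t, p, y) \<in> N" for t p y
      using k[OF that] V(3) by auto
    fix x assume x: "x \<in> N"
    have "H (k x) (1, 0, 0) = g x"
      using \<eta>t[of "k x"] k[OF x] V(3) by (metis fst_conv prod.collapse snd_conv subsetD)
    then show "Z x (1, 0, g x) = 0" by (simp add: Z_def)
    have "H (k x) (0, 0, 0) = 0"
      using linear_0[OF has_derivative_linear[OF H(1)[of "k x"]]] k(3)[OF x] V(3) by (auto simp: zero_prod_def)
    then show "Z x (0, 0, 1) \<noteq> 0" using Hk[OF x] by (simp add: Z_def)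
  qed
qed


section \<open>Smoothness in terms of iterated partial derivatives\<close>

text \<open>The second difference of \<open>f\<close> over the parallelogram spanned by
  \<open>h v\<close> and \<open>h w\<close> is symmetric in the two directions; the mean value
  theorem, applied twice in either order, expresses it by each mixed derivative at a nearby
  point.\<close>

lemma second_derivative_symmetric:
  fixes f :: "'a::real_normed_vector \<Rightarrow> real"
  assumes U: "open U" "x \<in> U"
    and D: "\<And>x. x \<in> U \<Longrightarrow> (f has_derivative D x) (at x)"
    and V: "\<And>x. x \<in> U \<Longrightarrow> ((\<lambda>x. D x v) has_derivative V x) (at x)"
    and W: "\<And>x. x \<in> U \<Longrightarrow> ((\<lambda>x. D x w) has_derivative W x) (at x)"
    and cont: "continuous_on U (\<lambda>x. V x w)" "continuous_on U (\<lambda>x. W x v)"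
  shows "V x w = W x v"
proof -
  have mv: "\<exists>s1\<in>{0<..<h}. \<exists>s2\<in>{0<..<h}.
      f (x + h *\<^sub>R v + h *\<^sub>R w) - f (x + h *\<^sub>R v) - f (x + h *\<^sub>R w) + f x = h * (h * V (x + s1 *\<^sub>R v + s2 *\<^sub>R w) w)"
    if V: "\<And>x. x \<in> U \<Longrightarrow> ((\<lambda>x. D x v) has_derivative V x) (at x)"
      and h: "h > 0" and sub: "\<And>s1 s2. s1 \<in> {0..h} \<Longrightarrow> s2 \<in> {0..h} \<Longrightarrow> x + s1 *\<^sub>R v + s2 *\<^sub>R w \<in> U"
    for V v w h
  proof -
    have d1: "((\<lambda>s. f (x + s *\<^sub>R v + c *\<^sub>R w)) has_real_derivative D (x + s *\<^sub>R v + c *\<^sub>R w) v) (at s)"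
      if "s \<in> {0..h}" "c \<in> {0..h}" for s c
    proof -
      have "((\<lambda>s. f (x + s *\<^sub>R v + c *\<^sub>R w)) has_derivative (\<lambda>k. D (x + s *\<^sub>R v + c *\<^sub>R w) (k *\<^sub>R v))) (at s)"
        by (rule has_derivative_compose[where g=f and f="\<lambda>s. x + s *\<^sub>R v + c *\<^sub>R w", OF _ D[OF sub[OF that]]]) (auto intro!: derivative_eq_intros)
      moreover have "(\<lambda>k. D (x + s *\<^sub>R v + c *\<^sub>R w) (k *\<^sub>R v)) = (*) (D (x + s *\<^sub>R v + c *\<^sub>R w) v)"
        using linear_cmul[OF has_derivative_linear[OF D[OF sub[OF that]]]] by (auto simp: mult.commute)
      ultimately show ?thesis by (simp only: has_field_derivative_def)
    qed
    have d2: "((\<lambda>c. D (x + s *\<^sub>R v + c *\<^sub>R w) v) has_real_derivative V (x + s *\<^sub>R v + c *\<^sub>R w) w) (at c)"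
      if "s \<in> {0..h}" "c \<in> {0..h}" for s c
    proof -
      have "((\<lambda>c. D (x + s *\<^sub>R v + c *\<^sub>R w) v) has_derivative (\<lambda>k. V (x + s *\<^sub>R v + c *\<^sub>R w) (k *\<^sub>R w))) (at c)"
        by (rule has_derivative_compose[where g="\<lambda>x. D x v" and f="\<lambda>c. x + s *\<^sub>R v + c *\<^sub>R w", OF _ V[OF sub[OF that]]]) (auto intro!: derivative_eq_intros)
      moreover have "(\<lambda>k. V (x + s *\<^sub>R v + c *\<^sub>R w) (k *\<^sub>R w)) = (*) (V (x + s *\<^sub>R v + c *\<^sub>R w) w)"
        using linear_cmul[OF has_derivative_linear[OF V[OF sub[OF that]]]] by (auto simp: mult.commute)
      ultimately show ?thesis by (simp only: has_field_derivative_def)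
    qed
    let ?\<phi> = "\<lambda>s. f (x + s *\<^sub>R v + h *\<^sub>R w) - f (x + s *\<^sub>R v + 0 *\<^sub>R w)"
    have "\<exists>s1>0. s1 < h \<and> ?\<phi> h - ?\<phi> 0 = (h - 0) * (D (x + s1 *\<^sub>R v + h *\<^sub>R w) v - D (x + s1 *\<^sub>R v + 0 *\<^sub>R w) v)"
      by (rule MVT2) (use h in \<open>auto intro!: DERIV_diff d1 simp del: scale_zero_left\<close>)
    then obtain s1 where s1: "0 < s1" "s1 < h"
      "?\<phi> h - ?\<phi> 0 = h * (D (x + s1 *\<^sub>R v + h *\<^sub>R w) v - D (x + s1 *\<^sub>R v + 0 *\<^sub>R w) v)" by auto
    have "\<exists>s2>0. s2 < h \<and> D (x + s1 *\<^sub>R v + h *\<^sub>R w) v - D (x + s1 *\<^sub>R v + 0 *\<^sub>R w) v = (h - 0) * V (x + s1 *\<^sub>R v + s2 *\<^sub>R w) w"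
      by (rule MVT2) (use h s1 in \<open>auto intro!: d2\<close>)
    then obtain s2 where s2: "0 < s2" "s2 < h"
      "D (x + s1 *\<^sub>R v + h *\<^sub>R w) v - D (x + s1 *\<^sub>R v + 0 *\<^sub>R w) v = h * V (x + s1 *\<^sub>R v + s2 *\<^sub>R w) w" by auto
    have "f (x + h *\<^sub>R v + h *\<^sub>R w) - f (x + h *\<^sub>R v) - f (x + h *\<^sub>R w) + f x = h * (h * V (x + s1 *\<^sub>R v + s2 *\<^sub>R w) w)"
      using s1(3) unfolding s2(3) by simp
    then show ?thesis using s1(1,2) s2(1,2) by (intro bexI[of _ s1] bexI[of _ s2]) auto
  qed
  show ?thesis
  proof (rule ccontr)
    assume ne: "V x w \<noteq> W x v"
    define e where "e = \<bar>V x w - W x v\<bar> / 2"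
    have e: "e > 0" using ne by (simp add: e_def)
    have "isCont (\<lambda>x. V x w) x" "isCont (\<lambda>x. W x v) x"
      using cont U by (auto simp: continuous_on_eq_continuous_at)
    then obtain d1 d2 where d: "d1 > 0" "\<And>y. dist y x < d1 \<Longrightarrow> dist (V y w) (V x w) < e"
       "d2 > 0" "\<And>y. dist y x < d2 \<Longrightarrow> dist (W y v) (W x v) < e"
      using e unfolding continuous_at_eps_delta by metis
    obtain d3 where d3: "d3 > 0" "ball x d3 \<subseteq> U" using U openE by blast
    define d where "d = min d1 (min d2 d3)"
    \<comment> \<open>With this \<open>h\<close> every point of the parallelogram lies within
      \<open>d\<close> of \<open>x\<close>, hence in \<open>U\<close> and in both continuity
      balls.\<close>
    define h where "h = d / (2 * (1 + norm v + norm w))"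
    have dpos: "d > 0" using d d3 by (simp add: d_def)
    have n: "1 + norm v + norm w > 0" by (smt (verit) norm_ge_zero)
    have h: "h > 0" using dpos n by (simp add: h_def)
    have near: "dist (x + s1 *\<^sub>R v + s2 *\<^sub>R w) x < d" "dist (x + s1 *\<^sub>R w + s2 *\<^sub>R v) x < d"
      if "s1 \<in> {0..h}" "s2 \<in> {0..h}" for s1 s2
    proof -
      have le: "norm (s1 *\<^sub>R a + s2 *\<^sub>R b) < d" if ab: "norm a + norm b = norm v + norm w" for a b :: 'a
      proof -
        have "norm (s1 *\<^sub>R a + s2 *\<^sub>R b) \<le> s1 * norm a + s2 * norm b"
          using norm_triangle_ineq[of "s1 *\<^sub>R a" "s2 *\<^sub>R b"] \<open>s1 \<in> _\<close> \<open>s2 \<in> _\<close> by simp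
        also have "\<dots> \<le> h * norm a + h * norm b"
          using \<open>s1 \<in> _\<close> \<open>s2 \<in> _\<close> by (intro add_mono mult_right_mono) auto
        also have "\<dots> = h * (norm v + norm w)" using ab by (simp flip: distrib_left)
        also have "\<dots> < h * (2 * (1 + norm v + norm w))" using h n by (intro mult_strict_left_mono) (auto simp: add_nonneg_pos)
        also have "\<dots> = d" using n by (simp add: h_def)
        finally show ?thesis .
      qed
      show "dist (x + s1 *\<^sub>R v + s2 *\<^sub>R w) x < d" "dist (x + s1 *\<^sub>R w + s2 *\<^sub>R v) x < d"
        using le[of v w] le[of w v] by (auto simp: dist_norm add.assoc)
    qed
    have inU: "y \<in> U" if "dist y x < d" for y
      using that d3 by (auto simp: d_def subset_iff dist_commute)
    obtain s1 s2 where s: "s1 \<in> {0<..<h}" "s2 \<in> {0<..<h}"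
      "f (x + h *\<^sub>R v + h *\<^sub>R w) - f (x + h *\<^sub>R v) - f (x + h *\<^sub>R w) + f x = h * (h * V (x + s1 *\<^sub>R v + s2 *\<^sub>R w) w)"
      using mv[OF V h inU[OF near(1)]] by blast
    obtain r1 r2 where r: "r1 \<in> {0<..<h}" "r2 \<in> {0<..<h}"
      "f (x + h *\<^sub>R w + h *\<^sub>R v) - f (x + h *\<^sub>R w) - f (x + h *\<^sub>R v) + f x = h * (h * W (x + r1 *\<^sub>R w + r2 *\<^sub>R v) v)"
      using mv[OF W h inU[OF near(2)]] by blast
    have "h * (h * V (x + s1 *\<^sub>R v + s2 *\<^sub>R w) w) = h * (h * W (x + r1 *\<^sub>R w + r2 *\<^sub>R v) v)"
      using s(3) r(3) by (simp add: algebra_simps)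
    then have "V (x + s1 *\<^sub>R v + s2 *\<^sub>R w) w = W (x + r1 *\<^sub>R w + r2 *\<^sub>R v) v" using h by simp
    moreover have "dist (V (x + s1 *\<^sub>R v + s2 *\<^sub>R w) w) (V x w) < e"
      using near(1)[of s1 s2] s by (intro d) (auto simp: d_def)
    moreover have "dist (W (x + r1 *\<^sub>R w + r2 *\<^sub>R v) v) (W x v) < e"
      using near(2)[of r1 r2] r by (intro d) (auto simp: d_def)
    ultimately have "\<bar>V x w - W x v\<bar> < 2 * e" unfolding dist_real_def by linarith
    then show False by (simp add: e_def)
  qed
qed

section \<open>Partial derivatives and the Frechet derivative\<close>

abbreviation unc :: "(real \<Rightarrow> real \<Rightarrow> real \<Rightarrow> real) \<Rightarrow> real \<times> real \<times> real \<Rightarrow> real" where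
  "unc f \<equiv> (\<lambda>(t, x, y). f t x y)"

definition grad3 :: "(real \<Rightarrow> real \<Rightarrow> real \<Rightarrow> real) \<Rightarrow> real \<times> real \<times> real \<Rightarrow> real \<times> real \<times> real \<Rightarrow> real" where
  "grad3 f q v = fst v * unc (pd3 CT f) q + fst (snd v) * unc (pd3 CX f) q + snd (snd v) * unc (pd3 CX1 f) q"

lemma has_derivative_partials2:
  fixes g :: "real \<Rightarrow> real \<Rightarrow> real"
  assumes "open B" "open C" "convex C" "x \<in> B" "y \<in> C"
    and gx: "((\<lambda>s. g s y) has_real_derivative gx) (at x)"
    and gy: "\<And>x y. x \<in> B \<Longrightarrow> y \<in> C \<Longrightarrow> ((\<lambda>s. g x s) has_real_derivative gy x y) (at y)"
    and cont: "continuous_on (B \<times> C) (\<lambda>(x, y). gy x y)"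
  shows "((\<lambda>(x, y). g x y) has_derivative (\<lambda>(a, b). a * gx + b * gy x y)) (at (x, y))"
proof -
  have "((\<lambda>(x, y). g x y) has_derivative (\<lambda>(a, b). gx * a + blinfun_apply (blinfun_mult_right (gy x y)) b)) (at (x, y) within B \<times> C)"
  proof (rule has_derivative_partialsI)
    show "((\<lambda>x. g x y) has_derivative (*) gx) (at x within B)"
      using gx by (simp add: has_field_derivative_def has_derivative_at_withinI)
    show "((\<lambda>y. g x y) has_derivative blinfun_apply (blinfun_mult_right (gy x y))) (at y within C)"
      if "x \<in> B" "y \<in> C" for x y
      using gy[OF that] by (simp add: has_field_derivative_def has_derivative_at_withinI)
    have "continuous_on (B \<times> C) (\<lambda>(x, y). blinfun_mult_right (gy x y))"
      using cont by (auto simp: split_beta intro!: bounded_linear.continuous_on[OF bounded_linear_blinfun_mult_right])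
    then show "continuous (at (x, y) within B \<times> C) (\<lambda>(x, y). blinfun_mult_right (gy x y))"
      using assms by (auto simp: continuous_on_eq_continuous_within)
  qed (use assms in auto)
  then show ?thesis
    using assms by (simp add: at_within_open[of "(x, y)" "B \<times> C"] open_Times mult.commute)
qed

text \<open>Continuous partial derivatives give differentiability. The criterion at hand splits off
  one variable at a time, so the pair (x, y) is treated first and t is adjoined afterwards.\<close>

lemma has_derivative_grad3:
  assumes U: "open U" "q \<in> U"
    and diff: "\<And>t x y. (t, x, y) \<in> U \<Longrightarrow> (\<lambda>s. f s x y) differentiable (at t) \<and>
            (\<lambda>s. f t s y) differentiable (at x) \<and> (\<lambda>s. f t x s) differentiable (at y)"
    and cont: "\<And>c. continuous_on U (unc (pd3 c f))"
  shows "(unc f has_derivative grad3 f q) (at q)"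
proof -
  obtain t x y where q: "q = (t, x, y)" by (metis prod.exhaust)
  obtain A E where AE: "open A" "open E" "t \<in> A" "(x, y) \<in> E" "A \<times> E \<subseteq> U"
    using open_prod_elim[OF U] q by (metis mem_Sigma_iff)
  obtain B C where BC: "open B" "open C" "x \<in> B" "y \<in> C" "B \<times> C \<subseteq> E"
    using open_prod_elim[OF AE(2,4)] by (metis mem_Sigma_iff)
  obtain b c where bc: "b > 0" "ball x b \<subseteq> B" "c > 0" "ball y c \<subseteq> C"
    using BC by (meson openE)
  define B' C' where "B' = ball x b" and "C' = ball y c"
  have sub: "(t', x', y') \<in> U" if "t' \<in> A" "x' \<in> B'" "y' \<in> C'" for t' x' y'
    using that AE BC bc unfolding B'_def C'_def by blast
  have p: "((\<lambda>s. f s x' y') has_real_derivative pd3 CT f t' x' y') (at t')"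
    "((\<lambda>s. f t' s y') has_real_derivative pd3 CX f t' x' y') (at x')"
    "((\<lambda>s. f t' x' s) has_real_derivative pd3 CX1 f t' x' y') (at y')" if "t' \<in> A" "x' \<in> B'" "y' \<in> C'" for t' x' y'
    using diff[OF sub[OF that]] by (auto simp: pd3_def DERIV_deriv_iff_real_differentiable)
  have B'C': "open B'" "open C'" "convex B'" "convex C'" "x \<in> B'" "y \<in> C'"
    using bc by (auto simp: B'_def C'_def)
  have d2: "((\<lambda>(x, y). f t' x y) has_derivative (\<lambda>(a, b). a * pd3 CX f t' x' y' + b * pd3 CX1 f t' x' y')) (at (x', y'))"
    if t': "t' \<in> A" "x' \<in> B'" "y' \<in> C'" for t' x' y'
  proof (rule has_derivative_partials2[where gy="\<lambda>x y. pd3 CX1 f t' x y"])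
    have "continuous_on (B' \<times> C') (\<lambda>z. unc (pd3 CX1 f) (t', z))"
      by (rule continuous_on_compose2[OF cont]) (use sub t' in \<open>auto intro!: continuous_intros\<close>)
    then show "continuous_on (B' \<times> C') (\<lambda>(x, y). pd3 CX1 f t' x y)" by (simp add: split_beta)
  qed (use B'C' t' p in auto)
  define L :: "real \<Rightarrow> real \<times> real \<Rightarrow> (real \<times> real) \<Rightarrow>\<^sub>L real"
    where "L t' z = pd3 CX f t' (fst z) (snd z) *\<^sub>R fst_blinfun + pd3 CX1 f t' (fst z) (snd z) *\<^sub>R snd_blinfun"
    for t' z
  have "((\<lambda>(t, z). (\<lambda>t (x, y). f t x y) t z) has_derivative (\<lambda>(a, z'). pd3 CT f t x y * a + blinfun_apply (L t (x, y)) z')) (at (t, (x, y)) within A \<times> (B' \<times> C'))"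
  proof (rule has_derivative_partialsI)
    show "((\<lambda>t. case (x, y) of (x, y) \<Rightarrow> f t x y) has_derivative (*) (pd3 CT f t x y)) (at t within A)"
      using p(1)[OF AE(3) B'C'(5,6)] by (simp add: has_field_derivative_def has_derivative_at_withinI)
    show "((\<lambda>(x, y). f t' x y) has_derivative blinfun_apply (L t' z)) (at z within B' \<times> C')"
      if "t' \<in> A" "z \<in> B' \<times> C'" for t' z
    proof -
      have "blinfun_apply (L t' z) = (\<lambda>(a, b). a * pd3 CX f t' (fst z) (snd z) + b * pd3 CX1 f t' (fst z) (snd z))"
        by (auto simp: L_def blinfun.bilinear_simps mult.commute)
      then show ?thesis using d2[of t' "fst z" "snd z"] that by (auto intro: has_derivative_at_withinI)
    qed
    have "continuous_on (A \<times> B' \<times> C') (unc (pd3 c f))" for c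
      by (rule continuous_on_subset[OF cont]) (use sub in auto)
    then have "continuous_on (A \<times> B' \<times> C') (\<lambda>(t, z). L t z)"
      unfolding L_def split_beta by (intro continuous_intros)
    then show "continuous (at (t, x, y) within A \<times> B' \<times> C') (\<lambda>(t, z). L t z)"
      using AE B'C' by (auto simp: continuous_on_eq_continuous_within)
    show "(x, y) \<in> B' \<times> C'" "convex (B' \<times> C')" using B'C' by (auto intro: convex_Times)
  qed
  moreover have "at (t, (x, y)) within A \<times> (B' \<times> C') = at (t, x, y)"
    by (rule at_within_open) (use AE B'C' in \<open>auto intro!: open_Times\<close>)
  moreover have "(\<lambda>(a, z'). pd3 CT f t x y * a + blinfun_apply (L t (x, y)) z') = grad3 f q"
    by (auto simp: grad3_def q L_def blinfun.bilinear_simps mult.commute)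
  ultimately show ?thesis by (simp add: q)
qed

lemma has_derivative_partials:
  assumes "(unc f has_derivative D) (at (t, x, y))"
  shows "((\<lambda>s. f s x y) has_real_derivative D (1, 0, 0)) (at t)"
    "((\<lambda>s. f t s y) has_real_derivative D (0, 1, 0)) (at x)"
    "((\<lambda>s. f t x s) has_real_derivative D (0, 0, 1)) (at y)"
proof -
  have l: "linear D" using assms has_derivative_linear by blast
  have "((\<lambda>s. unc f (s, x, y)) has_derivative (\<lambda>k. D (k, 0, 0))) (at t)"
    by (rule has_derivative_compose[where g="unc f" and f="\<lambda>s. (s, x, y)", OF _ assms]) (auto intro!: derivative_eq_intros simp: zero_prod_def)
  moreover have "(\<lambda>k. D (k, 0, 0)) = (*) (D (1, 0, 0))"
  proof
    show "D (k, 0, 0) = D (1, 0, 0) * k" for k using linear_cmul[OF l, of k "(1, 0, 0)"] by (simp add: mult.commute)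
  qed
  ultimately show "((\<lambda>s. f s x y) has_real_derivative D (1, 0, 0)) (at t)" by (simp add: has_field_derivative_def)
  have "((\<lambda>s. unc f (t, s, y)) has_derivative (\<lambda>k. D (0, k, 0))) (at x)"
    by (rule has_derivative_compose[where g="unc f" and f="\<lambda>s. (t, s, y)", OF _ assms]) (auto intro!: derivative_eq_intros simp: zero_prod_def)
  moreover have "(\<lambda>k. D (0, k, 0)) = (*) (D (0, 1, 0))"
  proof
    show "D (0, k, 0) = D (0, 1, 0) * k" for k using linear_cmul[OF l, of k "(0, 1, 0)"] by (simp add: mult.commute)
  qed
  ultimately show "((\<lambda>s. f t s y) has_real_derivative D (0, 1, 0)) (at x)" by (simp add: has_field_derivative_def)
  have "((\<lambda>s. unc f (t, x, s)) has_derivative (\<lambda>k. D (0, 0, k))) (at y)"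
    by (rule has_derivative_compose[where g="unc f" and f="\<lambda>s. (t, x, s)", OF _ assms]) (auto intro!: derivative_eq_intros simp: zero_prod_def)
  moreover have "(\<lambda>k. D (0, 0, k)) = (*) (D (0, 0, 1))"
  proof
    show "D (0, 0, k) = D (0, 0, 1) * k" for k using linear_cmul[OF l, of k "(0, 0, 1)"] by (simp add: mult.commute)
  qed
  ultimately show "((\<lambda>s. f t x s) has_real_derivative D (0, 0, 1)) (at y)" by (simp add: has_field_derivative_def)
qed

lemma pd3_eq_derivative:
  assumes "(unc f has_derivative D) (at (t, x, y))"
  shows "pd3 CT f t x y = D (1, 0, 0)" "pd3 CX f t x y = D (0, 1, 0)" "pd3 CX1 f t x y = D (0, 0, 1)"
  using has_derivative_partials[OF assms, THEN DERIV_imp_deriv] by (simp_all add: pd3_def)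

lemma ipd_append: "ipd (cs @ [c]) f = ipd cs (pd3 c f)"
  by (induction cs) auto

text \<open>\<open>ipd\<close> applies the last entry of its list first, so appending
  \<open>c\<close> to a list means differentiating by \<open>c\<close> before everything
  else.\<close>

lemma smooth3_pd3: "smooth3 U f \<Longrightarrow> smooth3 U (pd3 c f)"
  unfolding smooth3_def by (simp flip: ipd_append)

lemma smooth3_has_derivative:
  assumes "smooth3 U f" "open U" "q \<in> U"
  shows "(unc f has_derivative grad3 f q) (at q)"
proof (rule has_derivative_grad3[OF assms(2,3)])
  show "continuous_on U (unc (pd3 c f))" for c
    using assms(1)[unfolded smooth3_def, THEN spec, of "[c]"] by simp
next
  fix t x y assume "(t, x, y) \<in> U"
  then show "(\<lambda>s. f s x y) differentiable (at t) \<and>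
            (\<lambda>s. f t s y) differentiable (at x) \<and> (\<lambda>s. f t x s) differentiable (at y)"
    using assms(1)[unfolded smooth3_def, THEN spec, of "[]"] by auto
qed

text \<open>In one direction the partial derivatives supply the gradient and are again smooth; in
  the other, each partial derivative is the Frechet derivative in a coordinate direction, so
  smoothness is inherited along the list.\<close>

lemma smooth3_iff_smooth_on:
  assumes U: "open U"
  shows "smooth3 U f \<longleftrightarrow> smooth_on U (unc f)"
proof
  assume f: "smooth3 U f"
  have "Ck n U (unc f)" for n
    using f
  proof (induction n arbitrary: f)
    case 0
    then have "continuous_on U (unc (ipd [] f))" unfolding smooth3_def by blast
    then show ?case by simp
  next
    case (Suc n)
    show ?case
    proof (rule Ck_SucI[OF smooth3_has_derivative[OF Suc.prems U]])
      show "Ck n U (\<lambda>q. grad3 f q v)" for v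
        unfolding grad3_def by (intro Ck_add Ck_mult Ck_const Suc.IH smooth3_pd3 Suc.prems)
    qed
  qed
  then show "smooth_on U (unc f)" by (rule smooth_onI)
next
  assume f: "smooth_on U (unc f)"
  have s: "smooth_on U (unc (ipd cs f))" for cs
  proof (induction cs)
    case Nil
    show ?case using f by simp
  next
    case (Cons c cs)
    obtain D where D: "\<And>x. x \<in> U \<Longrightarrow> (unc (ipd cs f) has_derivative D x) (at x)"
      "\<And>v. smooth_on U (\<lambda>x. D x v)"
      using smooth_on_obtain_derivative[OF Cons U] by blast
    define e :: "real \<times> real \<times> real" where "e = (case c of CT \<Rightarrow> (1,0,0) | CX \<Rightarrow> (0,1,0) | CX1 \<Rightarrow> (0,0,1))"
    have "D x e = unc (ipd (c # cs) f) x" if "x \<in> U" for x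
      using pd3_eq_derivative[of "ipd cs f" "D x" "fst x" "fst (snd x)" "snd (snd x)"] D(1)[OF that]
      by (cases c) (auto simp: e_def split_beta)
    then show ?case
      using Ck_cong[OF U _ smooth_onD[OF D(2)]] by (intro smooth_onI) blast
  qed
  show "smooth3 U f"
    unfolding smooth3_def
  proof (intro allI conjI)
    fix cs
    show "continuous_on U (unc (ipd cs f))" using s smooth_on_continuous by blast
    obtain D where D: "\<And>x. x \<in> U \<Longrightarrow> (unc (ipd cs f) has_derivative D x) (at x)"
      using smooth_on_obtain_derivative[OF s U] by blast
    show "\<forall>(t, x, y)\<in>U. (\<lambda>s. ipd cs f s x y) differentiable (at t) \<and>
        (\<lambda>s. ipd cs f t s y) differentiable (at x) \<and> (\<lambda>s. ipd cs f t x s) differentiable (at y)"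
    proof (safe, goal_cases)
      case (1 t x y) show ?case using has_derivative_partials(1)[OF D[OF 1]] real_differentiable_def by blast
    next
      case (2 t x y) show ?case using has_derivative_partials(2)[OF D[OF 2]] real_differentiable_def by blast
    next
      case (3 t x y) show ?case using has_derivative_partials(3)[OF D[OF 3]] real_differentiable_def by blast
    qed
  qed
qed

lemma pd3_commute:
  assumes f: "smooth3 U f" and U: "open U" "(t, x, y) \<in> U"
  shows "pd3 c (pd3 d f) t x y = pd3 d (pd3 c f) t x y"
proof -
  define e :: "coord \<Rightarrow> real \<times> real \<times> real" where "e c = (case c of CT \<Rightarrow> (1,0,0) | CX \<Rightarrow> (0,1,0) | CX1 \<Rightarrow> (0,0,1))" for c
  have e: "grad3 g q (e c) = unc (pd3 c g) q" for g q c
    by (cases c) (auto simp: e_def grad3_def)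
  have "grad3 (pd3 d f) (t, x, y) (e c) = grad3 (pd3 c f) (t, x, y) (e d)"
  proof (rule second_derivative_symmetric[OF U smooth3_has_derivative[OF f U(1)]])
    fix q assume "q \<in> U"
    then show "((\<lambda>q. grad3 f q (e d)) has_derivative grad3 (pd3 d f) q) (at q)"
      "((\<lambda>q. grad3 f q (e c)) has_derivative grad3 (pd3 c f) q) (at q)"
      unfolding e using smooth3_has_derivative[OF smooth3_pd3[OF f] U(1)] by auto
  next
    show "continuous_on U (\<lambda>q. grad3 (pd3 d f) q (e c))" "continuous_on U (\<lambda>q. grad3 (pd3 c f) q (e d))"
      unfolding e using smooth3_pd3[OF smooth3_pd3[OF f]] smooth3_iff_smooth_on[OF U(1)] smooth_on_continuous by blast+
  qed
  then show ?thesis by (simp add: e)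
qed


section \<open>First integrals of a projectable vector field\<close>

lemma open_preimage_on:
  assumes "open V" "continuous_on V f" "open W"
  shows "open {x \<in> V. f x \<in> W}"
proof -
  have "open (f -` W \<inter> V)"
    using assms continuous_on_open_vimage by blast
  moreover have "f -` W \<inter> V = {x \<in> V. f x \<in> W}" by auto
  ultimately show ?thesis by simp
qed

text \<open>Division by the nonvanishing \<open>\<alpha>\<close> turns orbits into graphs over t, as
  straightening requires. The projection of the field to (t, x) does not involve y, so
  \<open>z\<close> can be found before \<open>\<zeta>\<close>.\<close>

lemma first_integrals_transversal:
  fixes \<alpha> \<beta> :: "real \<Rightarrow> real \<Rightarrow> real" and \<gamma> :: "real \<Rightarrow> real \<Rightarrow> real \<Rightarrow> real"
  assumes U: "open U" "(t0, x0, y0) \<in> U"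
    and \<alpha>: "smooth_on U (\<lambda>(t, x, y). \<alpha> t x)" and \<beta>: "smooth_on U (\<lambda>(t, x, y). \<beta> t x)" and \<gamma>: "smooth_on U (unc \<gamma>)"
    and nz: "\<alpha> t0 x0 \<noteq> 0"
  obtains N and z :: "real \<Rightarrow> real \<Rightarrow> real" and \<zeta> :: "real \<Rightarrow> real \<Rightarrow> real \<Rightarrow> real" and P Q where "open N" "N \<subseteq> U" "(t0, x0, y0) \<in> N"
    "smooth_on N (\<lambda>(t, x, y). z t x)" "smooth_on N (unc \<zeta>)"
    "\<And>q. q \<in> N \<Longrightarrow> ((\<lambda>(t, x, y). z t x) has_derivative P q) (at q)"
    "\<And>q. q \<in> N \<Longrightarrow> (unc \<zeta> has_derivative Q q) (at q)"
    "\<And>t x y. (t, x, y) \<in> N \<Longrightarrow> P (t, x, y) (\<alpha> t x, \<beta> t x, \<gamma> t x y) = 0 \<and> Q (t, x, y) (\<alpha> t x, \<beta> t x, \<gamma> t x y) = 0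
        \<and> P (t, x, y) (0, 1, 0) \<noteq> 0 \<and> Q (t, x, y) (0, 0, 1) \<noteq> 0"
proof -
  define U1 where "U1 = {q \<in> U. (\<lambda>(t, x, y). \<alpha> t x) q \<in> - {0}}"
  have U1: "open U1" "(t0, x0, y0) \<in> U1" "U1 \<subseteq> U"
    unfolding U1_def using open_preimage_on[OF U(1) smooth_on_continuous[OF \<alpha>], of "-{0}"] U nz by auto
  have \<alpha>nz: "\<alpha> t x \<noteq> 0" if "(t, x, y) \<in> U1" for t x y using that by (auto simp: U1_def)
  \<comment> \<open>The equation for x carries no parameter, so a dummy one with value 0 occupies
    the middle slot; \<open>y0\<close> is a placeholder, since \<open>\<alpha>\<close> and
    \<open>\<beta>\<close> do not depend on y.\<close>
  let ?s = "\<lambda>z::real \<times> real \<times> real. (fst z, snd (snd z), y0)"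
  have cs: "continuous_on UNIV ?s" by (intro continuous_intros)
  have "open (?s -` U1)" by (rule open_vimage[OF U1(1) cs])
  moreover have "(t0, 0, x0) \<in> ?s -` U1" using U1 by simp
  moreover have "smooth_on (?s -` U1) (\<lambda>z. (\<lambda>(t, x, y). \<beta> t x) (?s z) / (\<lambda>(t, x, y). \<alpha> t x) (?s z))"
    by (intro smooth_onI Ck_divide Ck_compose[OF smooth_onD[OF \<alpha>]] Ck_compose[OF smooth_onD[OF \<beta>]]
          Ck_Pair Ck_fst Ck_snd Ck_ident Ck_const) (use U1 \<alpha>nz in auto)
  ultimately obtain N1 V1 \<eta>1 \<zeta>1 Z1 where 1: "open N1" "(t0, 0, x0) \<in> N1" "smooth_on N1 \<zeta>1" "\<zeta>1 (t0, 0, x0) = x0"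
    "open V1" "smooth_on V1 \<eta>1"
    "\<And>t p y. (t, p, y) \<in> N1 \<Longrightarrow> (t, p, \<zeta>1 (t, p, y)) \<in> V1 \<and> \<eta>1 (t, p, \<zeta>1 (t, p, y)) = y"
    "\<And>x. x \<in> N1 \<Longrightarrow> (\<zeta>1 has_derivative Z1 x) (at x)"
    "\<And>x. x \<in> N1 \<Longrightarrow> Z1 x (1, 0, (\<lambda>z. (\<lambda>(t, x, y). \<beta> t x) (?s z) / (\<lambda>(t, x, y). \<alpha> t x) (?s z)) x) = 0"
    "\<And>x. x \<in> N1 \<Longrightarrow> Z1 x (0, 0, 1) \<noteq> 0"
    by (rule flow_box) blast
  \<comment> \<open>In the coordinates \<open>(t, z, y)\<close> the field has no \<open>z\<close>-component, so the second invariant again comes from a scalar ODE.\<close>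
  define z where "z t x = \<zeta>1 (t, 0, x)" for t x
  define V2 where "V2 = {q::real \<times> real \<times> real. (fst q, 0::real, fst (snd q)) \<in> V1}"
  let ?j = "\<lambda>q::real \<times> real \<times> real. (fst q, 0::real, fst (snd q))"
  have cj: "continuous_on UNIV ?j" by (intro continuous_intros)
  have V2: "open V2" using open_vimage[OF 1(5) cj] by (simp add: V2_def vimage_def)
  \<comment> \<open>The return from (t, z, y) to (t, x, y): x is the value at time t of the solution
    labelled by z.\<close>
  let ?k = "\<lambda>q::real \<times> real \<times> real. (fst q, \<eta>1 (fst q, 0, fst (snd q)), snd (snd q))"
  have sk: "smooth_on V2 ?k"
    by (intro smooth_onI Ck_Pair Ck_fst Ck_snd Ck_ident Ck_compose[OF smooth_onD[OF 1(6)]] Ck_const) (auto simp: V2_def)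
  define V3 where "V3 = {q \<in> V2. ?k q \<in> U1}"
  have "open V3" unfolding V3_def by (rule open_preimage_on[OF V2 smooth_on_continuous[OF sk] U1(1)])
  moreover have "(t0, x0, y0) \<in> V3"
    using 1(7)[OF 1(2)] 1(4) U1 by (simp add: V3_def V2_def)
  moreover have "smooth_on V3 (\<lambda>q. unc \<gamma> (?k q) / (\<lambda>(t, x, y). \<alpha> t x) (?k q))"
  proof (intro smooth_onI Ck_divide)
    have k3: "Ck n V3 ?k" for n by (rule Ck_subset[OF smooth_onD[OF sk]]) (auto simp: V3_def)
    have kU: "?k ` V3 \<subseteq> U" using U1(3) by (auto simp: V3_def)
    show "Ck n V3 (\<lambda>q. unc \<gamma> (?k q))" for n by (rule Ck_compose[OF smooth_onD[OF \<gamma>] k3 kU])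
    show "Ck n V3 (\<lambda>q. (\<lambda>(t, x, y). \<alpha> t x) (?k q))" for n by (rule Ck_compose[OF smooth_onD[OF \<alpha>] k3 kU])
    show "(\<lambda>(t, x, y). \<alpha> t x) (?k q) \<noteq> 0" if "q \<in> V3" for q using that by (auto simp: V3_def U1_def)
  qed
  ultimately obtain N2 V4 \<eta>2 \<zeta>2 Z2 where 2: "open N2" "(t0, x0, y0) \<in> N2" "smooth_on N2 \<zeta>2"
    "\<zeta>2 (t0, x0, y0) = y0" "open V4" "smooth_on V4 \<eta>2"
    "\<And>t p y. (t, p, y) \<in> N2 \<Longrightarrow> (t, p, \<zeta>2 (t, p, y)) \<in> V4 \<and> \<eta>2 (t, p, \<zeta>2 (t, p, y)) = y"
    "\<And>x. x \<in> N2 \<Longrightarrow> (\<zeta>2 has_derivative Z2 x) (at x)"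
    "\<And>x. x \<in> N2 \<Longrightarrow> Z2 x (1, 0, (\<lambda>q. unc \<gamma> (?k q) / (\<lambda>(t, x, y). \<alpha> t x) (?k q)) x) = 0"
    "\<And>x. x \<in> N2 \<Longrightarrow> Z2 x (0, 0, 1) \<noteq> 0"
    by (rule flow_box) blast
  define M where "M = {q \<in> U1. ?j q \<in> N1}"
  have M: "open M" unfolding M_def
    by (rule open_preimage_on[OF U1(1) _ 1(1)]) (intro continuous_intros)
  let ?z = "\<lambda>q. \<zeta>1 (?j q)"
  have sz: "smooth_on M ?z"
    by (intro smooth_onI Ck_compose[OF smooth_onD[OF 1(3)]] Ck_Pair Ck_fst Ck_snd Ck_ident Ck_const) (auto simp: M_def)
  let ?l = "\<lambda>q. (fst q, ?z q, snd (snd q))"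
  have sl: "smooth_on M ?l" by (intro smooth_onI Ck_Pair Ck_fst Ck_snd Ck_ident smooth_onD[OF sz])
  define N where "N = {q \<in> M. ?l q \<in> N2}"
  have N: "open N" unfolding N_def by (rule open_preimage_on[OF M smooth_on_continuous[OF sl] 2(1)])
  have NM: "N \<subseteq> M" by (auto simp: N_def)
  let ?\<zeta> = "\<lambda>t x y. \<zeta>2 (t, z t x, y)"
  have z_eq: "(\<lambda>(t, x, y). z t x) = ?z" by (auto simp: z_def)
  have \<zeta>_eq: "unc ?\<zeta> = (\<lambda>q. \<zeta>2 (?l q))" by (auto simp: z_def)
  let ?P = "\<lambda>q v. Z1 (?j q) (fst v, 0, fst (snd v))"
  let ?Q = "\<lambda>q v. Z2 (?l q) (fst v, ?P q v, snd (snd v))"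
  have dP: "(?z has_derivative ?P q) (at q)" if "q \<in> N" for q
    by (rule has_derivative_compose[where g=\<zeta>1 and f="?j"])
       (use that 1(8) in \<open>auto simp: N_def M_def intro!: derivative_eq_intros has_derivative_Pair\<close>)
  have dQ: "((\<lambda>q. \<zeta>2 (?l q)) has_derivative ?Q q) (at q)" if "q \<in> N" for q
  proof (rule has_derivative_compose[where g=\<zeta>2 and f="?l"])
    show "(?l has_derivative (\<lambda>v. (fst v, ?P q v, snd (snd v)))) (at q)"
      by (intro has_derivative_Pair dP[OF that] has_derivative_fst has_derivative_snd has_derivative_ident)
    show "(\<zeta>2 has_derivative Z2 (?l q)) (at (?l q))" using that 2(8) by (auto simp: N_def)
  qed
  show ?thesis
  proof (rule that[OF N, of z ?\<zeta> ?P ?Q])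
    show "N \<subseteq> U" using U1 by (auto simp: N_def M_def)
    show "(t0, x0, y0) \<in> N" using U1 1 2 by (simp add: N_def M_def)
    show "smooth_on N (\<lambda>(t, x, y). z t x)" unfolding z_eq by (rule smooth_on_subset[OF sz NM])
    show "smooth_on N (unc ?\<zeta>)" unfolding \<zeta>_eq
      by (intro smooth_onI Ck_compose[OF smooth_onD[OF 2(3)]] Ck_subset[OF smooth_onD[OF sl] NM]) (auto simp: N_def)
    show "((\<lambda>(t, x, y). z t x) has_derivative ?P q) (at q)" if "q \<in> N" for q
      unfolding z_eq by (rule dP[OF that])
    show "(unc ?\<zeta> has_derivative ?Q q) (at q)" if "q \<in> N" for q
      unfolding \<zeta>_eq by (rule dQ[OF that])
    fix t x y assume q: "(t, x, y) \<in> N"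
    let ?q = "(t, x, y)"
    have j: "?j ?q \<in> N1" "?q \<in> U1" "?l ?q \<in> N2" using q by (auto simp: N_def M_def)
    have a: "\<alpha> t x \<noteq> 0" using \<alpha>nz j by blast
    have l1: "linear (Z1 (?j ?q))" using 1(8)[OF j(1)] has_derivative_linear by blast
    have l2: "linear (Z2 (?l ?q))" using 2(8)[OF j(3)] has_derivative_linear by blast
    have P0: "?P ?q (\<alpha> t x, \<beta> t x, \<gamma> t x y) = 0"
    proof -
      have "?P ?q (\<alpha> t x, \<beta> t x, \<gamma> t x y) = Z1 (?j ?q) (\<alpha> t x *\<^sub>R (1, 0, \<beta> t x / \<alpha> t x))" using a by simp
      also have "\<dots> = \<alpha> t x *\<^sub>R Z1 (?j ?q) (1, 0, \<beta> t x / \<alpha> t x)" by (rule linear_cmul[OF l1])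
      also have "Z1 (?j ?q) (1, 0, \<beta> t x / \<alpha> t x) = 0" using 1(9)[OF j(1)] by simp
      finally show ?thesis by simp
    qed
    have "?Q ?q (\<alpha> t x, \<beta> t x, \<gamma> t x y) = Z2 (?l ?q) (\<alpha> t x *\<^sub>R (1, 0, \<gamma> t x y / \<alpha> t x))" using a P0 by simp
    also have "\<dots> = \<alpha> t x *\<^sub>R Z2 (?l ?q) (1, 0, \<gamma> t x y / \<alpha> t x)" by (rule linear_cmul[OF l2])
    also have "Z2 (?l ?q) (1, 0, \<gamma> t x y / \<alpha> t x) = 0"
      using 2(9)[OF j(3)] 1(7)[of t 0 x] j(1) by simp
    finally have Q0: "?Q ?q (\<alpha> t x, \<beta> t x, \<gamma> t x y) = 0" by simp
    have "?P ?q (0, 1, 0) \<noteq> 0" using 1(10)[OF j(1)] by simp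
    \<comment> \<open>\<open>z\<close> has no y-derivative, so the y-derivative of the composite is
      that of \<open>\<zeta>2\<close> in its last argument.\<close>
    moreover have "?P ?q (0, 0, 1) = 0" using linear_0[OF l1] by (simp add: zero_prod_def)
    then have "?Q ?q (0, 0, 1) \<noteq> 0" using 2(10)[OF j(3)] by simp
    ultimately show "?P ?q (\<alpha> t x, \<beta> t x, \<gamma> t x y) = 0 \<and> ?Q ?q (\<alpha> t x, \<beta> t x, \<gamma> t x y) = 0
        \<and> ?P ?q (0, 1, 0) \<noteq> 0 \<and> ?Q ?q (0, 0, 1) \<noteq> 0" using P0 Q0 by blast
  qed
qed

text \<open>If \<open>\<alpha>\<close> vanishes at the point then \<open>\<beta>\<close> does not,
  and exchanging t and x brings back the transversal case. The exchange also swaps z_t and z_x,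
  hence the disjunction in the conclusion.\<close>

lemma first_integrals:
  fixes \<alpha> \<beta> :: "real \<Rightarrow> real \<Rightarrow> real" and \<gamma> :: "real \<Rightarrow> real \<Rightarrow> real \<Rightarrow> real"
  assumes U: "open U" "(t0, x0, y0) \<in> U"
    and \<alpha>: "smooth_on U (\<lambda>(t, x, y). \<alpha> t x)" and \<beta>: "smooth_on U (\<lambda>(t, x, y). \<beta> t x)" and \<gamma>: "smooth_on U (unc \<gamma>)"
    and nz: "\<alpha> t0 x0 \<noteq> 0 \<or> \<beta> t0 x0 \<noteq> 0"
  obtains N and z :: "real \<Rightarrow> real \<Rightarrow> real" and \<zeta> :: "real \<Rightarrow> real \<Rightarrow> real \<Rightarrow> real" and P Q where "open N" "N \<subseteq> U" "(t0, x0, y0) \<in> N"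
    "smooth_on N (\<lambda>(t, x, y). z t x)" "smooth_on N (unc \<zeta>)"
    "\<And>q. q \<in> N \<Longrightarrow> ((\<lambda>(t, x, y). z t x) has_derivative P q) (at q)"
    "\<And>q. q \<in> N \<Longrightarrow> (unc \<zeta> has_derivative Q q) (at q)"
    "\<And>t x y. (t, x, y) \<in> N \<Longrightarrow> P (t, x, y) (\<alpha> t x, \<beta> t x, \<gamma> t x y) = 0 \<and> Q (t, x, y) (\<alpha> t x, \<beta> t x, \<gamma> t x y) = 0
        \<and> (P (t, x, y) (1, 0, 0) \<noteq> 0 \<or> P (t, x, y) (0, 1, 0) \<noteq> 0) \<and> Q (t, x, y) (0, 0, 1) \<noteq> 0"
proof (cases "\<alpha> t0 x0 \<noteq> 0")
  case True
  obtain N and z :: "real \<Rightarrow> real \<Rightarrow> real" and \<zeta> :: "real \<Rightarrow> real \<Rightarrow> real \<Rightarrow> real" and P Q where *: "open N" "N \<subseteq> U" "(t0, x0, y0) \<in> N"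
    "smooth_on N (\<lambda>(t, x, y). z t x)" "smooth_on N (unc \<zeta>)"
    "\<And>q. q \<in> N \<Longrightarrow> ((\<lambda>(t, x, y). z t x) has_derivative P q) (at q)"
    "\<And>q. q \<in> N \<Longrightarrow> (unc \<zeta> has_derivative Q q) (at q)"
    "\<And>t x y. (t, x, y) \<in> N \<Longrightarrow> P (t, x, y) (\<alpha> t x, \<beta> t x, \<gamma> t x y) = 0 \<and> Q (t, x, y) (\<alpha> t x, \<beta> t x, \<gamma> t x y) = 0
        \<and> P (t, x, y) (0, 1, 0) \<noteq> 0 \<and> Q (t, x, y) (0, 0, 1) \<noteq> 0"
    using first_integrals_transversal[OF U \<alpha> \<beta> \<gamma> True] by blast
  show ?thesis by (rule that[of N z \<zeta> P Q]) (use * in blast)+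
next
  case False
  let ?\<sigma> = "\<lambda>q::real \<times> real \<times> real. (fst (snd q), fst q, snd (snd q))"
  have \<sigma>: "continuous_on UNIV ?\<sigma>" by (intro continuous_intros)
  have s: "smooth_on (?\<sigma> -` T) (\<lambda>q. f (?\<sigma> q))" if "smooth_on T f" for T and f :: "_ \<Rightarrow> real"
    by (intro smooth_onI Ck_compose[OF smooth_onD[OF that]] Ck_Pair Ck_fst Ck_snd Ck_ident) auto
  have o: "open (?\<sigma> -` T)" if "open T" for T by (rule open_vimage[OF that \<sigma>])
  obtain N and z :: "real \<Rightarrow> real \<Rightarrow> real" and \<zeta> :: "real \<Rightarrow> real \<Rightarrow> real \<Rightarrow> real" and P Q where *: "open N" "N \<subseteq> ?\<sigma> -` U" "(x0, t0, y0) \<in> N"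
    "smooth_on N (\<lambda>(t, x, y). z t x)" "smooth_on N (unc \<zeta>)"
    "\<And>q. q \<in> N \<Longrightarrow> ((\<lambda>(t, x, y). z t x) has_derivative P q) (at q)"
    "\<And>q. q \<in> N \<Longrightarrow> (unc \<zeta> has_derivative Q q) (at q)"
    "\<And>x t y. (x, t, y) \<in> N \<Longrightarrow> P (x, t, y) (\<beta> t x, \<alpha> t x, \<gamma> t x y) = 0 \<and> Q (x, t, y) (\<beta> t x, \<alpha> t x, \<gamma> t x y) = 0
        \<and> P (x, t, y) (0, 1, 0) \<noteq> 0 \<and> Q (x, t, y) (0, 0, 1) \<noteq> 0"
  proof (rule first_integrals_transversal[of "?\<sigma> -` U" x0 t0 y0 "\<lambda>x t. \<beta> t x" "\<lambda>x t. \<alpha> t x" "\<lambda>x t y. \<gamma> t x y"])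
    show "smooth_on (?\<sigma> -` U) (\<lambda>(x, t, y). \<beta> t x)" "smooth_on (?\<sigma> -` U) (\<lambda>(x, t, y). \<alpha> t x)"
      "smooth_on (?\<sigma> -` U) (\<lambda>(x, t, y). \<gamma> t x y)"
      using s[OF \<beta>] s[OF \<alpha>] s[OF \<gamma>] by (simp_all add: case_prod_unfold)
    show "open (?\<sigma> -` U)" by (rule o[OF U(1)])
    show "(x0, t0, y0) \<in> ?\<sigma> -` U" using U(2) by simp
    show "\<beta> t0 x0 \<noteq> 0" using nz False by simp
  qed (rule that)
  have d: "((\<lambda>q. f (?\<sigma> q)) has_derivative (\<lambda>v. D (?\<sigma> q) (?\<sigma> v))) (at q)"
    if "(f has_derivative D (?\<sigma> q)) (at (?\<sigma> q))" for f :: "real \<times> real \<times> real \<Rightarrow> real" and D q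
    by (rule has_derivative_compose[where f="?\<sigma>" and g=f, OF _ that])
       (auto intro!: derivative_eq_intros has_derivative_Pair)
  show ?thesis
  proof (rule that[of "?\<sigma> -` N" "\<lambda>t x. z x t" "\<lambda>t x y. \<zeta> x t y" "\<lambda>q v. P (?\<sigma> q) (?\<sigma> v)" "\<lambda>q v. Q (?\<sigma> q) (?\<sigma> v)"])
    show "smooth_on (?\<sigma> -` N) (\<lambda>(t, x, y). z x t)" "smooth_on (?\<sigma> -` N) (\<lambda>(t, x, y). \<zeta> x t y)"
      using s[OF *(4)] s[OF *(5)] by (simp_all add: case_prod_unfold)
    show "((\<lambda>(t, x, y). z x t) has_derivative (\<lambda>v. P (?\<sigma> q) (?\<sigma> v))) (at q)" if "q \<in> ?\<sigma> -` N" for q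
      using d[of "\<lambda>(t, x, y). z t x" P q] *(6) that by (simp add: case_prod_unfold)
    show "((\<lambda>(t, x, y). \<zeta> x t y) has_derivative (\<lambda>v. Q (?\<sigma> q) (?\<sigma> v))) (at q)" if "q \<in> ?\<sigma> -` N" for q
      using d[of "unc \<zeta>" Q q] *(7) that by (simp add: case_prod_unfold)
  qed (use * o in auto)
qed


section \<open>Invariants and reduction of order\<close>

lemma invariant_constant_on_level_sets:
  fixes f g K :: "real \<times> real \<times> real \<Rightarrow> real" and X :: "real \<times> real \<times> real \<Rightarrow> real \<times> real \<times> real"
  assumes U: "open U" "q0 \<in> U"
    and P: "\<And>q. q \<in> U \<Longrightarrow> (f has_derivative P q) (at q)" "\<And>v. continuous_on U (\<lambda>q. P q v)"
    and Q: "\<And>q. q \<in> U \<Longrightarrow> (g has_derivative Q q) (at q)" "\<And>v. continuous_on U (\<lambda>q. Q q v)"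
    and R: "\<And>q. q \<in> U \<Longrightarrow> (K has_derivative R q) (at q)" "\<And>q. q \<in> U \<Longrightarrow> R q (X q) = 0"
    and ker: "\<And>q v. q \<in> U \<Longrightarrow> P q v = 0 \<Longrightarrow> Q q v = 0 \<Longrightarrow> \<exists>c. v = c *\<^sub>R X q"
    and X0: "X q0 \<noteq> 0"
  obtains W where "open W" "q0 \<in> W" "W \<subseteq> U"
    "\<And>q1 q2. q1 \<in> W \<Longrightarrow> q2 \<in> W \<Longrightarrow> f q1 = f q2 \<Longrightarrow> g q1 = g q2 \<Longrightarrow> K q1 = K q2"
proof -
  \<comment> \<open>In the local coordinates \<open>\<Psi>\<close>, the level sets of \<open>(f, g)\<close> are segments tangent to \<open>X\<close>.\<close>
  define \<Psi> where "\<Psi> q = (X q0 \<bullet> q, f q, g q)" for q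
  have d\<Psi>: "(\<Psi> has_derivative (\<lambda>v. (X q0 \<bullet> v, P q v, Q q v))) (at q)" if "q \<in> U" for q
    unfolding \<Psi>_def by (intro has_derivative_Pair P(1) Q(1) that) (auto intro!: derivative_eq_intros)
  obtain W0 V k k' where *: "open W0" "W0 \<subseteq> U" "q0 \<in> W0" "open V" "homeomorphism W0 V \<Psi> k"
    "\<And>y. y \<in> V \<Longrightarrow> (k has_derivative k' y) (at y)"
    "\<And>y v. y \<in> V \<Longrightarrow> (\<lambda>v. (X q0 \<bullet> v, P (k y) v, Q (k y) v)) (k' y v) = v"
  proof (rule local_inverse[OF U d\<Psi>])
    fix v
    show "continuous_on U (\<lambda>q. (X q0 \<bullet> v, P q v, Q q v))" by (intro continuous_intros P(2) Q(2))
    \<comment> \<open>The first component of \<open>\<Psi>\<close> completes (f, g) to a chart: the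
      common kernel of their differentials is contained in the line through \<open>X q0\<close>, and
      there the inner product with \<open>X q0\<close> vanishes only at 0.\<close>
    assume 0: "(X q0 \<bullet> v, P q0 v, Q q0 v) = 0"
    then obtain c where c: "v = c *\<^sub>R X q0" using ker[OF U(2), of v] by (auto simp: zero_prod_def)
    with 0 have "c * (X q0 \<bullet> X q0) = 0" by (auto simp: zero_prod_def)
    then show "v = 0" using X0 c by simp
  qed (assumption, rule that)
  have k: "k (\<Psi> q) = q" "\<Psi> q \<in> V" if "q \<in> W0" for q
    using *(5) that by (auto simp: homeomorphism_def)
  obtain A E where AE: "open A" "open E" "\<Psi> q0 \<in> A \<times> E" "A \<times> E \<subseteq> V"
    using open_prod_elim[OF *(4) k(2)[OF *(3)]] by blast
  \<comment> \<open>An interval as first factor makes each level set of (f, g) in the box connected,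
    so that a vanishing derivative along it forces a constant value.\<close>
  obtain r where r: "r > 0" "ball (fst (\<Psi> q0)) r \<subseteq> A" using AE by (metis mem_Times_iff openE)
  define B where "B = ball (fst (\<Psi> q0)) r"
  have BE: "B \<times> E \<subseteq> V" "open (B \<times> E)" "convex B" "open B" using AE r by (auto simp: B_def intro: open_Times)
  have c\<Psi>: "continuous_on W0 \<Psi>" using *(5) by (simp add: homeomorphism_def)
  define W where "W = {q \<in> W0. \<Psi> q \<in> B \<times> E}"
  show ?thesis
  proof (rule that[of W])
    show "open W" unfolding W_def by (rule open_preimage_on[OF *(1) c\<Psi> BE(2)])
    show "q0 \<in> W" using * AE r by (auto simp: W_def B_def mem_Times_iff)
    show "W \<subseteq> U" using * by (auto simp: W_def)
    fix q1 q2 assume q: "q1 \<in> W" "q2 \<in> W" and eq: "f q1 = f q2" "g q1 = g q2"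
    define e where "e = (f q1, g q1)"
    have eE: "e \<in> E" using q by (auto simp: W_def \<Psi>_def e_def)
    have d: "((\<lambda>s. K (k (s, e))) has_derivative (\<lambda>h. 0)) (at s within B)" if s: "s \<in> B" for s
    proof -
      have y: "(s, e) \<in> V" using BE s eE by blast
      have kU: "k (s, e) \<in> U" using *(2,5) y by (auto simp: homeomorphism_def)
      have "((\<lambda>s. k (s, e)) has_derivative (\<lambda>h. k' (s, e) (h, 0))) (at s)"
        by (rule has_derivative_compose[where g=k and f="\<lambda>s. (s, e)", OF _ *(6)[OF y]])
           (auto intro!: derivative_eq_intros)
      from has_derivative_compose[OF this R(1)[OF kU]]
      have "((\<lambda>s. K (k (s, e))) has_derivative (\<lambda>h. R (k (s, e)) (k' (s, e) (h, 0)))) (at s)" .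
      moreover have "R (k (s, e)) (k' (s, e) (h, 0)) = 0" for h
      proof -
        have "P (k (s, e)) (k' (s, e) (h, 0)) = 0" "Q (k (s, e)) (k' (s, e) (h, 0)) = 0"
          using *(7)[OF y, of "(h, 0)"] by (auto simp: prod_eq_iff)
        then obtain c where "k' (s, e) (h, 0) = c *\<^sub>R X (k (s, e))" using ker[OF kU] by blast
        then show ?thesis
          using R(2)[OF kU] linear_cmul[OF has_derivative_linear[OF R(1)[OF kU]]] by simp
      qed
      ultimately show ?thesis by (simp add: has_derivative_at_withinI)
    qed
    obtain c where c: "\<And>s. s \<in> B \<Longrightarrow> K (k (s, e)) = c"
      using has_derivative_zero_constant[OF BE(3) d] by blast
    have "\<Psi> q1 = (X q0 \<bullet> q1, e)" "\<Psi> q2 = (X q0 \<bullet> q2, e)" using eq by (auto simp: \<Psi>_def e_def)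
    then show "K q1 = K q2"
      using q k(1)[of q1] k(1)[of q2] c[of "X q0 \<bullet> q1"] c[of "X q0 \<bullet> q2"] by (auto simp: W_def)
  qed
qed

section \<open>Calculus of partial derivatives and first-order operators\<close>

context
  fixes U :: "(real \<times> real \<times> real) set"
  assumes U: "open U"
begin

lemma smooth3_const: "smooth3 U (\<lambda>t x y. c)"
  and smooth3_snd: "smooth3 U (\<lambda>t x y. y)"
  unfolding smooth3_iff_smooth_on[OF U] case_prod_unfold
  by (intro smooth_onI Ck_const Ck_snd Ck_ident)+

lemma smooth3_add: "smooth3 U f \<Longrightarrow> smooth3 U g \<Longrightarrow> smooth3 U (\<lambda>t x y. f t x y + g t x y)"
  and smooth3_diff: "smooth3 U f \<Longrightarrow> smooth3 U g \<Longrightarrow> smooth3 U (\<lambda>t x y. f t x y - g t x y)"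
  and smooth3_mult: "smooth3 U f \<Longrightarrow> smooth3 U g \<Longrightarrow> smooth3 U (\<lambda>t x y. f t x y * g t x y)"
  unfolding smooth3_iff_smooth_on[OF U] case_prod_unfold smooth_on_def
  by (auto intro!: Ck_add Ck_diff Ck_mult)

lemma smooth3_partial_differentiable:
  assumes "smooth3 U f" "(t, x, y) \<in> U"
  shows "(\<lambda>s. f s x y) field_differentiable at t" "(\<lambda>s. f t s y) field_differentiable at x"
    "(\<lambda>s. f t x s) field_differentiable at y"
  using has_derivative_partials[OF smooth3_has_derivative[OF assms(1) U assms(2)]]
  by (auto simp: field_differentiable_def)

lemma pd3_add:
  assumes "smooth3 U f" "smooth3 U g" "(t, x, y) \<in> U"
  shows "pd3 c (\<lambda>t x y. f t x y + g t x y) t x y = pd3 c f t x y + pd3 c g t x y"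
  using smooth3_partial_differentiable[OF assms(1,3)] smooth3_partial_differentiable[OF assms(2,3)]
  by (cases c) (simp_all add: pd3_def)

lemma pd3_mult:
  assumes "smooth3 U f" "smooth3 U g" "(t, x, y) \<in> U"
  shows "pd3 c (\<lambda>t x y. f t x y * g t x y) t x y = f t x y * pd3 c g t x y + pd3 c f t x y * g t x y"
  using smooth3_partial_differentiable[OF assms(1,3)] smooth3_partial_differentiable[OF assms(2,3)]
  by (cases c) (simp_all add: pd3_def)

end

lemma pd3_snd: "pd3 c (\<lambda>t x y. y) = (\<lambda>t x y. if c = CX1 then 1 else 0)"
  by (cases c) (auto simp: pd3_def)

lemma pd3_CX1_fibre_const [simp]: "pd3 CX1 (\<lambda>t x y. f t x) = (\<lambda>t x y. 0)"
  by (simp add: pd3_def)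

lemma pd3_eq_0:
  assumes "open U" "(t, x, y) \<in> U" "\<And>t x y. (t, x, y) \<in> U \<Longrightarrow> f t x y = 0"
  shows "pd3 c f t x y = 0"
proof -
  have "((\<lambda>q. 0) has_derivative (\<lambda>v. 0)) (at (t, x, y))" by simp
  then have "(unc f has_derivative (\<lambda>v. 0)) (at (t, x, y))"
    by (rule has_derivative_transform_within_open[OF _ assms(1,2)]) (use assms(3) in auto)
  from pd3_eq_derivative[OF this] show ?thesis by (cases c) auto
qed

definition vder :: "(real \<Rightarrow> real \<Rightarrow> real \<Rightarrow> real) \<Rightarrow> (real \<Rightarrow> real \<Rightarrow> real \<Rightarrow> real) \<Rightarrow> (real \<Rightarrow> real \<Rightarrow> real \<Rightarrow> real)
    \<Rightarrow> (real \<Rightarrow> real \<Rightarrow> real \<Rightarrow> real) \<Rightarrow> real \<Rightarrow> real \<Rightarrow> real \<Rightarrow> real" where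
  "vder a b c f t x y = a t x y * pd3 CT f t x y + b t x y * pd3 CX f t x y + c t x y * pd3 CX1 f t x y"

lemma smooth3_vder:
  assumes "open U" "smooth3 U a" "smooth3 U b" "smooth3 U c" "smooth3 U f"
  shows "smooth3 U (vder a b c f)"
  unfolding vder_def by (intro smooth3_add smooth3_mult smooth3_pd3 assms)

text \<open>Second derivatives of \<open>f\<close> are arranged with \<open>d\<close> innermost, so
  that differentiating an operator applied to \<open>f\<close> can be compared termwise with the
  operator applied to a derivative of \<open>f\<close>.\<close>

lemma pd3_vder:
  assumes U: "open U" "(t, x, y) \<in> U" and s: "smooth3 U a" "smooth3 U b" "smooth3 U c" "smooth3 U f"
  shows "pd3 d (vder a b c f) t x y =
    a t x y * pd3 CT (pd3 d f) t x y + pd3 d a t x y * pd3 CT f t x y +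
    (b t x y * pd3 CX (pd3 d f) t x y + pd3 d b t x y * pd3 CX f t x y) +
    (c t x y * pd3 CX1 (pd3 d f) t x y + pd3 d c t x y * pd3 CX1 f t x y)"
proof -
  note s' = s smooth3_pd3[OF s(4)] smooth3_mult[OF U(1)] smooth3_add[OF U(1)]
  show ?thesis
    unfolding vder_def
    by (simp add: pd3_add[OF U(1) _ _ U(2)] pd3_mult[OF U(1) _ _ U(2)] s' pd3_commute[OF s(4) U, of d])
qed

abbreviation Aop :: "(real \<Rightarrow> real \<Rightarrow> real \<Rightarrow> real) \<Rightarrow> (real \<Rightarrow> real \<Rightarrow> real \<Rightarrow> real) \<Rightarrow> real \<Rightarrow> real \<Rightarrow> real \<Rightarrow> real" where
  "Aop F \<equiv> vder (\<lambda>t x y. 1) (\<lambda>t x y. y) F"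

text \<open>This is the identity \<open>[X, A] = \<lambda> X + \<mu> A\<close> with \<open>\<mu> = - (A \<rho> + \<lambda> \<rho>)\<close>, evaluated on an invariant of \<open>X\<close>; here
  \<open>X\<close> is the first \<open>\<lambda>\<close>-prolongation and \<open>A\<close> the vector field of the equation.\<close>

lemma vder_Aop_of_invariant:
  fixes rho phi0 :: "real \<Rightarrow> real \<Rightarrow> real" and F lam phi1 f :: "real \<Rightarrow> real \<Rightarrow> real \<Rightarrow> real"
  defines "\<rho> \<equiv> \<lambda>t x y. rho t x" and "\<phi> \<equiv> \<lambda>t x y. phi0 t x"
  assumes U: "open U" "(t, x, y) \<in> U"
    and s: "smooth3 U F" "smooth3 U \<rho>" "smooth3 U \<phi>" "smooth3 U phi1" "smooth3 U f"
    and phi1: "phi1 t x y = Aop F \<phi> t x y - Aop F \<rho> t x y * y + lam t x y * (\<phi> t x y - \<rho> t x y * y)"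
    and sym: "vder \<rho> \<phi> phi1 F t x y =
        Aop F phi1 t x y - Aop F \<rho> t x y * F t x y + lam t x y * (phi1 t x y - \<rho> t x y * F t x y)"
    and inv: "\<And>t x y. (t, x, y) \<in> U \<Longrightarrow> vder \<rho> \<phi> phi1 f t x y = 0"
  shows "vder \<rho> \<phi> phi1 (Aop F f) t x y = - (Aop F \<rho> t x y + lam t x y * \<rho> t x y) * Aop F f t x y"
proof -
  have y0: "pd3 CX1 \<rho> = (\<lambda>t x y. 0)" "pd3 CX1 \<phi> = (\<lambda>t x y. 0)" by (simp_all add: \<rho>_def \<phi>_def)
  have one: "pd3 d (\<lambda>t x y. 1) = (\<lambda>t x y. 0)" for d by (cases d) (auto simp: pd3_def)
  note dA = pd3_vder[OF U smooth3_const[OF U(1)] smooth3_snd[OF U(1)] s(1,5)]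
  note dX = pd3_vder[OF U s(2,3,4,5)]
  have Z: "pd3 d (vder \<rho> \<phi> phi1 f) t x y = 0" for d
    by (rule pd3_eq_0[OF U inv])
  note com = pd3_commute[OF s(5) U, of CX CT] pd3_commute[OF s(5) U, of CX1 CT] pd3_commute[OF s(5) U, of CX1 CX]
  \<comment> \<open>The summands are A applied to X f, the x_1- and x-components of the bracket
    identity weighted by the derivatives of \<open>f\<close>, and \<lambda> X f. Each of them
    vanishes.\<close>
  have "vder \<rho> \<phi> phi1 (Aop F f) t x y + (Aop F \<rho> t x y + lam t x y * \<rho> t x y) * Aop F f t x y =
     (pd3 CT (vder \<rho> \<phi> phi1 f) t x y + y * pd3 CX (vder \<rho> \<phi> phi1 f) t x y + F t x y * pd3 CX1 (vder \<rho> \<phi> phi1 f) t x y)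
     + pd3 CX1 f t x y * (vder \<rho> \<phi> phi1 F t x y -
        (Aop F phi1 t x y - Aop F \<rho> t x y * F t x y + lam t x y * (phi1 t x y - \<rho> t x y * F t x y)))
     + pd3 CX f t x y * (phi1 t x y - (Aop F \<phi> t x y - Aop F \<rho> t x y * y + lam t x y * (\<phi> t x y - \<rho> t x y * y)))
     + lam t x y * vder \<rho> \<phi> phi1 f t x y"
    unfolding vder_def[of \<rho> \<phi> phi1 "Aop F f"] dA dX com one pd3_snd y0
    by (simp add: vder_def y0 algebra_simps)
  also have "\<dots> = 0" using Z inv[OF U(2)] phi1 sym by simp
  finally show ?thesis by (simp only: mult_minus_left eq_neg_iff_add_eq_0)
qed


section \<open>Functions of (t, x, x_1) on jet space and reduction of order\<close>

lemma jet_simps [simp]: "jt (t, u, w) = t" "jx (t, u, w) = u" "jw (t, u, w) = w"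
  by (simp_all add: jt_def jx_def jw_def)

lemma pdt_lift [simp]: "pdt (lift f) p = lift (pd3 CT f) p"
  by (simp add: pdt_def lift_def pd3_def)

lemma pdx_lift [simp]:
  "pdx 0 (lift f) p = lift (pd3 CX f) p" "pdx (Suc 0) (lift f) p = lift (pd3 CX1 f) p"
  "2 \<le> i \<Longrightarrow> pdx i (lift f) p = 0"
  by (simp_all add: pdx_def lift_def pd3_def)

lemma pdw_lift [simp]: "pdw i (lift f) p = 0"
  by (simp add: pdw_def lift_def)

text \<open>A function of (t, x, x_1) has no derivative along x_i with i \<ge> 2, so the series has
  only two nonzero terms.\<close>

lemma Dt_lift: "Dt (lift f) p = lift (pd3 CT f) p + jx p 1 * lift (pd3 CX f) p + jx p 2 * lift (pd3 CX1 f) p"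
proof -
  have "(\<Sum>i. jx p (Suc i) * pdx i (lift f) p) = (\<Sum>i\<in>{..<2}. jx p (Suc i) * pdx i (lift f) p)"
    by (rule suminf_finite) auto
  then show ?thesis by (simp add: Dt_def numeral_2_eq_2)
qed

lemma lift_fibre: "lift (\<lambda>t x y. f t x) p = f (jt p) (jx p 0)"
  by (simp add: lift_def)

lemma ode_form_of_invariants:
  fixes rho phi0 z :: "real \<Rightarrow> real \<Rightarrow> real" and F lam phi1 \<zeta> :: "real \<Rightarrow> real \<Rightarrow> real \<Rightarrow> real"
  defines "\<rho> \<equiv> \<lambda>t x y. rho t x" and "\<phi> \<equiv> \<lambda>t x y. phi0 t x" and "Z \<equiv> \<lambda>t x y. z t x"
  assumes U: "open U" "q0 \<in> U"
    and s: "smooth3 U F" "smooth3 U \<rho>" "smooth3 U \<phi>" "smooth3 U phi1" "smooth3 U Z" "smooth3 U \<zeta>"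
    and phi1: "\<And>t x y. (t, x, y) \<in> U \<Longrightarrow>
        phi1 t x y = Aop F \<phi> t x y - Aop F \<rho> t x y * y + lam t x y * (\<phi> t x y - \<rho> t x y * y)"
    and sym: "\<And>t x y. (t, x, y) \<in> U \<Longrightarrow> vder \<rho> \<phi> phi1 F t x y =
        Aop F phi1 t x y - Aop F \<rho> t x y * F t x y + lam t x y * (phi1 t x y - \<rho> t x y * F t x y)"
    and inv: "\<And>t x y. (t, x, y) \<in> U \<Longrightarrow> vder \<rho> \<phi> phi1 Z t x y = 0"
       "\<And>t x y. (t, x, y) \<in> U \<Longrightarrow> vder \<rho> \<phi> phi1 \<zeta> t x y = 0"
    and \<zeta>y: "\<And>t x y. (t, x, y) \<in> U \<Longrightarrow> pd3 CX1 \<zeta> t x y \<noteq> 0"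
    and A0: "unc (Aop F Z) q0 \<noteq> 0" and X0: "unc \<rho> q0 \<noteq> 0 \<or> unc \<phi> q0 \<noteq> 0"
  obtains W where "open W" "q0 \<in> W" "W \<subseteq> U" "ode_form W F (lift Z) (lift \<zeta>)"
proof -
  have sA: "smooth3 U (Aop F f)" if "smooth3 U f" for f
    by (rule smooth3_vder[OF U(1) smooth3_const[OF U(1)] smooth3_snd[OF U(1)] s(1) that])
  have c: "continuous_on U (unc f)" if "smooth3 U f" for f
    using that smooth3_iff_smooth_on[OF U(1)] smooth_on_continuous by blast
  \<comment> \<open>The smaller set keeps the denominator A z and the base components of X away from
    zero; the sum of squares turns the latter into one open condition.\<close>
  let ?n = "\<lambda>q. (unc (Aop F Z) q, (unc \<rho> q)\<^sup>2 + (unc \<phi> q)\<^sup>2)"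
  define V where "V = {q \<in> U. ?n q \<in> (-{0}) \<times> (-{0})}"
  have V: "open V" "q0 \<in> V" "V \<subseteq> U"
  proof -
    have "continuous_on U ?n" by (intro continuous_intros c sA s)
    moreover have "open ((-{0::real}) \<times> (-{0::real}))" by (intro open_Times) auto
    ultimately show "open V" unfolding V_def by (intro open_preimage_on[OF U(1)])
    show "q0 \<in> V" using U A0 X0 by (auto simp: V_def sum_power2_eq_zero_iff)
    show "V \<subseteq> U" by (auto simp: V_def)
  qed
  define X where "X q = (unc \<rho> q, unc \<phi> q, unc phi1 q)" for q
  have gX: "grad3 f q (X q) = unc (vder \<rho> \<phi> phi1 f) q" for f q
    by (simp add: grad3_def X_def vder_def case_prod_unfold)
  define K where "K q = unc (Aop F \<zeta>) q / unc (Aop F Z) q" for q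
  define R where "R q v = (grad3 (Aop F \<zeta>) q v * unc (Aop F Z) q - unc (Aop F \<zeta>) q * grad3 (Aop F Z) q v)
      / (unc (Aop F Z) q * unc (Aop F Z) q)" for q v
  have nz: "unc (Aop F Z) q \<noteq> 0" if "q \<in> V" for q using that by (auto simp: V_def)
  have dR: "(K has_derivative R q) (at q)" if q: "q \<in> V" for q
    unfolding K_def R_def
    by (rule has_derivative_divide'[OF smooth3_has_derivative[OF sA[OF s(6)] U(1)]
          smooth3_has_derivative[OF sA[OF s(5)] U(1)] nz[OF q]]) (use q V(3) in blast)+
  \<comment> \<open>X multiplies A \<zeta> and A z by the same factor, which cancels in the quotient
    rule.\<close>
  have R0: "R q (X q) = 0" if q: "q \<in> V" for q
  proof -
    obtain t x y where txy: "q = (t, x, y)" by (metis prod.exhaust)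
    then have qU: "(t, x, y) \<in> U" using q V by auto
    have "vder \<rho> \<phi> phi1 (Aop F f) t x y = - (Aop F \<rho> t x y + lam t x y * \<rho> t x y) * Aop F f t x y"
      if "smooth3 U f" "\<And>t x y. (t, x, y) \<in> U \<Longrightarrow> vder \<rho> \<phi> phi1 f t x y = 0" for f
      using s(2,3) phi1[OF qU] sym[OF qU] that(2) unfolding \<rho>_def \<phi>_def
      by (intro vder_Aop_of_invariant[OF U(1) qU s(1) _ _ s(4) that(1)])
    from this[OF s(5) inv(1)] this[OF s(6) inv(2)] show ?thesis
      unfolding R_def gX txy by simp
  qed
  have ker: "\<exists>k. v = k *\<^sub>R X q" if q: "q \<in> V" and v: "grad3 Z q v = 0" "grad3 \<zeta> q v = 0" for q v
  proof -
    obtain t x y where txy: "q = (t, x, y)" by (metis prod.exhaust)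
    obtain a b d where abd: "v = (a, b, d)" by (metis prod.exhaust)
    have qU: "(t, x, y) \<in> U" using q V txy by auto
    define zt zx r f where "zt = pd3 CT Z t x y" "zx = pd3 CX Z t x y" "r = \<rho> t x y" "f = \<phi> t x y"
    note d = this
    have zy: "pd3 CX1 Z t x y = 0" by (simp add: Z_def)
    have nz: "zt + y * zx \<noteq> 0" "r\<^sup>2 + f\<^sup>2 \<noteq> 0"
      using q by (auto simp: V_def txy vder_def zy d)
    have 1: "a * zt + b * zx = 0" using v(1) by (simp add: grad3_def txy abd zy d)
    have 2: "r * zt + f * zx = 0" using inv(1)[OF qU] by (simp add: vder_def zy d)
    \<comment> \<open>Both (a, b) and (r, f) are annihilated by (zt, zx), which is nonzero because
      zt + y zx is; in the plane this makes them parallel.\<close>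
    have "zt * (a * f - b * r) = 0" "zx * (a * f - b * r) = 0"
      using 1 2 by algebra+
    then have ab: "a * f = b * r" using nz(1) by auto
    \<comment> \<open>The multiple comes from projecting (a, b) orthogonally onto (r, f).\<close>
    define k where "k = (a * r + b * f) / (r\<^sup>2 + f\<^sup>2)"
    have "a * (r\<^sup>2 + f\<^sup>2) = (a * r + b * f) * r" "b * (r\<^sup>2 + f\<^sup>2) = (a * r + b * f) * f"
      using ab by algebra+
    then have k: "a = k * r" "b = k * f"
      using nz(2) by (simp_all add: k_def field_simps)
    \<comment> \<open>The differential of \<zeta> annihilates both \<open>v\<close> and
      \<open>X q\<close>; their first two components are already proportional, and \<zeta>_{x_1}
      \<noteq> 0 settles the third.\<close>
    have "pd3 CX1 \<zeta> t x y * (d - k * phi1 t x y) = 0"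
      using v(2) inv(2)[OF qU] unfolding grad3_def vder_def txy abd k d
      by (simp add: algebra_simps) algebra
    then have "d = k * phi1 t x y" using \<zeta>y[OF qU] by simp
    then show ?thesis using k by (intro exI[of _ k]) (simp add: X_def txy abd d)
  qed
  have cg: "continuous_on V (\<lambda>q. grad3 f q v)" if "smooth3 U f" for f v
    unfolding grad3_def
    by (rule continuous_on_subset[OF _ V(3)]) (intro continuous_intros c smooth3_pd3 that)
  have Xnz: "X q0 \<noteq> 0" using X0 by (auto simp: X_def zero_prod_def)
  have gr: "(unc f has_derivative grad3 f q) (at q)" if "smooth3 U f" "q \<in> V" for f q
    using smooth3_has_derivative[OF that(1) U(1)] that(2) V(3) by blast
  obtain W where W: "open W" "q0 \<in> W" "W \<subseteq> V"
    "\<And>q1 q2. q1 \<in> W \<Longrightarrow> q2 \<in> W \<Longrightarrow> unc Z q1 = unc Z q2 \<Longrightarrow> unc \<zeta> q1 = unc \<zeta> q2 \<Longrightarrow> K q1 = K q2"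
    by (rule invariant_constant_on_level_sets[OF V(1,2) gr[OF s(5)] cg[OF s(5)] gr[OF s(6)] cg[OF s(6)]
          dR R0 ker Xnz]) blast+
  have DZ: "Dt (lift Z) p = unc (Aop F Z) (base p)" for p
    by (simp add: Dt_lift lift_def vder_def base_def Z_def)
  \<comment> \<open>Off the equation, D_t \<zeta> differs from A \<zeta> by (x_2 - F) \<zeta>_{x_1};
    this is the term that detects x_2 = F.\<close>
  have D\<zeta>: "Dt (lift \<zeta>) p = unc (Aop F \<zeta>) (base p) + (jx p 2 - lift F p) * lift (pd3 CX1 \<zeta>) p" for p
    by (simp add: Dt_lift lift_def vder_def base_def algebra_simps)
  \<comment> \<open>Any point of \<open>W\<close> with the prescribed values may represent them,
    since \<open>K\<close> takes the same value at all such points.\<close>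
  define k where "k a b = K (SOME q. q \<in> W \<and> unc Z q = a \<and> unc \<zeta> q = b)" for a b
  have k: "k (unc Z q) (unc \<zeta> q) = K q" if q: "q \<in> W" for q
  proof -
    let ?q = "SOME q'. q' \<in> W \<and> unc Z q' = unc Z q \<and> unc \<zeta> q' = unc \<zeta> q"
    have "?q \<in> W \<and> unc Z ?q = unc Z q \<and> unc \<zeta> ?q = unc \<zeta> q"
      by (rule someI[of _ q]) (use q in simp)
    then show ?thesis unfolding k_def using W(4)[of ?q q] q by blast
  qed
  have "ode_form W F (lift Z) (lift \<zeta>)"
    unfolding ode_form_def
  proof (intro conjI exI[of _ "\<lambda>a b c. c - k a b"] allI impI)
    fix p assume p: "base p \<in> W"
    show nzp: "Dt (lift Z) p \<noteq> 0" using nz[of "base p"] p W(3) by (auto simp: DZ)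
    have "lift Z p = unc Z (base p)" "lift \<zeta> p = unc \<zeta> (base p)" by (simp_all add: lift_def base_def)
    then have "k (lift Z p) (lift \<zeta> p) = unc (Aop F \<zeta>) (base p) / Dt (lift Z) p"
      using k[OF p] by (simp add: K_def DZ)
    then have "Dt (lift \<zeta>) p / Dt (lift Z) p - k (lift Z p) (lift \<zeta> p) =
       (jx p 2 - lift F p) * lift (pd3 CX1 \<zeta>) p / Dt (lift Z) p"
      by (simp add: D\<zeta> add_divide_distrib)
    moreover have "lift (pd3 CX1 \<zeta>) p \<noteq> 0" using \<zeta>y p W(3) V(3) by (auto simp: lift_def base_def)
    ultimately show "(jx p 2 = lift F p) \<longleftrightarrow> (Dt (lift \<zeta>) p / Dt (lift Z) p - k (lift Z p) (lift \<zeta> p) = 0)"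
      using nzp by simp
  qed
  then show ?thesis using that W V(3) by blast
qed


section \<open>Prolongations\<close>

lemma continuous_on_base_coordinate:
  "continuous_on UNIV (\<lambda>s. base (s, u, w))" "continuous_on UNIV (\<lambda>s. base (t, u(i := s), w))"
proof -
  show "continuous_on UNIV (\<lambda>s. base (s, u, w))"
    unfolding base_def jet_simps by (intro continuous_intros)
  have "continuous_on UNIV (\<lambda>s. (u(i := s)) j)" for j
    by (cases "j = i") (simp_all add: continuous_on_id[unfolded id_def])
  then show "continuous_on UNIV (\<lambda>s. base (t, u(i := s), w))"
    unfolding base_def jet_simps by (intro continuous_intros)
qed

text \<open>Total differentiation sees a function only near the jet, and moving one jet coordinate
  moves the base point continuously. Formulas for prolongation coefficients that hold over
  \<open>U\<close> alone may therefore be differentiated once more.\<close>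

lemma TDt_cong:
  assumes U: "open U" "base p \<in> U" and eq: "\<And>q. base q \<in> U \<Longrightarrow> f q = g q"
  shows "TDt f p = TDt g p"
proof -
  obtain t u w where p: "p = (t, u, w)" by (metis prod.exhaust)
  have ev: "\<forall>\<^sub>F s in nhds s0. f (h s) = g (h s)"
    if "continuous_on UNIV (\<lambda>s. base (h s))" "base (h s0) \<in> U" for h :: "real \<Rightarrow> jet" and s0
  proof -
    have "open ((\<lambda>s. base (h s)) -` U)" by (rule open_vimage[OF U(1) that(1)])
    then have "\<forall>\<^sub>F s in nhds s0. s \<in> (\<lambda>s. base (h s)) -` U"
      using that(2) by (intro eventually_nhds_in_open) auto
    then show ?thesis by eventually_elim (auto intro: eq)
  qed
  have "pdt f p = pdt g p"
    unfolding pdt_def by (rule deriv_cong_ev[OF ev]) (use U p continuous_on_base_coordinate in auto)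
  moreover have "pdx i f p = pdx i g p" for i
    unfolding pdx_def by (rule deriv_cong_ev[OF ev]) (use U p continuous_on_base_coordinate in auto)
  moreover have "pdw i f p = pdw i g p" for i
    unfolding pdw_def by (rule deriv_cong_ev[OF ev]) (use U p in \<open>auto simp: base_def\<close>)
  ultimately show ?thesis by (simp add: TDt_def)
qed

lemma smooth3_partials:
  assumes "open U" "smooth3 U f" "(t, x, y) \<in> U"
  shows "((\<lambda>s. f s x y) has_real_derivative pd3 CT f t x y) (at t)"
    "((\<lambda>s. f t s y) has_real_derivative pd3 CX f t x y) (at x)"
    "((\<lambda>s. f t x s) has_real_derivative pd3 CX1 f t x y) (at y)"
  using smooth3_partial_differentiable[OF assms]
  by (auto simp: pd3_def DERIV_deriv_iff_field_differentiable)

lemma deriv_const_diff: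
  fixes f :: "real \<Rightarrow> real"
  assumes "(f has_real_derivative f') (at s)"
  shows "deriv (\<lambda>s. c - f s) s = - f'"
  using DERIV_imp_deriv[OF DERIV_diff[OF DERIV_const assms]] by simp

text \<open>The first prolongation coefficient is e^w times an expression affine in w_1.
  Differentiating e^w contributes the last product with w_1, which becomes the \<lambda>-term of the
  \<lambda>-prolongation once w_1 = \<lambda>.\<close>

lemma TDt_exp_affine:
  assumes U: "open U" "base p \<in> U" and s: "smooth3 U a" "smooth3 U b"
  shows "TDt (\<lambda>p. exp (jw p 0) * (lift a p + jw p 1 * lift b p)) p =
    exp (jw p 0) * (Dt (lift a) p + jw p 1 * Dt (lift b) p + jw p 2 * lift b p + jw p 1 * (lift a p + jw p 1 * lift b p))"
    (is "TDt ?f p = _")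
proof -
  have q: "(jt p, jx p 0, jx p 1) \<in> U" using U by (simp add: base_def)
  note d = smooth3_partials[OF U(1) s(1) q] smooth3_partials[OF U(1) s(2) q]
  have "pdt ?f p = exp (jw p 0) * (lift (pd3 CT a) p + jw p 1 * lift (pd3 CT b) p)"
    unfolding pdt_def lift_def jet_simps
    by (rule DERIV_imp_deriv) (rule derivative_eq_intros d refl | simp)+
  moreover have "pdx 0 ?f p = exp (jw p 0) * (lift (pd3 CX a) p + jw p 1 * lift (pd3 CX b) p)"
    unfolding pdx_def lift_def jet_simps fun_upd_same fun_upd_other[OF one_neq_zero]
    by (rule DERIV_imp_deriv) (rule derivative_eq_intros d refl | simp)+
  moreover have "pdx 1 ?f p = exp (jw p 0) * (lift (pd3 CX1 a) p + jw p 1 * lift (pd3 CX1 b) p)"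
    unfolding pdx_def lift_def jet_simps fun_upd_same fun_upd_other[OF zero_neq_one]
    by (rule DERIV_imp_deriv) (rule derivative_eq_intros d refl | simp)+
  moreover have "pdw 0 ?f p = exp (jw p 0) * (lift a p + jw p 1 * lift b p)"
    unfolding pdw_def lift_def jet_simps fun_upd_same fun_upd_other[OF one_neq_zero]
    by (rule DERIV_imp_deriv) (rule derivative_eq_intros refl | simp)+
  moreover have "pdw 1 ?f p = exp (jw p 0) * lift b p"
    unfolding pdw_def lift_def jet_simps fun_upd_same fun_upd_other[OF zero_neq_one]
    by (rule DERIV_imp_deriv) (rule derivative_eq_intros refl | simp)+
  moreover have "pdx i ?f p = 0" "pdw i ?f p = 0" if "2 \<le> i" for i
    using that by (simp_all add: pdx_def pdw_def lift_def)
  then have "(\<Sum>i. jx p (Suc i) * pdx i ?f p + jw p (Suc i) * pdw i ?f p) =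
     (\<Sum>i\<in>{..<2}. jx p (Suc i) * pdx i ?f p + jw p (Suc i) * pdw i ?f p)"
    by (intro suminf_finite) auto
  ultimately show ?thesis
    by (simp add: TDt_def Dt_lift numeral_2_eq_2 algebra_simps)
qed

lemma TDt_exp_lift:
  assumes U: "open U" "base p \<in> U" and s: "smooth3 U a"
  shows "TDt (\<lambda>p. exp (jw p 0) * lift a p) p = exp (jw p 0) * (Dt (lift a) p + jw p 1 * lift a p)"
  using TDt_exp_affine[OF U s smooth3_const[OF U(1), of 0]] by (simp add: lift_def[of "\<lambda>t x y. 0"] Dt_lift pd3_def[of _ "\<lambda>t x y. 0"] split: coord.splits)

section \<open>The prolonged field compared with the \<lambda>-prolongation\<close>

context
  fixes U :: "(real \<times> real \<times> real) set" and F lam \<psi> :: "real \<Rightarrow> real \<Rightarrow> real \<Rightarrow> real"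
    and rho phi0 :: "real \<Rightarrow> real \<Rightarrow> real"
  assumes U: "open U"
    and s: "smooth3 U F" "smooth3 U lam" "smooth3 U \<psi>"
      "smooth3 U (\<lambda>t x y. rho t x)" "smooth3 U (\<lambda>t x y. phi0 t x)"
begin

abbreviation (input) "rho3 \<equiv> \<lambda>t x y :: real. rho t x"
abbreviation (input) "phi3 \<equiv> \<lambda>t x y :: real. phi0 t x"

abbreviation (input) "vxi \<equiv> \<lambda>p. exp (jw p 0) * rho (jt p) (jx p 0)"
abbreviation (input) "veta \<equiv> \<lambda>p. exp (jw p 0) * phi0 (jt p) (jx p 0)"
abbreviation (input) "vpsi \<equiv> \<lambda>p. exp (jw p 0) * \<psi> (jt p) (jx p 0) (jx p 1)"

text \<open>On jets, \<open>\<eta>\<^sup>1 = e\<^sup>w (pa + w\<^sub>1 pb)\<close>; substituting \<open>w\<^sub>1 = \<lambda>\<close> gives the coefficient \<open>phi1\<close> of the \<open>\<lambda>\<close>-prolongation.\<close>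

definition pa :: "real \<Rightarrow> real \<Rightarrow> real \<Rightarrow> real" where
  "pa t x y = pd3 CT phi3 t x y + y * pd3 CX phi3 t x y - (pd3 CT rho3 t x y + y * pd3 CX rho3 t x y) * y"

definition pb :: "real \<Rightarrow> real \<Rightarrow> real \<Rightarrow> real" where
  "pb t x y = phi3 t x y - rho3 t x y * y"

definition phi1 :: "real \<Rightarrow> real \<Rightarrow> real \<Rightarrow> real" where
  "phi1 t x y = pa t x y + lam t x y * pb t x y"

lemma smooth3_phi1: "smooth3 U pa" "smooth3 U pb" "smooth3 U phi1"
proof -
  show a: "smooth3 U pa" unfolding pa_def
    by (intro smooth3_add[OF U] smooth3_mult[OF U] smooth3_diff[OF U] smooth3_pd3 s smooth3_snd[OF U])
  show b: "smooth3 U pb" unfolding pb_def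
    by (intro smooth3_mult[OF U] smooth3_diff[OF U] s smooth3_snd[OF U])
  show "smooth3 U phi1" unfolding phi1_def
    by (intro smooth3_add[OF U] smooth3_mult[OF U] s a b)
qed

lemma phiL_1: "phiL lam rho phi0 (Suc 0) = lift phi1"
  by (rule ext) (simp add: Dt_lift phi1_def pa_def pb_def lift_def algebra_simps)

lemma phiL_2: "phiL lam rho phi0 2 p = Dt (lift phi1) p - Dt (lift rho3) p * jx p 2 + lift lam p * (lift phi1 p - lift rho3 p * jx p 2)"
  by (simp only: numeral_2_eq_2 phiL.simps(2)[of lam rho phi0 "Suc 0"] phiL_1)

lemma Dt_phi1:
  assumes "base p \<in> U"
  shows "Dt (lift phi1) p = Dt (lift pa) p + lift lam p * Dt (lift pb) p + lift pb p * Dt (lift lam) p"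
proof -
  have q: "(jt p, jx p 0, jx p 1) \<in> U" using assms by (simp add: base_def)
  have "lift (pd3 c phi1) p = lift (pd3 c pa) p + (lift lam p * lift (pd3 c pb) p + lift (pd3 c lam) p * lift pb p)" for c
    unfolding phi1_def[abs_def] lift_def
    by (subst pd3_add[OF U _ _ q], rule smooth3_phi1, rule smooth3_mult[OF U s(2) smooth3_phi1(2)],
        subst pd3_mult[OF U s(2) smooth3_phi1(2) q], rule refl)
  then show ?thesis by (simp add: Dt_lift algebra_simps)
qed

lemma eta_1:
  assumes "base p \<in> U"
  shows "eta vxi veta (Suc 0) p = exp (jw p 0) * (lift pa p + jw p 1 * lift pb p)"
  using TDt_exp_lift[OF U assms s(4)] TDt_exp_lift[OF U assms s(5)]
  by (simp add: lift_fibre Dt_lift) (simp add: lift_def pa_def pb_def algebra_simps)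

lemma eta_2:
  assumes "base p \<in> U"
  shows "eta vxi veta 2 p = exp (jw p 0) * (Dt (lift pa) p + jw p 1 * Dt (lift pb) p + jw p 2 * lift pb p
      + jw p 1 * (lift pa p + jw p 1 * lift pb p) - (Dt (lift rho3) p + jw p 1 * lift rho3 p) * jx p 2)"
proof -
  have "eta vxi veta 2 p = TDt (eta vxi veta (Suc 0)) p - TDt vxi p * jx p 2"
    by (simp add: numeral_2_eq_2)
  also have "TDt (eta vxi veta (Suc 0)) p = TDt (\<lambda>p. exp (jw p 0) * (lift pa p + jw p 1 * lift pb p)) p"
    by (rule TDt_cong[OF U assms eta_1])
  also have "\<dots> = exp (jw p 0) * (Dt (lift pa) p + jw p 1 * Dt (lift pb) p + jw p 2 * lift pb p
      + jw p 1 * (lift pa p + jw p 1 * lift pb p))"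
    by (rule TDt_exp_affine[OF U assms smooth3_phi1(1,2)])
  also have "TDt vxi p = exp (jw p 0) * (Dt (lift rho3) p + jw p 1 * lift rho3 p)"
    using TDt_exp_lift[OF U assms s(4)] by (simp add: lift_fibre)
  finally show ?thesis by (simp add: algebra_simps)
qed

lemma eta_eq_phiL_1:
  assumes "base p \<in> U" "jw p 1 = lift lam p" "i \<le> 1"
  shows "eta vxi veta i p = exp (jw p 0) * phiL lam rho phi0 i p"
proof (cases i)
  case 0 then show ?thesis by (simp add: lift_fibre)
next
  case (Suc j)
  then have "i = Suc 0" using assms by simp
  then show ?thesis using eta_1[OF assms(1)] assms(2) by (simp only: phiL_1) (simp add: lift_def phi1_def)
qed

text \<open>In second order the term w_2 \<open>pb\<close> must match the part of D_t
  \<open>phi1\<close> in which \<lambda> is differentiated; the condition w_2 = D_t \<lambda>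
  contained in \<open>inDelta\<close> does exactly this.\<close>

lemma eta_eq_phiL_2:
  assumes "base p \<in> U" "inDelta F lam p" "i \<le> 2"
  shows "eta vxi veta i p = exp (jw p 0) * phiL lam rho phi0 i p"
proof (cases "i \<le> 1")
  case True then show ?thesis using eta_eq_phiL_1 assms by (simp add: inDelta_def)
next
  case False
  then have i: "i = 2" using assms by simp
  have "lift phi1 p = lift pa p + lift lam p * lift pb p" by (simp add: lift_def phi1_def)
  then show ?thesis
    using assms(2) unfolding i eta_2[OF assms(1)] phiL_2 Dt_phi1[OF assms(1)] inDelta_def
    by (simp add: algebra_simps)
qed

text \<open>When \<open>G\<close> has no derivatives along the w-coordinates, the \<psi>-part drops
  out and the common factor e^w can be pulled out.\<close>

lemma prol_eq_XL:
  assumes "\<And>i. i \<le> k \<Longrightarrow> eta vxi veta i p = exp (jw p 0) * phiL lam rho phi0 i p"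
    and "\<And>i. i \<le> k \<Longrightarrow> pdw i G p = 0"
  shows "prol k vxi veta vpsi G p = exp (jw p 0) * XL k lam rho phi0 G p"
  using assms by (simp add: prol_def XL_def distrib_left sum_distrib_left mult_ac)

lemma XL_1_lift: "XL 1 lam rho phi0 (lift f) p = lift (vder rho3 phi3 phi1 f) p"
proof -
  have "{..1} = {0, Suc 0}" by auto
  then show ?thesis
    by (simp add: XL_def phiL_1 del: phiL.simps(2)) (simp add: lift_def vder_def)
qed

lemma XL_0_lift: "XL 0 lam rho phi0 (lift (\<lambda>t x y. z t x)) p = lift (vder rho3 phi3 phi1 (\<lambda>t x y. z t x)) p"
  by (simp add: XL_def lift_fibre) (simp add: lift_def vder_def)

lemma XL_2_equation:
  assumes "base p \<in> U"
  shows "XL 2 lam rho phi0 (\<lambda>q. jx q 2 - lift F q) p = phiL lam rho phi0 2 p - lift (vder rho3 phi3 phi1 F) p"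
proof -
  have q: "(jt p, jx p 0, jx p 1) \<in> U" using assms by (simp add: base_def)
  note d = smooth3_partials[OF U s(1) q]
  let ?G = "\<lambda>q. jx q 2 - lift F q"
  have "pdt ?G p = - lift (pd3 CT F) p"
    by (simp add: pdt_def lift_def deriv_const_diff[OF d(1)[unfolded One_nat_def]])
  moreover have "pdx 0 ?G p = - lift (pd3 CX F) p"
    by (simp add: pdx_def lift_def deriv_const_diff[OF d(2)[unfolded One_nat_def]])
  moreover have "pdx (Suc 0) ?G p = - lift (pd3 CX1 F) p"
    by (simp add: pdx_def lift_def deriv_const_diff[OF d(3)[unfolded One_nat_def]])
  moreover have "pdx 2 ?G p = 1"
    unfolding pdx_def lift_def jet_simps
    by (rule DERIV_imp_deriv) (simp, (rule derivative_eq_intros refl | simp)+)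
  moreover have "{..2} = {0, Suc 0, 2::nat}" by auto
  ultimately show ?thesis
    by (simp add: XL_def phiL_1 del: phiL.simps(2)) (simp add: lift_def vder_def)
qed

lemma pd_w1_equation:
  assumes "base p \<in> U"
  shows "pdt (\<lambda>q. jw q 1 - lift lam q) p = - lift (pd3 CT lam) p"
    "pdx 0 (\<lambda>q. jw q 1 - lift lam q) p = - lift (pd3 CX lam) p"
    "pdx (Suc 0) (\<lambda>q. jw q 1 - lift lam q) p = - lift (pd3 CX1 lam) p"
    "pdx 2 (\<lambda>q. jw q 1 - lift lam q) p = 0"
    "pdw 0 (\<lambda>q. jw q 1 - lift lam q) p = 0"
    "pdw (Suc 0) (\<lambda>q. jw q 1 - lift lam q) p = 1"
    "pdw 2 (\<lambda>q. jw q 1 - lift lam q) p = 0"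
proof -
  have q: "(jt p, jx p 0, jx p 1) \<in> U" using assms by (simp add: base_def)
  note d = smooth3_partials[OF U s(2) q]
  show "pdt (\<lambda>q. jw q 1 - lift lam q) p = - lift (pd3 CT lam) p"
    by (simp add: pdt_def lift_def deriv_const_diff[OF d(1)[unfolded One_nat_def]])
  show "pdx 0 (\<lambda>q. jw q 1 - lift lam q) p = - lift (pd3 CX lam) p"
    by (simp add: pdx_def lift_def deriv_const_diff[OF d(2)[unfolded One_nat_def]])
  show "pdx (Suc 0) (\<lambda>q. jw q 1 - lift lam q) p = - lift (pd3 CX1 lam) p"
    by (simp add: pdx_def lift_def deriv_const_diff[OF d(3)[unfolded One_nat_def]])
  show "pdw (Suc 0) (\<lambda>q. jw q 1 - lift lam q) p = 1"
    unfolding pdw_def lift_def jet_simps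
    by (rule DERIV_imp_deriv) (simp, (rule derivative_eq_intros refl | simp)+)
qed (simp_all add: pdx_def pdw_def lift_def)

section \<open>The determining equations and the local reduction\<close>

lemma gen_symmetryI:
  assumes ls: "lambda_symmetry U F lam rho phi0"
    and pde: "\<forall>p. base p \<in> U \<longrightarrow>
           pdt (lift \<psi>) p + pdx 0 (lift \<psi>) p * jx p 1 + pdx 1 (lift \<psi>) p * lift F p
             + lift \<psi> p * lift lam p
           = Dt (lift rho3) p * lift lam p + lift rho3 p * (lift lam p)\<^sup>2 + XL 1 lam rho phi0 (lift lam) p"
  shows "gen_symmetry U F lam vxi veta vpsi"
  unfolding gen_symmetry_def
proof (intro allI impI conjI; elim conjE)
  fix p assume p: "base p \<in> U" and \<Delta>: "inDelta F lam p"
  have \<Delta>': "jx p 2 = lift F p" "jw p 1 = lift lam p" using \<Delta> by (simp_all add: inDelta_def)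
  have "prol 2 vxi veta vpsi (\<lambda>q. jx q 2 - lift F q) p = exp (jw p 0) * XL 2 lam rho phi0 (\<lambda>q. jx q 2 - lift F q) p"
    by (rule prol_eq_XL[OF eta_eq_phiL_2[OF p \<Delta>]]) (simp_all add: pdw_def lift_def)
  then show "prol 2 vxi veta vpsi (\<lambda>q. jx q 2 - lift F q) p = 0"
    using ls[unfolded lambda_symmetry_def, rule_format, of p] p \<Delta>' by simp
  have "psiP vxi vpsi (Suc 0) p = exp (jw p 0) * (Dt (lift \<psi>) p + jw p 1 * lift \<psi> p - (Dt (lift rho3) p + jw p 1 * lift rho3 p) * jw p 1)"
    using TDt_exp_lift[OF U p s(4)] TDt_exp_lift[OF U p s(3)]
    by (simp add: lift_fibre) (simp add: lift_def algebra_simps)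
  \<comment> \<open>This is the PDE for \<psi>, with x_2 = F and w_1 = \<lambda>
    substituted.\<close>
  also have "Dt (lift \<psi>) p + jw p 1 * lift \<psi> p - (Dt (lift rho3) p + jw p 1 * lift rho3 p) * jw p 1
     = XL 1 lam rho phi0 (lift lam) p"
    using pde[rule_format, OF p] \<Delta>' by (simp add: Dt_lift[of \<psi>] power2_eq_square algebra_simps)
  finally have psi1: "psiP vxi vpsi (Suc 0) p = exp (jw p 0) * lift (vder rho3 phi3 phi1 lam) p"
    by (simp only: XL_1_lift)
  have "{..2} = {0, Suc 0, 2::nat}" by auto
  then have "prol 2 vxi veta vpsi (\<lambda>q. jw q 1 - lift lam q) p =
     psiP vxi vpsi (Suc 0) p - (vxi p * lift (pd3 CT lam) p + eta vxi veta 0 p * lift (pd3 CX lam) p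
       + eta vxi veta (Suc 0) p * lift (pd3 CX1 lam) p)"
    by (simp add: prol_def pd_w1_equation[OF p, unfolded One_nat_def] del: psiP.simps eta.simps)
  \<comment> \<open>Both parts equal e^w times the \<lambda>-prolongation applied to
    \<lambda>.\<close>
  also have "\<dots> = 0"
    using eta_eq_phiL_1[OF p \<Delta>'(2), of 0] eta_eq_phiL_1[OF p \<Delta>'(2), of "Suc 0"]
    unfolding psi1 phiL_1 by (simp add: lift_fibre) (simp add: lift_def vder_def algebra_simps)
  finally show "prol 2 vxi veta vpsi (\<lambda>q. jw q 1 - lift lam q) p = 0" .
qed

text \<open>\<open>rho\<close> and \<open>phi0\<close> do not depend on x_1, so A acts on them as
  D_t does; written with A, the coefficient has the form that the bracket identity needs.\<close>

lemma phi1_eq_Aop: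
  "phi1 t x y = Aop F phi3 t x y - Aop F rho3 t x y * y + lam t x y * (phi3 t x y - rho3 t x y * y)"
  by (simp add: phi1_def pa_def pb_def vder_def algebra_simps)

lemma lambda_symmetry_vder:
  assumes ls: "lambda_symmetry U F lam rho phi0" and q: "(t, x, y) \<in> U"
  shows "vder rho3 phi3 phi1 F t x y =
        Aop F phi1 t x y - Aop F rho3 t x y * F t x y + lam t x y * (phi1 t x y - rho3 t x y * F t x y)"
proof -
  \<comment> \<open>A jet over (t, x, y) on the equation: x_2 is \<open>F t x y\<close>, while the
    higher x-coordinates and the w-coordinates do not enter and are filled arbitrarily.\<close>
  define p :: jet where "p = (t, (\<lambda>i. if i = 0 then x else if i = 1 then y else F t x y), (\<lambda>_. 0))"
  have p: "jt p = t" "jx p 0 = x" "jx p (Suc 0) = y" "jx p 2 = F t x y" by (simp_all add: p_def)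
  have "base p \<in> U" using q by (simp add: base_def p)
  moreover have "jx p 2 = lift F p" by (simp add: lift_def p)
  ultimately have "phiL lam rho phi0 2 p = lift (vder rho3 phi3 phi1 F) p"
    using ls[unfolded lambda_symmetry_def, rule_format, of p] XL_2_equation by simp
  then show ?thesis
    unfolding phiL_2 by (simp add: Dt_lift lift_def p vder_def algebra_simps)
qed

lemma base_jet_at [simp]: "base (jet_at q) = q"
  by (simp add: base_def jet_at_def)

lemma prol_invariants:
  assumes V: "V \<subseteq> U"
    and inv: "\<And>t x y. (t, x, y) \<in> V \<Longrightarrow> vder rho3 phi3 phi1 (\<lambda>t x y. z t x) t x y = 0"
      "\<And>t x y. (t, x, y) \<in> V \<Longrightarrow> vder rho3 phi3 phi1 \<zeta> t x y = 0"
    and p: "base p \<in> V"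
  shows "prol 0 vxi veta vpsi (lift (\<lambda>t x y. z t x)) p = 0"
    "inDelta F lam p \<Longrightarrow> prol 1 vxi veta vpsi (lift \<zeta>) p = 0"
proof -
  have pU: "base p \<in> U" using p V by blast
  have q: "(jt p, jx p 0, jx p 1) \<in> V" using p by (simp add: base_def)
  have "prol 0 vxi veta vpsi (lift (\<lambda>t x y. z t x)) p = exp (jw p 0) * XL 0 lam rho phi0 (lift (\<lambda>t x y. z t x)) p"
    by (rule prol_eq_XL) (simp_all add: lift_fibre)
  then show "prol 0 vxi veta vpsi (lift (\<lambda>t x y. z t x)) p = 0"
    unfolding XL_0_lift using inv(1)[OF q] by (simp add: lift_def)
  assume \<Delta>: "inDelta F lam p"
  have "prol 1 vxi veta vpsi (lift \<zeta>) p = exp (jw p 0) * XL 1 lam rho phi0 (lift \<zeta>) p"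
    by (rule prol_eq_XL[OF eta_eq_phiL_1[OF pU]]) (use \<Delta> in \<open>simp_all add: inDelta_def\<close>)
  then show "prol 1 vxi veta vpsi (lift \<zeta>) p = 0"
    unfolding XL_1_lift using inv(2)[OF q] by (simp add: lift_def)
qed

lemma ode_form_near:
  assumes ls: "lambda_symmetry U F lam rho phi0"
    and V: "open V" "V \<subseteq> U" "(t0, x0, y0) \<in> V"
    and sV: "smooth3 V (\<lambda>t x y. z t x)" "smooth3 V \<zeta>"
    and inv: "\<And>t x y. (t, x, y) \<in> V \<Longrightarrow> vder rho3 phi3 phi1 (\<lambda>t x y. z t x) t x y = 0"
      "\<And>t x y. (t, x, y) \<in> V \<Longrightarrow> vder rho3 phi3 phi1 \<zeta> t x y = 0"
    and \<zeta>y: "\<And>t x y. (t, x, y) \<in> V \<Longrightarrow> pd3 CX1 \<zeta> t x y \<noteq> 0"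
    and A0: "Aop F (\<lambda>t x y. z t x) t0 x0 y0 \<noteq> 0" and X0: "rho t0 x0 \<noteq> 0 \<or> phi0 t0 x0 \<noteq> 0"
  obtains W where "open W" "(t0, x0, y0) \<in> W" "W \<subseteq> V" "ode_form W F (lift (\<lambda>t x y. z t x)) (lift \<zeta>)"
proof -
  have sub: "smooth3 V f" if "smooth3 U f" for f
    using that V(2) smooth_on_subset unfolding smooth3_iff_smooth_on[OF U] smooth3_iff_smooth_on[OF V(1)] by blast
  show ?thesis
  proof (rule ode_form_of_invariants[OF V(1,3) sub[OF s(1)] sub[OF s(4)] sub[OF s(5)] sub[OF smooth3_phi1(3)] sV
        phi1_eq_Aop _ inv \<zeta>y])
    fix t x y assume "(t, x, y) \<in> V"
    then have "(t, x, y) \<in> U" using V(2) by blast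
    then show "vder rho3 phi3 phi1 F t x y =
        Aop F phi1 t x y - Aop F rho3 t x y * F t x y + lam t x y * (phi1 t x y - rho3 t x y * F t x y)"
      by (rule lambda_symmetry_vder[OF ls])
  qed (use A0 X0 that in auto)
qed

lemma vder_eq_derivative:
  assumes "(unc f has_derivative D) (at (t, x, y))"
  shows "vder a b c f t x y = D (a t x y, b t x y, c t x y)"
proof -
  have l: "linear D" using assms has_derivative_linear by blast
  have "D (a t x y, b t x y, c t x y) = D (a t x y *\<^sub>R (1, 0, 0) + (b t x y *\<^sub>R (0, 1, 0) + c t x y *\<^sub>R (0, 0, 1)))"
    by simp
  also have "\<dots> = a t x y * D (1, 0, 0) + (b t x y * D (0, 1, 0) + c t x y * D (0, 0, 1))"
    using l by (simp only: linear_add linear_cmul real_scaleR_def)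
  finally show ?thesis by (simp add: vder_def pd3_eq_derivative[OF assms])
qed

lemma nonlocal_symmetryI:
  assumes ls: "lambda_symmetry U F lam rho phi0" and gs: "gen_symmetry U F lam vxi veta vpsi"
    and nz: "(t0, x0, y0) \<in> U" "rho t0 x0 \<noteq> 0 \<or> phi0 t0 x0 \<noteq> 0"
  shows "nonlocal_symmetry U F lam vxi veta vpsi"
proof -
  obtain N and z :: "real \<Rightarrow> real \<Rightarrow> real" and \<zeta> :: "real \<Rightarrow> real \<Rightarrow> real \<Rightarrow> real" and P Q
    where *: "open N" "N \<subseteq> U" "(t0, x0, y0) \<in> N"
    "smooth_on N (\<lambda>(t, x, y). z t x)" "smooth_on N (unc \<zeta>)"
    "\<And>q. q \<in> N \<Longrightarrow> ((\<lambda>(t, x, y). z t x) has_derivative P q) (at q)"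
    "\<And>q. q \<in> N \<Longrightarrow> (unc \<zeta> has_derivative Q q) (at q)"
    "\<And>t x y. (t, x, y) \<in> N \<Longrightarrow> P (t, x, y) (rho t x, phi0 t x, phi1 t x y) = 0 \<and> Q (t, x, y) (rho t x, phi0 t x, phi1 t x y) = 0
        \<and> (P (t, x, y) (1, 0, 0) \<noteq> 0 \<or> P (t, x, y) (0, 1, 0) \<noteq> 0) \<and> Q (t, x, y) (0, 0, 1) \<noteq> 0"
    using first_integrals[OF U nz(1) s(4)[unfolded smooth3_iff_smooth_on[OF U]] s(5)[unfolded smooth3_iff_smooth_on[OF U]]
        smooth3_phi1(3)[unfolded smooth3_iff_smooth_on[OF U]] nz(2)] by blast
  let ?Z = "\<lambda>t x y :: real. z t x"
  have sN: "smooth3 N ?Z" "smooth3 N \<zeta>" using *(4,5) by (simp_all add: smooth3_iff_smooth_on[OF *(1)])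
  have inv: "vder rho3 phi3 phi1 ?Z t x y = 0" "vder rho3 phi3 phi1 \<zeta> t x y = 0" if "(t, x, y) \<in> N" for t x y
    using vder_eq_derivative[OF *(6)[OF that]] vder_eq_derivative[OF *(7)[OF that]] *(8)[OF that] by simp_all
  have \<zeta>y: "pd3 CX1 \<zeta> t x y \<noteq> 0" if "(t, x, y) \<in> N" for t x y
    using pd3_eq_derivative[OF *(7)[OF that]] *(8)[OF that] by simp
  have zg: "pd3 CT ?Z t x y \<noteq> 0 \<or> pd3 CX ?Z t x y \<noteq> 0" if "(t, x, y) \<in> N" for t x y
    using pd3_eq_derivative[OF *(6)[OF that]] *(8)[OF that] by simp
  \<comment> \<open>Here A z = z_t + x_1 z_x. If it vanishes at \<open>y0\<close> then z_x does not,
    since otherwise z_t would vanish too; shifting x_1 by \<open>r/2\<close> inside the ball then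
    gives a nonzero value.\<close>
  obtain y1 where y1: "(t0, x0, y1) \<in> N" "Aop F ?Z t0 x0 y1 \<noteq> 0"
  proof (cases "Aop F ?Z t0 x0 y0 = 0")
    case False then show ?thesis using that *(3) by blast
  next
    case True
    obtain r where r: "r > 0" "ball (t0, x0, y0) r \<subseteq> N" using *(1,3) openE by blast
    have "(t0, x0, y0 + r/2) \<in> ball (t0, x0, y0) r" using r by (simp add: dist_Pair_Pair dist_real_def)
    then have N1: "(t0, x0, y0 + r/2) \<in> N" using r by blast
    have indep: "pd3 CT ?Z t x y = pd3 CT ?Z t x y0" "pd3 CX ?Z t x y = pd3 CX ?Z t x y0" for t x y
      by (simp_all add: pd3_def)
    have "Aop F ?Z t0 x0 (y0 + r/2) = Aop F ?Z t0 x0 y0 + r/2 * pd3 CX ?Z t0 x0 y0"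
      by (simp add: vder_def indep[of t0 x0 "y0 + r/2"] algebra_simps)
    moreover have "pd3 CX ?Z t0 x0 y0 \<noteq> 0"
      using True zg[OF *(3)] by (auto simp: vder_def)
    ultimately have "Aop F ?Z t0 x0 (y0 + r/2) \<noteq> 0" using True r(1) by auto
    then show ?thesis by (rule that[OF N1])
  qed
  obtain W where W: "open W" "(t0, x0, y1) \<in> W" "W \<subseteq> N" "ode_form W F (lift ?Z) (lift \<zeta>)"
    using ode_form_near[OF ls *(1,2) y1(1) sN inv \<zeta>y y1(2) nz(2)] by blast
  have sW: "smooth3 W ?Z" "smooth3 W \<zeta>"
    using *(4,5) W(3) by (simp_all add: smooth3_iff_smooth_on[OF W(1)] smooth_on_subset)
  have fi: "func_indep W ?Z \<zeta>"
    unfolding func_indep_def using zg \<zeta>y W(3) by fastforce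
  have pr: "prol 0 vxi veta vpsi (lift ?Z) p = 0" "inDelta F lam p \<Longrightarrow> prol 1 vxi veta vpsi (lift \<zeta>) p = 0"
    if "base p \<in> W" for p
    by (rule prol_invariants[OF *(2) inv]; use that W(3) in blast)+
  \<comment> \<open>\<open>jet_at\<close> sets w = 0, so the derivative of e^w is 1 there and the
    two coefficients have w-derivatives \<open>rho\<close> and \<open>phi0\<close>.\<close>
  have w: "\<exists>p. base p \<in> U \<and> (pdw 0 vxi p)\<^sup>2 + (pdw 0 veta p)\<^sup>2 \<noteq> 0"
  proof (intro exI[of _ "jet_at (t0, x0, y0)"] conjI)
    have "pdw 0 (\<lambda>p. exp (jw p 0) * f (jt p) (jx p 0)) (jet_at (t0, x0, y0)) = f t0 x0" for f :: "real \<Rightarrow> real \<Rightarrow> real"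
      unfolding pdw_def jet_at_def
      by (rule DERIV_imp_deriv) (simp, (rule derivative_eq_intros refl | simp)+)
    then show "(pdw 0 vxi (jet_at (t0, x0, y0)))\<^sup>2 + (pdw 0 veta (jet_at (t0, x0, y0)))\<^sup>2 \<noteq> 0"
      using nz(2) by (simp add: sum_power2_eq_zero_iff)
  qed (use nz in simp)
  show ?thesis
    unfolding nonlocal_symmetry_def
  proof (intro conjI gs w exI[of _ W] exI[of _ z] exI[of _ \<zeta>] allI impI W(1) sW fi pr W(4))
    show "W \<noteq> {}" "W \<subseteq> U" using W(2,3) *(2) by auto
    show "\<forall>(t, x, y)\<in>W. pd3 CX1 \<zeta> t x y \<noteq> 0" using \<zeta>y W(3) by blast
  qed blast+
qed

lemma reduction_of_invariants:
  assumes ls: "lambda_symmetry U F lam rho phi0"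
    and V: "open V" "V \<subseteq> U"
    and sV: "smooth3 V (\<lambda>t x y. z t x)" "smooth3 V \<zeta>"
    and XL: "\<And>p. base p \<in> V \<Longrightarrow> XL 1 lam rho phi0 (lift (\<lambda>t x y. z t x)) p = 0 \<and> XL 1 lam rho phi0 (lift \<zeta>) p = 0"
    and \<zeta>y: "\<And>t x y. (t, x, y) \<in> V \<Longrightarrow> pd3 CX1 \<zeta> t x y \<noteq> 0"
  shows "(\<forall>p. base p \<in> V \<longrightarrow> prol 0 vxi veta vpsi (lift (\<lambda>t x y. z t x)) p = 0) \<and>
        (\<forall>p. base p \<in> V \<and> inDelta F lam p \<longrightarrow> prol 1 vxi veta vpsi (lift \<zeta>) p = 0) \<and>
        (\<forall>q \<in> V. Dt (lift (\<lambda>t x y. z t x)) (jet_at q) \<noteq> 0 \<and>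
            (rho (fst q) (fst (snd q)) \<noteq> 0 \<or> phi0 (fst q) (fst (snd q)) \<noteq> 0
              \<or> phiL lam rho phi0 1 (jet_at q) \<noteq> 0) \<longrightarrow>
          (\<exists>W. open W \<and> q \<in> W \<and> W \<subseteq> V \<and> ode_form W F (lift (\<lambda>t x y. z t x)) (lift \<zeta>)))"
proof -
  let ?Z = "\<lambda>t x y :: real. z t x"
  have lj: "lift f (jet_at (t, x, y)) = f t x y" for f t x y by (simp add: lift_def jet_at_def)
  have inv: "vder rho3 phi3 phi1 ?Z t x y = 0" "vder rho3 phi3 phi1 \<zeta> t x y = 0" if "(t, x, y) \<in> V" for t x y
    using XL[of "jet_at (t, x, y)"] that unfolding XL_1_lift lj by simp_all
  have "\<exists>W. open W \<and> (t, x, y) \<in> W \<and> W \<subseteq> V \<and> ode_form W F (lift ?Z) (lift \<zeta>)"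
    if q: "(t, x, y) \<in> V" and D: "Dt (lift ?Z) (jet_at (t, x, y)) \<noteq> 0"
      and X: "rho t x \<noteq> 0 \<or> phi0 t x \<noteq> 0 \<or> phiL lam rho phi0 1 (jet_at (t, x, y)) \<noteq> 0" for t x y
  proof -
    have "Dt (lift ?Z) (jet_at (t, x, y)) = Aop F ?Z t x y"
      unfolding Dt_lift lj by (simp add: jet_at_def vder_def)
    then have A0: "Aop F ?Z t x y \<noteq> 0" using D by simp
    have "phiL lam rho phi0 1 (jet_at (t, x, y)) = phi1 t x y" unfolding One_nat_def phiL_1 lj ..
    \<comment> \<open>If \<open>rho\<close> and \<open>phi0\<close> both vanished, invariance of
      \<zeta> would read \<open>phi1\<close> \<zeta>_{x_1} = 0, so that \<open>phi1\<close> would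
      vanish as well, and with it the whole prolonged field.\<close>
    then have "rho t x \<noteq> 0 \<or> phi0 t x \<noteq> 0"
      using X inv(2)[OF q] \<zeta>y[OF q] by (auto simp: vder_def)
    from ode_form_near[OF ls V q sV inv \<zeta>y A0 this] show ?thesis by blast
  qed
  note red = this
  show ?thesis
  proof (intro conjI allI ballI impI)
    fix p assume "base p \<in> V"
    then show "prol 0 vxi veta vpsi (lift ?Z) p = 0" by (intro prol_invariants(1)[where \<zeta>=\<zeta>, OF V(2)] inv)
  next
    fix p assume "base p \<in> V \<and> inDelta F lam p"
    then show "prol 1 vxi veta vpsi (lift \<zeta>) p = 0" by (intro prol_invariants(2)[where z=z, OF V(2)] inv) auto
  next
    fix q assume q: "q \<in> V" and D: "Dt (lift ?Z) (jet_at q) \<noteq> 0 \<and>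
            (rho (fst q) (fst (snd q)) \<noteq> 0 \<or> phi0 (fst q) (fst (snd q)) \<noteq> 0
              \<or> phiL lam rho phi0 1 (jet_at q) \<noteq> 0)"
    obtain t x y where txy: "q = (t, x, y)" by (metis prod.exhaust)
    show "\<exists>W. open W \<and> q \<in> W \<and> W \<subseteq> V \<and> ode_form W F (lift ?Z) (lift \<zeta>)"
      unfolding txy by (rule red) (use q D in \<open>simp_all only: txy fst_conv snd_conv simp_thms\<close>)
  qed
qed

end

theorem theorem5p1:
  fixes \<Omega> :: "(real \<times> real \<times> real) set"
    and F lam \<psi> :: "real \<Rightarrow> real \<Rightarrow> real \<Rightarrow> real"
    and rho phi0 :: "real \<Rightarrow> real \<Rightarrow> real"
  defines "xi \<equiv> (\<lambda>p. exp (jw p 0) * rho (jt p) (jx p 0))"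
    and "eta0 \<equiv> (\<lambda>p. exp (jw p 0) * phi0 (jt p) (jx p 0))"
    and "psi0 \<equiv> (\<lambda>p. exp (jw p 0) * \<psi> (jt p) (jx p 0) (jx p 1))"
  assumes "open \<Omega>"
    and "smooth3 \<Omega> F" and "smooth3 \<Omega> lam" and "smooth3 \<Omega> \<psi>"
    and "smooth3 \<Omega> (\<lambda>t x y. rho t x)" and "smooth3 \<Omega> (\<lambda>t x y. phi0 t x)"
    and "\<exists>(t, x, y) \<in> \<Omega>. rho t x \<noteq> 0 \<or> phi0 t x \<noteq> 0"
    and "lambda_symmetry \<Omega> F lam rho phi0"
    and "\<forall>p. base p \<in> \<Omega> \<longrightarrow>
           pdt (lift \<psi>) p + pdx 0 (lift \<psi>) p * jx p 1 + pdx 1 (lift \<psi>) p * lift F p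
             + lift \<psi> p * lift lam p
           = Dt (lift (\<lambda>t x y. rho t x)) p * lift lam p
             + lift (\<lambda>t x y. rho t x) p * (lift lam p)\<^sup>2
             + XL 1 lam rho phi0 (lift lam) p"
  shows "(gen_symmetry \<Omega> F lam xi eta0 psi0 \<and> nonlocal_symmetry \<Omega> F lam xi eta0 psi0) \<and>
    (\<forall>V (z :: real \<Rightarrow> real \<Rightarrow> real) (\<zeta> :: real \<Rightarrow> real \<Rightarrow> real \<Rightarrow> real).
        open V \<and> V \<subseteq> \<Omega> \<and>
        smooth3 V (\<lambda>t x y. z t x) \<and> smooth3 V \<zeta> \<and>
        func_indep V (\<lambda>t x y. z t x) \<zeta> \<and>
        (\<forall>p. base p \<in> V \<longrightarrow> XL 1 lam rho phi0 (lift (\<lambda>t x y. z t x)) p = 0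
                              \<and> XL 1 lam rho phi0 (lift \<zeta>) p = 0) \<and>
        (\<forall>(t, x, y) \<in> V. pd3 CX1 \<zeta> t x y \<noteq> 0)
      \<longrightarrow>
        (\<forall>p. base p \<in> V \<longrightarrow> prol 0 xi eta0 psi0 (lift (\<lambda>t x y. z t x)) p = 0) \<and>
        (\<forall>p. base p \<in> V \<and> inDelta F lam p \<longrightarrow> prol 1 xi eta0 psi0 (lift \<zeta>) p = 0) \<and>
        (\<forall>q \<in> V. Dt (lift (\<lambda>t x y. z t x)) (jet_at q) \<noteq> 0 \<and>
            (rho (fst q) (fst (snd q)) \<noteq> 0 \<or> phi0 (fst q) (fst (snd q)) \<noteq> 0
              \<or> phiL lam rho phi0 1 (jet_at q) \<noteq> 0) \<longrightarrow>
          (\<exists>W. open W \<and> q \<in> W \<and> W \<subseteq> V \<and>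
               ode_form W F (lift (\<lambda>t x y. z t x)) (lift \<zeta>))))"
proof -
  obtain t0 x0 y0 where nz: "(t0, x0, y0) \<in> \<Omega>" "rho t0 x0 \<noteq> 0 \<or> phi0 t0 x0 \<noteq> 0"
    using assms(10) by auto
  note s = assms(4-9)
  have gs: "gen_symmetry \<Omega> F lam xi eta0 psi0"
    unfolding xi_def eta0_def psi0_def by (rule gen_symmetryI[OF s assms(11,12)])
  have ns: "nonlocal_symmetry \<Omega> F lam xi eta0 psi0"
    unfolding xi_def eta0_def psi0_def
    by (rule nonlocal_symmetryI[OF s assms(11) gs[unfolded xi_def eta0_def psi0_def] nz])
  note red = reduction_of_invariants[OF s assms(11), folded xi_def eta0_def psi0_def]
  show ?thesis
  proof (rule conjI[OF conjI[OF gs ns]], intro allI impI, elim conjE, goal_cases)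
    case (1 V z \<zeta>)
    show ?case
      by (rule red[OF 1(1-4) 1(6)[rule_format]]) (use 1(7) in auto)
  qed
qed

end
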